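(* The dendriform descent algebra $\mathbf{Descd}$ is a sub bidendriform bialgebra of $\mathbf{S}$; that is, $\mathbf{Descd}_+$ is stable under $\prec$ and $\succ$ and $\Delta_\prec(\mathbf{Descd}_+)\subseteq\mathbf{Descd}_+\otimes\mathbf{Descd}_+$, $\Delta_\succ(\mathbf{Descd}_+)\subseteq\mathbf{Descd}_+\otimes\mathbf{Descd}_+$. In particular, it is a free dendriform algebra over its dendriform primitive elements: $\mathbf{Descd}_+$ is freely generated, as a dendriform algebra, by the subspace $\mathrm{Ker}(\Delta_\prec)\cap\mathrm{Ker}(\Delta_\succ)\cap\mathbf{Descd}_+$.
   Context: The ground field is $\mathbf{Q}$, $\mathbb{N}^*=\{1,2,\dots\}$, $[k]=\{1,\dots,k\}$. Dendriform algebra: a vector space with two bilinear products $\prec,\succ$ such that, with $\ast=\prec+\succ$, $(x\prec y)\prec z=x\prec(y\ast z)$, $(x\succ y)\prec z=x\succ(y\prec z)$, $(x\ast y)\succ z=x\succ(y\succ z)$. Graded permutations: $\mathbf{S}$ is the vector space with basis the pairs $(\sigma,d)$, $\sigma\in\mathfrak{S}_k$, $d:[k]\to\mathbb{N}^*$, $k\ge 0$; $(\sigma,d)$ is written as the biword $\begin{pmatrix}\sigma(1)&\ldots&\sigma(k)\\ d(1)&\ldots&d(k)\end{pmatrix}$. Let $1$ be the empty biword ($k=0$) and $\mathbf{S}_+$ the span of the biwords with $k\ge 1$. For $(\sigma,d)$ of length $k\ge1$ and $(\tau,e)$ of length $l\ge1$, $$(\sigma,d)\prec(\tau,e)=\sum_{\alpha}((\sigma\otimes\tau)\circ\alpha^{-1},(d\otimes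 e)\circ\alpha^{-1}),$$ the sum being over permutations $\alpha\in\mathfrak{S}_{k+l}$ with $\alpha(1)<\dots<\alpha(k)$, $\alpha(k+1)<\dots<\alpha(k+l)$ and $\alpha^{-1}(1)=1$; $(\sigma,d)\succ(\tau,e)$ is the same sum with $\alpha^{-1}(1)=k+1$ instead. Here $(\sigma\otimes\tau)(i)=\sigma(i)$ for $i\le k$, $(\sigma\otimes\tau)(i)=\tau(i-k)+k$ for $i>k$, and $(d\otimes e)(i)=d(i)$ for $i\le k$, $(d\otimes e)(i)=e(i-k)$ for $i>k$. With these products $\mathbf{S}_+$ is a dendriform algebra. Coproducts on $\mathbf{S}_+$: for $(\sigma,d)$ with $\sigma\in\mathfrak{S}_n$, $n\ge1$, $$\Delta_\prec((\sigma,d))=\sum_{i=\sigma^{-1}(1)}^{n-1}\begin{pmatrix}std(\sigma(1),\ldots,\sigma(i))\\ d(1),\ldots,d(i)\end{pmatrix}\otimes\begin{pmatrix}std(\sigma(i+1),\ldots,\sigma(n))\\ d(i+1),\ldots,d(n)\end{pmatrix},$$ and $\Delta_\succ((\sigma,d))$ is the same sum over $1\le i\le\sigma^{-1}(1)-1$. Here $std(i_1,\dots,i_k)=(f(i_1),\dots,f(i_k))$, $f$ being the increasing bijection $\{i_1,\dots,i_k\}\to[k]$. (Up to passing to opposite products and coproducts, $\mathbf{S}_+$ with this structure is a bidendriform bialgebra; a sub bidendriform bialgebra is a subspace stable under both products and both coproducts.) Dendriform descent algebra: for $n\ge1$, $p_n=\sum_{k=1}^n\sum_{d(1)+\dots+d(k)=n}\begin{pmatrix}1&\ldots&k\\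 d(1)&\ldots&d(k)\end{pmatrix}$ (sum over $d:[k]\to\mathbb{N}^*$), and $p_0=1$. $\mathbf{Descd}\subseteq\mathbf{S}$ is the dendriform subalgebra generated by the $p_n$, $n\ge0$; thus $\mathbf{Descd}=\mathbf{Q}1\oplus\mathbf{Descd}_+$, where $\mathbf{Descd}_+\subseteq\mathbf{S}_+$ is the dendriform subalgebra generated by the $p_n$, $n\ge1$. *)

theory Defs
  imports
    "HOL.Vector_Spaces"
    "HOL.Hull"
    "HOL.Rat"
    "HOL-Library.FuncSet"
    "HOL-Library.Poly_Mapping"
    "HOL-Combinatorics.Permutations"
begin

section \<open>Dendriform algebras\<close>

text \<open>The carrier is a subspace \<open>A\<close> of an ambient rational vector space, so that subalgebras
  need no type of their own.\<close>

locale dendriform_algebra = vector_space scale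
  for scale :: "rat \<Rightarrow> 'a::ab_group_add \<Rightarrow> 'a" +
  fixes A :: "'a set" and lt gt :: "'a \<Rightarrow> 'a \<Rightarrow> 'a"
  assumes carrier_subspace: "subspace A"
    and lt_closed: "x \<in> A \<Longrightarrow> y \<in> A \<Longrightarrow> lt x y \<in> A"
    and gt_closed: "x \<in> A \<Longrightarrow> y \<in> A \<Longrightarrow> gt x y \<in> A"
    and lt_add_left: "x \<in> A \<Longrightarrow> y \<in> A \<Longrightarrow> z \<in> A \<Longrightarrow> lt (x + y) z = lt x z + lt y z"
    and lt_add_right: "x \<in> A \<Longrightarrow> y \<in> A \<Longrightarrow> z \<in> A \<Longrightarrow> lt x (y + z) = lt x y + lt x z"
    and lt_scale_left: "x \<in> A \<Longrightarrow> y \<in> A \<Longrightarrow> lt (scale c x) y = scale c (lt x y)"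
    and lt_scale_right: "x \<in> A \<Longrightarrow> y \<in> A \<Longrightarrow> lt x (scale c y) = scale c (lt x y)"
    and gt_add_left: "x \<in> A \<Longrightarrow> y \<in> A \<Longrightarrow> z \<in> A \<Longrightarrow> gt (x + y) z = gt x z + gt y z"
    and gt_add_right: "x \<in> A \<Longrightarrow> y \<in> A \<Longrightarrow> z \<in> A \<Longrightarrow> gt x (y + z) = gt x y + gt x z"
    and gt_scale_left: "x \<in> A \<Longrightarrow> y \<in> A \<Longrightarrow> gt (scale c x) y = scale c (gt x y)"
    and gt_scale_right: "x \<in> A \<Longrightarrow> y \<in> A \<Longrightarrow> gt x (scale c y) = scale c (gt x y)"
    and dendriform_lt: "x \<in> A \<Longrightarrow> y \<in> A \<Longrightarrow> z \<in> A \<Longrightarrow> lt (lt x y) z = lt x (lt y z + gt y z)"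
    and dendriform_mid: "x \<in> A \<Longrightarrow> y \<in> A \<Longrightarrow> z \<in> A \<Longrightarrow> lt (gt x y) z = gt x (lt y z)"
    and dendriform_gt: "x \<in> A \<Longrightarrow> y \<in> A \<Longrightarrow> z \<in> A \<Longrightarrow> gt (lt x y + gt x y) z = gt x (gt y z)"

definition dendriform_subalgebra ::
  "(rat \<Rightarrow> 'a::ab_group_add \<Rightarrow> 'a) \<Rightarrow> 'a set \<Rightarrow> ('a \<Rightarrow> 'a \<Rightarrow> 'a) \<Rightarrow> ('a \<Rightarrow> 'a \<Rightarrow> 'a) \<Rightarrow> 'a set \<Rightarrow> bool"
where
  "dendriform_subalgebra scale A lt gt B \<longleftrightarrow>
     module.subspace scale B \<and> B \<subseteq> A \<and> (\<forall>x\<in>B. \<forall>y\<in>B. lt x y \<in> B \<and> gt x y \<in> B)"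

definition generated_dendriform ::
  "(rat \<Rightarrow> 'a::ab_group_add \<Rightarrow> 'a) \<Rightarrow> 'a set \<Rightarrow> ('a \<Rightarrow> 'a \<Rightarrow> 'a) \<Rightarrow> ('a \<Rightarrow> 'a \<Rightarrow> 'a) \<Rightarrow> 'a set \<Rightarrow> 'a set"
where
  "generated_dendriform scale A lt gt G = dendriform_subalgebra scale A lt gt hull G"

definition linear_map_on ::
  "(rat \<Rightarrow> 'a::ab_group_add \<Rightarrow> 'a) \<Rightarrow> 'a set \<Rightarrow>
   (rat \<Rightarrow> 'b::ab_group_add \<Rightarrow> 'b) \<Rightarrow> 'b set \<Rightarrow> ('a \<Rightarrow> 'b) \<Rightarrow> bool"
where
  "linear_map_on scale V scale' W f \<longleftrightarrow>
     f \<in> V \<rightarrow> W \<and>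
     (\<forall>x\<in>V. \<forall>y\<in>V. f (x + y) = f x + f y) \<and>
     (\<forall>c. \<forall>x\<in>V. f (scale c x) = scale' c (f x))"

definition dendriform_hom ::
  "(rat \<Rightarrow> 'a::ab_group_add \<Rightarrow> 'a) \<Rightarrow> 'a set \<Rightarrow> ('a \<Rightarrow> 'a \<Rightarrow> 'a) \<Rightarrow> ('a \<Rightarrow> 'a \<Rightarrow> 'a) \<Rightarrow>
   (rat \<Rightarrow> 'b::ab_group_add \<Rightarrow> 'b) \<Rightarrow> 'b set \<Rightarrow> ('b \<Rightarrow> 'b \<Rightarrow> 'b) \<Rightarrow> ('b \<Rightarrow> 'b \<Rightarrow> 'b) \<Rightarrow>
   ('a \<Rightarrow> 'b) \<Rightarrow> bool"
where
  "dendriform_hom scale A lt gt scale' B lt' gt' f \<longleftrightarrow>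
     linear_map_on scale A scale' B f \<and>
     (\<forall>x\<in>A. \<forall>y\<in>A. f (lt x y) = lt' (f x) (f y) \<and> f (gt x y) = gt' (f x) (f y))"

text \<open>The dendriform algebra \<open>A\<close> is freely generated by its subspace \<open>V\<close>: it is generated by
  \<open>V\<close>, and every linear map from \<open>V\<close> to a dendriform algebra extends uniquely to a morphism.
  HOL cannot quantify over types inside a formula, so the type in which the target algebras
  live is a parameter; a theorem with an arbitrary type \<open>'b\<close> in this place covers all of them.
  Morphisms are taken in \<open>extensional A\<close>, so that uniqueness means uniqueness on \<open>A\<close>.\<close>

definition freely_generated_dendriform ::
  "'b::ab_group_add itself \<Rightarrow>
   (rat \<Rightarrow> 'a::ab_group_add \<Rightarrow> 'a) \<Rightarrow> 'a set \<Rightarrow> ('a \<Rightarrow> 'a \<Rightarrow> 'a) \<Rightarrow> ('a \<Rightarrow> 'a \<Rightarrow> 'a) \<Rightarrow> 'a set \<Rightarrow> bool"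
where
  "freely_generated_dendriform T scale A lt gt V \<longleftrightarrow>
     dendriform_algebra scale A lt gt \<and>
     module.subspace scale V \<and> V \<subseteq> A \<and>
     generated_dendriform scale A lt gt V = A \<and>
     (\<forall>(scale' :: rat \<Rightarrow> 'b \<Rightarrow> 'b) B lt' gt' f.
        dendriform_algebra scale' B lt' gt' \<longrightarrow>
        linear_map_on scale V scale' B f \<longrightarrow>
        (\<exists>!g. g \<in> extensional A \<and>
              dendriform_hom scale A lt gt scale' B lt' gt' g \<and>
              (\<forall>v\<in>V. g v = f v)))"


section \<open>Rational vector spaces with a given basis\<close>

definition scl :: "rat \<Rightarrow> ('k \<Rightarrow>\<^sub>0 rat) \<Rightarrow> ('k \<Rightarrow>\<^sub>0 rat)" where
  "scl c x = Poly_Mapping.map ((*) c) x"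

lemma lookup_scl [simp]: "Poly_Mapping.lookup (scl c x) k = c * Poly_Mapping.lookup x k"
  by (simp add: scl_def map.rep_eq when_def)

global_interpretation scl: vector_space scl
  by unfold_locales (auto intro!: poly_mapping_eqI simp: lookup_add algebra_simps)

abbreviation basis_vec :: "'k \<Rightarrow> ('k \<Rightarrow>\<^sub>0 rat)" where
  "basis_vec k \<equiv> Poly_Mapping.single k 1"

definition lin_ext :: "('k \<Rightarrow> ('l \<Rightarrow>\<^sub>0 rat)) \<Rightarrow> ('k \<Rightarrow>\<^sub>0 rat) \<Rightarrow> ('l \<Rightarrow>\<^sub>0 rat)" where
  "lin_ext f x = (\<Sum>u\<in>Poly_Mapping.keys x. scl (Poly_Mapping.lookup x u) (f u))"

definition bilin_ext ::
  "('k \<Rightarrow> 'l \<Rightarrow> ('m \<Rightarrow>\<^sub>0 rat)) \<Rightarrow> ('k \<Rightarrow>\<^sub>0 rat) \<Rightarrow> ('l \<Rightarrow>\<^sub>0 rat) \<Rightarrow> ('m \<Rightarrow>\<^sub>0 rat)" where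
  "bilin_ext f x y = lin_ext (\<lambda>u. lin_ext (f u) y) x"

text \<open>The tensor product of the spaces with bases \<open>'k\<close> and \<open>'l\<close> is the space with basis
  \<open>'k \<times> 'l\<close>, with \<open>u \<otimes> v\<close> being the pair \<open>(u, v)\<close> for basis elements.\<close>

definition tensor :: "('k \<Rightarrow>\<^sub>0 rat) \<Rightarrow> ('l \<Rightarrow>\<^sub>0 rat) \<Rightarrow> ('k \<times> 'l \<Rightarrow>\<^sub>0 rat)" where
  "tensor = bilin_ext (\<lambda>u v. basis_vec (u, v))"

definition tensor_space ::
  "('k \<Rightarrow>\<^sub>0 rat) set \<Rightarrow> ('l \<Rightarrow>\<^sub>0 rat) set \<Rightarrow> ('k \<times> 'l \<Rightarrow>\<^sub>0 rat) set" where
  "tensor_space A B = scl.span {tensor x y | x y. x \<in> A \<and> y \<in> B}"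


section \<open>Graded permutations\<close>

text \<open>The biword of \<open>(\<sigma>, d)\<close> is the pair of its rows, the lists
  \<open>[\<sigma>(1), \<dots>, \<sigma>(k)]\<close> and \<open>[d(1), \<dots>, d(k)]\<close>. The letters of \<open>\<sigma>\<close> range over \<open>{1..k}\<close>, whereas
  positions in a list are counted from 0.\<close>

type_synonym biword = "nat list \<times> nat list"

definition graded_perms :: "biword set" where
  "graded_perms = {(s, d). distinct s \<and> set s = {1..length s} \<and>
                           length d = length s \<and> (\<forall>a\<in>set d. 1 \<le> a)}"

definition S_plus :: "(biword \<Rightarrow>\<^sub>0 rat) set" where
  "S_plus = scl.span (basis_vec ` {w \<in> graded_perms. length (fst w) \<ge> 1})"

definition tensor_perm :: "nat list \<Rightarrow> nat list \<Rightarrow> nat list" where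
  "tensor_perm s t = s @ map (\<lambda>a. a + length s) t"

text \<open>A permutation \<open>\<alpha>\<close> of positions acts by \<open>u \<circ> \<alpha>\<^sup>-\<^sup>1 = permute_list (inv \<alpha>) u\<close>.\<close>

definition shuffles_perm :: "nat \<Rightarrow> nat \<Rightarrow> (nat \<Rightarrow> nat) set" where
  "shuffles_perm k l = {\<alpha>. \<alpha> permutes {..<k + l} \<and>
                            strict_mono_on {..<k} \<alpha> \<and> strict_mono_on {k..<k + l} \<alpha>}"

lemma finite_shuffles_perm: "finite (shuffles_perm k l)"
  by (rule finite_subset[OF _ finite_permutations[of "{..<k + l}"]]) (auto simp: shuffles_perm_def)

definition shuffle_term :: "biword \<Rightarrow> biword \<Rightarrow> (nat \<Rightarrow> nat) \<Rightarrow> biword" where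
  "shuffle_term u v \<alpha> =
     (permute_list (inv \<alpha>) (tensor_perm (fst u) (fst v)), permute_list (inv \<alpha>) (snd u @ snd v))"

text \<open>Of the products below only the restriction to \<open>S_plus\<close> is meaningful; the formulas are
  not the conventional ones when a factor is the empty biword.\<close>

definition lt_basis :: "biword \<Rightarrow> biword \<Rightarrow> (biword \<Rightarrow>\<^sub>0 rat)" where
  "lt_basis u v =
     (\<Sum>\<alpha> | \<alpha> \<in> shuffles_perm (length (fst u)) (length (fst v)) \<and> inv \<alpha> 0 = 0.
        basis_vec (shuffle_term u v \<alpha>))"

definition gt_basis :: "biword \<Rightarrow> biword \<Rightarrow> (biword \<Rightarrow>\<^sub>0 rat)" where
  "gt_basis u v =
     (\<Sum>\<alpha> | \<alpha> \<in> shuffles_perm (length (fst u)) (length (fst v)) \<and> inv \<alpha> 0 = length (fst u).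
        basis_vec (shuffle_term u v \<alpha>))"

definition lt_S :: "(biword \<Rightarrow>\<^sub>0 rat) \<Rightarrow> (biword \<Rightarrow>\<^sub>0 rat) \<Rightarrow> (biword \<Rightarrow>\<^sub>0 rat)" where
  "lt_S = bilin_ext lt_basis"

definition gt_S :: "(biword \<Rightarrow>\<^sub>0 rat) \<Rightarrow> (biword \<Rightarrow>\<^sub>0 rat) \<Rightarrow> (biword \<Rightarrow>\<^sub>0 rat)" where
  "gt_S = bilin_ext gt_basis"

definition std :: "nat list \<Rightarrow> nat list" where
  "std s = map (\<lambda>a. card {b \<in> set s. b \<le> a}) s"

text \<open>The number \<open>\<sigma>\<^sup>-\<^sup>1(1)\<close>, a position counted from 1.\<close>

definition pos_one :: "nat list \<Rightarrow> nat" where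
  "pos_one s = (THE i. i \<in> {1..length s} \<and> s ! (i - 1) = 1)"

definition cut :: "biword \<Rightarrow> nat \<Rightarrow> biword \<times> biword" where
  "cut u i = ((std (take i (fst u)), take i (snd u)), (std (drop i (fst u)), drop i (snd u)))"

definition cop_lt :: "(biword \<Rightarrow>\<^sub>0 rat) \<Rightarrow> (biword \<times> biword \<Rightarrow>\<^sub>0 rat)" where
  "cop_lt = lin_ext (\<lambda>u. \<Sum>i = pos_one (fst u)..<length (fst u). basis_vec (cut u i))"

definition cop_gt :: "(biword \<Rightarrow>\<^sub>0 rat) \<Rightarrow> (biword \<times> biword \<Rightarrow>\<^sub>0 rat)" where
  "cop_gt = lin_ext (\<lambda>u. \<Sum>i = 1..<pos_one (fst u). basis_vec (cut u i))"

definition sub_bidendriform :: "(biword \<Rightarrow>\<^sub>0 rat) set \<Rightarrow> bool" where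
  "sub_bidendriform A \<longleftrightarrow>
     dendriform_subalgebra scl S_plus lt_S gt_S A \<and>
     cop_lt ` A \<subseteq> tensor_space A A \<and> cop_gt ` A \<subseteq> tensor_space A A"


section \<open>The dendriform descent algebra\<close>

definition p_gen :: "nat \<Rightarrow> (biword \<Rightarrow>\<^sub>0 rat)" where
  "p_gen n = (\<Sum>k = 1..n. \<Sum>d | length d = k \<and> (\<forall>a\<in>set d. 1 \<le> a) \<and> sum_list d = n.
            basis_vec ([1..<k + 1], d))"

lemma finite_compositions:
  "finite {d :: nat list. length d = k \<and> (\<forall>a\<in>set d. 1 \<le> a) \<and> sum_list d = n}"
proof (rule finite_subset[OF _ finite_lists_length_eq[of "{..n}" k]])
  show "{d :: nat list. length d = k \<and> (\<forall>a\<in>set d. 1 \<le> a) \<and> sum_list d = n}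
      \<subseteq> {d. set d \<subseteq> {..n} \<and> length d = k}"
    by (auto intro: member_le_sum_list)
qed simp

definition Descd_plus :: "(biword \<Rightarrow>\<^sub>0 rat) set" where
  "Descd_plus = generated_dendriform scl S_plus lt_S gt_S {p_gen n | n. n \<ge> 1}"

definition dendriform_primitives :: "(biword \<Rightarrow>\<^sub>0 rat) set \<Rightarrow> (biword \<Rightarrow>\<^sub>0 rat) set" where
  "dendriform_primitives A = {x. cop_lt x = 0} \<inter> {x. cop_gt x = 0} \<inter> A"

end

theory Submission
  imports Defs "HOL-Library.Tree"
begin

text \<open>Writing \<open>a\<^sub>n\<close> for the one-letter biword of degree \<open>n\<close>, one has
  \<open>p\<^sub>n = a\<^sub>n + (\<Sum>i<n. a\<^sub>i \<prec> p\<^sub>n\<^sub>-\<^sub>i)\<close>, so the descent algebra is generated by the letters \<open>a\<^sub>n\<close>.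
  Sorting the graded permutations by the shape of the binary search tree obtained by
  inserting their letters, the sum \<open>e\<^sub>t\<close> of all biwords of shape \<open>t = (l, n, r)\<close> equals
  \<open>e\<^sub>l \<succ> a\<^sub>n \<prec> e\<^sub>r\<close>. Hence the descent algebra consists exactly of the elements whose coefficients
  depend only on the shape, and it is free over the span of the letters, the \<open>e\<^sub>t\<close> being
  linearly independent because their supports are disjoint. The shape of a concatenation
  depends only on the shapes of its factors, which gives stability under the coproducts.
  Finally, cutting a biword of length at least 2 at a suitable place next to the letter 1
  isolates its coefficient, up to coefficients already known to vanish, so that the primitive elements are the combinations of letters.\<close>

section \<open>Biwords as lists of pairs\<close>

text \<open>Products and coproducts cut words in two different ways. On coefficients a half-product
  is a convolution over cuts by letter value, while a coproduct collects all words with a prescribed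
  cut by position. Search trees respect both: the tree of a word determines the tree of its
  restriction to an initial or final interval of letters, and the trees of two words determine that
  of their concatenation. For freeness, the value of a morphism on \<open>e_t\<close> is forced, but
  the factorization of \<open>e_t\<close> only covers products of special pairs of trees. Arbitrary
  pairs need an induction on the total size, where a dendriform axiom leads to smaller pairs and
  both half-products have to be treated together. For primitive elements, the obstacle is that a
  coefficient of a coproduct sums over all ways to distribute the letters between the two sides of
  the cut. Only the shape of a word matters, so the word can first be replaced by one whose prefix
  carries a final interval of letters. Every other distribution then has a smaller least prefix
  letter, and an induction on that letter isolates one coefficient.\<close>

type_synonym word = "(nat \<times> nat) list"

text \<open>Zipping the two rows ties each letter to its degree, so that restricting or permuting a
  biword is a \<open>filter\<close> or \<open>permute_list\<close> on a single list.\<close>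

definition biword_of :: "word \<Rightarrow> biword" where
  "biword_of l = (map fst l, map snd l)"

definition gword :: "word \<Rightarrow> bool" where
  "gword l \<longleftrightarrow> distinct (map fst l) \<and> fst ` set l = {1..length l} \<and> (\<forall>p\<in>set l. 1 \<le> snd p)"

definition gword_plus :: "word \<Rightarrow> bool" where
  "gword_plus l \<longleftrightarrow> gword l \<and> l \<noteq> []"

lemma gwordI:
  "distinct (map fst l) \<Longrightarrow> fst ` set l = {1..length l} \<Longrightarrow> (\<And>p. p \<in> set l \<Longrightarrow> 1 \<le> snd p) \<Longrightarrow> gword l"
  unfolding gword_def by blast

lemma gwordD:
  assumes "gword l"
  shows "distinct (map fst l)" "fst ` set l = {1..length l}" "\<And>p. p \<in> set l \<Longrightarrow> 1 \<le> snd p"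
  using assms unfolding gword_def by blast+

lemma gword_plus_gword [simp]: "gword_plus l \<Longrightarrow> gword l"
  by (simp add: gword_plus_def)

lemma inj_biword_of: "inj biword_of"
proof (rule injI)
  fix l l' assume "biword_of l = biword_of l'"
  then show "l = l'" by (metis biword_of_def prod.inject zip_map_fst_snd)
qed

lemma biword_of_eq_iff [simp]: "biword_of l = biword_of l' \<longleftrightarrow> l = l'"
  using inj_biword_of by (auto dest: injD)

lemma length_fst_biword_of [simp]: "length (fst (biword_of l)) = length l"
  and fst_biword_of: "fst (biword_of l) = map fst l"
  and snd_biword_of: "snd (biword_of l) = map snd l"
  by (simp_all add: biword_of_def)

lemma graded_perms_eq: "graded_perms = biword_of ` Collect gword"
proof (intro set_eqI iffI)
  fix w assume "w \<in> graded_perms"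
  then obtain s d where w: "w = (s, d)" "distinct s" "set s = {1..length s}"
      "length d = length s" "\<forall>a\<in>set d. 1 \<le> a"
    by (auto simp: graded_perms_def)
  then have "gword (zip s d)"
    unfolding gword_def using set_zip_rightD[of _ _ s d] set_map[of fst "zip s d"]
    by (auto simp del: set_map)
  moreover have "w = biword_of (zip s d)"
    using w by (simp add: biword_of_def)
  ultimately show "w \<in> biword_of ` Collect gword" by blast
next
  fix w assume "w \<in> biword_of ` Collect gword"
  then show "w \<in> graded_perms"
    by (auto simp: graded_perms_def biword_of_def gword_def)
qed

lemma biword_of_graded_perms [simp]: "biword_of l \<in> graded_perms \<longleftrightarrow> gword l"
  by (auto simp: graded_perms_eq)

lemma graded_perms_plus_eq:
  "{w \<in> graded_perms. length (fst w) \<ge> 1} = biword_of ` Collect gword_plus"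
proof (intro set_eqI iffI)
  fix w assume "w \<in> {w \<in> graded_perms. length (fst w) \<ge> 1}"
  then obtain l where "w = biword_of l" "gword l" "length (fst w) \<ge> 1"
    unfolding graded_perms_eq by blast
  then have "w = biword_of l" "gword_plus l"
    by (auto simp: gword_plus_def)
  then show "w \<in> biword_of ` Collect gword_plus" by blast
next
  fix w assume "w \<in> biword_of ` Collect gword_plus"
  then obtain l where "w = biword_of l" "gword l" "length l \<ge> 1"
    by (auto simp: gword_plus_def Suc_le_eq)
  then show "w \<in> {w \<in> graded_perms. length (fst w) \<ge> 1}"
    by simp
qed

section \<open>Coefficients of linear and bilinear extensions\<close>

lemma lookup_sum_basis_vec:
  "finite A \<Longrightarrow> Poly_Mapping.lookup (\<Sum>w\<in>A. basis_vec w) k = (of_bool (k \<in> A) :: rat)"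
  by (simp add: lookup_sum lookup_single when_def sum.delta')

lemma lookup_sum_basis_vec_image:
  "finite A \<Longrightarrow> inj_on f A \<Longrightarrow>
     Poly_Mapping.lookup (\<Sum>a\<in>A. basis_vec (f a)) k = (of_bool (k \<in> f ` A) :: rat)"
  using lookup_sum_basis_vec[of "f ` A" k] by (simp add: sum.reindex)

lemma lookup_lin_ext:
  "Poly_Mapping.lookup (lin_ext f x) k =
     (\<Sum>u\<in>Poly_Mapping.keys x. Poly_Mapping.lookup x u * Poly_Mapping.lookup (f u) k)"
  by (simp add: lin_ext_def lookup_sum)

lemma lookup_bilin_ext:
  "Poly_Mapping.lookup (bilin_ext f x y) k =
     (\<Sum>(u, v)\<in>Poly_Mapping.keys x \<times> Poly_Mapping.keys y.
        Poly_Mapping.lookup x u * Poly_Mapping.lookup y v * Poly_Mapping.lookup (f u v) k)"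
  by (simp add: bilin_ext_def lookup_lin_ext sum_distrib_left sum.cartesian_product mult.assoc)

lemma lookup_tensor:
  "Poly_Mapping.lookup (tensor x y) (u, v) = Poly_Mapping.lookup x u * Poly_Mapping.lookup y v"
proof -
  have "Poly_Mapping.lookup (tensor x y) (u, v) =
     (\<Sum>p\<in>Poly_Mapping.keys x \<times> Poly_Mapping.keys y.
        if p = (u, v) then Poly_Mapping.lookup x u * Poly_Mapping.lookup y v else 0)"
    unfolding tensor_def lookup_bilin_ext
    by (rule sum.cong) (auto simp: lookup_single when_def split: if_splits)
  also have "\<dots> = Poly_Mapping.lookup x u * Poly_Mapping.lookup y v"
    by (subst sum.delta) (auto simp: in_keys_iff)
  finally show ?thesis .
qed

lemma span_basis_vec_iff: "x \<in> scl.span (basis_vec ` B) \<longleftrightarrow> Poly_Mapping.keys x \<subseteq> B"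
proof
  assume "x \<in> scl.span (basis_vec ` B)"
  then show "Poly_Mapping.keys x \<subseteq> B"
  proof (induction rule: scl.span_induct_alt)
    case (step c b y)
    then show ?case by (auto simp: in_keys_iff lookup_add lookup_single when_def split: if_splits)
  qed simp
next
  assume *: "Poly_Mapping.keys x \<subseteq> B"
  have "x = (\<Sum>k\<in>Poly_Mapping.keys x. scl (Poly_Mapping.lookup x k) (basis_vec k))"
    by (rule poly_mapping_eqI)
      (simp add: lookup_sum lookup_single when_def in_keys_iff if_distrib[of "(*) _"] cong: if_cong)
  also have "\<dots> \<in> scl.span (basis_vec ` B)"
    using * by (intro scl.span_sum scl.span_scale scl.span_base) auto
  finally show "x \<in> scl.span (basis_vec ` B)" .
qed

definition cf :: "(biword \<Rightarrow>\<^sub>0 rat) \<Rightarrow> word \<Rightarrow> rat" where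
  "cf x l = Poly_Mapping.lookup x (biword_of l)"

lemma cf_simps [simp]:
  "cf (x + y) l = cf x l + cf y l" "cf (scl c x) l = c * cf x l" "cf 0 l = 0"
  "cf (x - y) l = cf x l - cf y l"
  by (simp_all add: cf_def lookup_add lookup_minus)

lemma cf_sum: "cf (sum f A) l = (\<Sum>a\<in>A. cf (f a) l)"
  by (simp add: cf_def lookup_sum)

lemma S_plus_iff: "x \<in> S_plus \<longleftrightarrow> Poly_Mapping.keys x \<subseteq> biword_of ` Collect gword_plus"
  by (simp only: S_plus_def graded_perms_plus_eq span_basis_vec_iff)

lemma subspace_S_plus: "scl.subspace S_plus"
  by (simp add: S_plus_def)

lemma cf_eq_0: "x \<in> S_plus \<Longrightarrow> \<not> gword_plus l \<Longrightarrow> cf x l = 0"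
  by (auto simp: S_plus_iff cf_def in_keys_iff dest!: subsetD[where c = "biword_of l"])

lemma S_plus_eqI:
  assumes "x \<in> S_plus" "y \<in> S_plus" "\<And>l. gword_plus l \<Longrightarrow> cf x l = cf y l"
  shows "x = y"
proof (rule poly_mapping_eqI)
  fix w
  show "Poly_Mapping.lookup x w = Poly_Mapping.lookup y w"
  proof (cases "w \<in> biword_of ` Collect gword_plus")
    case True
    then show ?thesis using assms(3) by (auto simp: cf_def)
  next
    case False
    then have "w \<notin> Poly_Mapping.keys x" "w \<notin> Poly_Mapping.keys y"
      using assms by (auto simp: S_plus_iff)
    then show ?thesis by (simp add: in_keys_iff)
  qed
qed

section \<open>Restriction of words to intervals of letters\<close>

definition lo :: "nat \<Rightarrow> word \<Rightarrow> word" where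
  "lo k l = filter (\<lambda>p. fst p \<le> k) l"

text \<open>In a graded permutation the letters above \<open>k\<close> are
  \<open>k + 1, ..., n\<close>, so subtracting \<open>k\<close> already standardizes them, and
  \<open>lo k\<close> needs no relabelling at all. Restriction by letter value is dual to the
  shifted shuffle.\<close>

definition hi :: "nat \<Rightarrow> word \<Rightarrow> word" where
  "hi k l = map (apfst (\<lambda>a. a - k)) (filter (\<lambda>p. k < fst p) l)"

definition shift :: "nat \<Rightarrow> word \<Rightarrow> word" where
  "shift k l = map (apfst (\<lambda>a. a + k)) l"

lemma shift_hi: "shift k (hi k l) = filter (\<lambda>p. k < fst p) l"
  by (auto simp: shift_def hi_def intro!: map_idI)

lemma hi_append_shift: "\<forall>p\<in>set u. fst p \<le> k \<Longrightarrow> \<forall>p\<in>set v. 1 \<le> fst p \<Longrightarrow> hi k (u @ shift k v) = v"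
proof -
  assume *: "\<forall>p\<in>set u. fst p \<le> k" "\<forall>p\<in>set v. 1 \<le> fst p"
  have "filter (\<lambda>p. k < fst p) u = []"
    using * by (auto simp: filter_empty_conv)
  moreover have "filter (\<lambda>p. k < fst p) (shift k v) = shift k v"
    using * by (intro filter_True) (auto simp: shift_def)
  ultimately have "filter (\<lambda>p. k < fst p) (u @ shift k v) = shift k v"
    by (simp only: filter_append append_Nil)
  moreover have "map (apfst (\<lambda>a. a - k)) (shift k v) = v"
    by (auto simp: shift_def intro!: map_idI)
  ultimately show ?thesis by (simp only: hi_def)
qed

lemma length_shift [simp]: "length (shift k l) = length l"
  by (simp add: shift_def)

lemma lo_lo: "lo j (lo k l) = lo (min j k) l"
  by (auto simp: lo_def intro!: filter_cong)

lemma lo_hi: "lo j (hi k l) = hi k (lo (j + k) l)"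
  by (auto simp: lo_def hi_def filter_map o_def intro!: arg_cong[of _ _ "map _"] filter_cong)

lemma hi_hi: "hi j (hi k l) = hi (j + k) l"
  by (auto simp: hi_def filter_map o_def intro!: map_cong filter_cong)

lemma distinct_fst_filter: "distinct (map fst l) \<Longrightarrow> distinct (map fst (filter P l))"
  by (induction l) auto

lemma length_eq_card_fst: "distinct (map fst l) \<Longrightarrow> length l = card (fst ` set l)"
  by (metis distinct_card length_map set_map)

lemma fst_set_filter: "fst ` set (filter (\<lambda>p. Q (fst p)) l) = {a \<in> fst ` set l. Q a}"
  by auto

lemma gword_lo:
  assumes "gword l" "k \<le> length l"
  shows "gword (lo k l)" "length (lo k l) = k"
proof -
  have "fst ` set (lo k l) = {a \<in> {1..length l}. a \<le> k}"
    using assms(1) fst_set_filter[of "\<lambda>a. a \<le> k" l] by (simp only: gword_def lo_def)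
  also have "\<dots> = {1..k}" using assms by auto
  finally have s: "fst ` set (lo k l) = {1..k}" .
  have d: "distinct (map fst (lo k l))"
    using assms by (simp add: lo_def gword_def distinct_fst_filter)
  show len: "length (lo k l) = k"
    using length_eq_card_fst[OF d] s by simp
  show "gword (lo k l)"
    using s d assms(1) unfolding gword_def len by (simp add: lo_def)
qed

lemma gword_hi:
  assumes "gword l" "k \<le> length l"
  shows "gword (hi k l)" "length (hi k l) = length l - k"
proof -
  let ?f = "filter (\<lambda>p. k < fst p) l"
  have "fst ` set ?f = {a \<in> {1..length l}. k < a}"
    using assms(1) fst_set_filter[of "\<lambda>a. k < a" l] by (simp only: gword_def)
  also have "\<dots> = {k<..length l}" by auto
  finally have s: "fst ` set ?f = {k<..length l}" .
  have d: "distinct (map fst ?f)"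
    using assms by (simp add: gword_def distinct_fst_filter)
  have "map fst (hi k l) = map (\<lambda>a. a - k) (map fst ?f)"
    by (simp add: hi_def)
  moreover have "inj_on (\<lambda>a. a - k) (set (map fst ?f))"
    by (rule inj_onI) auto
  ultimately have d': "distinct (map fst (hi k l))"
    using d by (simp only: distinct_map[of "\<lambda>a. a - k" "map fst ?f"])
  have "fst ` set (hi k l) = (\<lambda>a. a - k) ` fst ` set ?f"
    by (simp only: hi_def set_map image_image fst_apfst)
  also have "\<dots> = {1..length l - k}"
  proof -
    have "a \<in> (\<lambda>a. a - k) ` {k<..length l}" if "a \<in> {1..length l - k}" for a
      using that by (intro image_eqI[of _ _ "a + k"]) auto
    then show ?thesis unfolding s by auto
  qed
  finally have s': "fst ` set (hi k l) = {1..length l - k}" .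
  show len: "length (hi k l) = length l - k"
    using length_eq_card_fst[OF d'] s' by simp
  show "gword (hi k l)"
    using s' d' assms(1) unfolding gword_def len by (simp add: hi_def)
qed

lemma gword_plus_lo: "gword l \<Longrightarrow> 1 \<le> k \<Longrightarrow> k \<le> length l \<Longrightarrow> gword_plus (lo k l)"
  using gword_lo[of l k] by (auto simp: gword_plus_def)

lemma gword_plus_hi: "gword l \<Longrightarrow> k < length l \<Longrightarrow> gword_plus (hi k l)"
  using gword_hi[of l k] by (auto simp: gword_plus_def)

lemma gword_letter_bounds: "gword l \<Longrightarrow> p \<in> set l \<Longrightarrow> 1 \<le> fst p \<and> fst p \<le> length l"
  using imageI[of p "set l" fst] by (simp only: gword_def atLeastAtMost_iff)

lemma fst_hd_gword: "gword_plus l \<Longrightarrow> 1 \<le> fst (hd l) \<and> fst (hd l) \<le> length l"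
  using gword_letter_bounds[of l "hd l"] by (simp add: gword_plus_def)

lemma hd_lo: "l \<noteq> [] \<Longrightarrow> fst (hd l) \<le> k \<Longrightarrow> hd (lo k l) = hd l"
  by (cases l) (auto simp: lo_def)

lemma hd_hi: "l \<noteq> [] \<Longrightarrow> k < fst (hd l) \<Longrightarrow> fst (hd (hi k l)) = fst (hd l) - k"
  by (cases l) (auto simp: hi_def)

section \<open>The half-shuffle products on coefficients\<close>

text \<open>The shifted shuffles of \<open>u\<close> and \<open>v\<close>, described without the permutations \<open>\<alpha>\<close> of
  \<open>shuffles_perm\<close>: since the letters are distinct, \<open>\<alpha>\<close> can be recovered from the shuffle.\<close>

definition sh_words :: "word \<Rightarrow> word \<Rightarrow> word set" where
  "sh_words u v = {l. gword l \<and> length l = length u + length v \<and>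
      lo (length u) l = u \<and> hi (length u) l = v}"

section \<open>Shuffle permutations and shuffled words\<close>

lemma shuffle_term_biword_of:
  assumes "\<alpha> permutes {..<length u + length v}"
  shows "shuffle_term (biword_of u) (biword_of v) \<alpha> =
     biword_of (permute_list (inv \<alpha>) (u @ shift (length u) v))"
proof -
  have i: "inv \<alpha> permutes {..<length (u @ shift (length u) v)}"
    using permutes_inv[OF assms] by simp
  show ?thesis
    unfolding biword_of_def[of "permute_list _ _"]
    unfolding permute_list_map[OF i, symmetric]
    by (simp add: shuffle_term_def tensor_perm_def biword_of_def shift_def o_def)
qed

text \<open>Since \<open>\<alpha>\<close> increases on the block, the values of
  \<open>inv \<alpha>\<close> that fall into the block occur in increasing order. By bijectivity
  they fill the block, and a strictly sorted list is determined by its set.\<close>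

lemma filter_map_inv_upt:
  assumes "strict_mono_on {a..<b} \<alpha>" "\<alpha> permutes {..<N}" "b \<le> N"
  shows "filter (\<lambda>i. i \<in> {a..<b}) (map (inv \<alpha>) [0..<N]) = [a..<b]"
proof -
  let ?b = "inv \<alpha>" and ?I = "{a..<b}"
  have b: "\<alpha> (?b i) = i" for i
    using permutes_inverses[OF assms(2)] by auto
  have "?b i < ?b j" if "?b i \<in> ?I" "?b j \<in> ?I" "i < j" for i j
  proof (rule ccontr)
    assume "\<not> ?b i < ?b j"
    then have "?b j \<le> ?b i" by simp
    then have "\<alpha> (?b j) \<le> \<alpha> (?b i)"
      using strict_mono_onD[OF assms(1), of "?b j" "?b i"] that
      by (cases "?b j = ?b i") auto
    then show False using b that by simp
  qed
  moreover have "sorted_wrt (<) (filter (\<lambda>i. ?b i \<in> ?I) [0..<N])"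
    by (simp add: sorted_wrt_filter)
  ultimately have "sorted_wrt (\<lambda>i j. ?b i < ?b j) (filter (\<lambda>i. ?b i \<in> ?I) [0..<N])"
    by (elim sorted_wrt_mono_rel[rotated]) (simp only: set_filter mem_Collect_eq)
  then have s: "sorted_wrt (<) (filter (\<lambda>i. i \<in> ?I) (map ?b [0..<N]))"
    by (simp add: filter_map sorted_wrt_map o_def)
  have "bij_betw ?b {..<N} {..<N}"
    using permutes_inv[OF assms(2)] by (rule permutes_imp_bij)
  then have *: "?b ` {..<N} = {..<N}" by (simp add: bij_betw_def)
  have "set (filter (\<lambda>i. i \<in> ?I) (map ?b [0..<N])) = {i \<in> ?b ` {..<N}. i \<in> ?I}"
    unfolding set_filter set_map set_upt atLeast0LessThan ..
  also have "\<dots> = ?I"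
    unfolding * using assms(3) by auto
  finally have "set (filter (\<lambda>i. i \<in> ?I) (map ?b [0..<N])) = set [a..<b]"
    by (simp only: set_upt)
  then show ?thesis
    using strict_sorted_equal[OF sorted_wrt_upt s] by metis
qed

lemma filter_permute_list_inv:
  assumes "\<alpha> permutes {..<length xs}" "strict_mono_on {a..<b} \<alpha>" "b \<le> length xs"
    and "\<And>i. i < length xs \<Longrightarrow> P (xs ! i) \<longleftrightarrow> i \<in> {a..<b}"
  shows "filter P (permute_list (inv \<alpha>) xs) = map ((!) xs) [a..<b]"
proof -
  have b: "inv \<alpha> i < length xs" if "i < length xs" for i
    using permutes_in_image[OF permutes_inv[OF assms(1)]] that by auto
  have "filter P (permute_list (inv \<alpha>) xs) =
      map ((!) xs) (filter (\<lambda>i. i \<in> {a..<b}) (map (inv \<alpha>) [0..<length xs]))"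
  proof -
    have "filter (\<lambda>i. P (xs ! inv \<alpha> i)) [0..<length xs] = filter (\<lambda>i. inv \<alpha> i \<in> {a..<b}) [0..<length xs]"
      using b assms(4) by (intro filter_cong) simp_all
    then show ?thesis
      by (simp only: permute_list_def filter_map map_map o_def)
  qed
  also have "\<dots> = map ((!) xs) [a..<b]"
    using assms by (simp only: filter_map_inv_upt)
  finally show ?thesis .
qed

lemma gword_append_shift:
  assumes "gword u" "gword v"
  shows "gword (u @ shift (length u) v)"
proof (rule gwordI)
  let ?k = "length u"
  have "fst ` set (shift ?k v) = (\<lambda>a. a + ?k) ` fst ` set v"
    by (simp only: shift_def set_map image_image fst_apfst)
  also have "\<dots> = (\<lambda>a. a + ?k) ` {1..length v}"
    by (simp only: gwordD(2)[OF assms(2)])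
  also have "\<dots> = {?k + 1..?k + length v}"
    by (simp add: image_add_atLeastAtMost' add.commute)
  finally have s: "fst ` set (shift ?k v) = {?k + 1..?k + length v}" .
  note u = gwordD(2)[OF assms(1)]
  have "map fst (shift ?k v) = map (\<lambda>a. a + ?k) (map fst v)"
    by (simp add: shift_def)
  moreover have "distinct (map (\<lambda>a. a + ?k) (map fst v))"
    unfolding distinct_map[of _ "map fst v"] using gwordD(1)[OF assms(2)] by (simp add: inj_on_def)
  ultimately have "distinct (map fst (shift ?k v))" by simp
  moreover have "{1..?k} \<inter> {?k + 1..?k + length v} = {}" by auto
  ultimately show "distinct (map fst (u @ shift ?k v))"
    using gwordD(1)[OF assms(1)] unfolding map_append distinct_append set_map s u by blast
  have "fst ` set (u @ shift ?k v) = {1..?k} \<union> {?k + 1..?k + length v}"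
    by (simp only: set_append image_Un s u)
  also have "\<dots> = {1..?k + length v}"
    by auto
  finally show "fst ` set (u @ shift ?k v) = {1..length (u @ shift ?k v)}"
    by (simp only: length_append length_shift)
  have "snd ` set (shift ?k v) = snd ` set v"
    by (simp only: shift_def set_map image_image snd_apfst)
  then show "1 \<le> snd p" if "p \<in> set (u @ shift ?k v)" for p
    using that gwordD(3)[OF assms(1)] gwordD(3)[OF assms(2)]
    unfolding set_append by (metis Un_iff imageE imageI)
qed

lemma gword_permute_list:
  assumes "gword l" "\<beta> permutes {..<length l}"
  shows "gword (permute_list \<beta> l)"
proof -
  have "distinct (permute_list \<beta> (map fst l))"
    using assms by (subst distinct_permute_list) (auto simp: gword_def)
  then show ?thesis
    using assms by (simp add: gword_def permute_list_map)
qed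

text \<open>The entries of \<open>u @ shift (length u) v\<close> are distinct, so the shuffled word
  reveals where each of its entries came from, which is \<open>inv \<alpha>\<close>.\<close>

lemma inj_on_shuffle_word:
  assumes "gword u" "gword v"
  shows "inj_on (\<lambda>\<alpha>. permute_list (inv \<alpha>) (u @ shift (length u) v)) (shuffles_perm (length u) (length v))"
proof (rule inj_onI)
  let ?t = "u @ shift (length u) v" and ?N = "length u + length v"
  have dt: "distinct ?t"
    using gword_append_shift[OF assms] by (auto simp: gword_def distinct_map)
  fix \<alpha> \<beta> assume *: "\<alpha> \<in> shuffles_perm (length u) (length v)" "\<beta> \<in> shuffles_perm (length u) (length v)"
    "permute_list (inv \<alpha>) ?t = permute_list (inv \<beta>) ?t"
  then have p: "\<alpha> permutes {..<?N}" "\<beta> permutes {..<?N}"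
    by (auto simp: shuffles_perm_def)
  have i: "inv \<alpha> permutes {..<length ?t}" "inv \<beta> permutes {..<length ?t}"
    using p permutes_inv by auto
  have "inv \<alpha> i = inv \<beta> i" for i
  proof (cases "i < length ?t")
    case True
    have "?t ! inv \<alpha> i = ?t ! inv \<beta> i"
      using permute_list_nth[OF i(1) True] permute_list_nth[OF i(2) True] *(3) by simp
    moreover have "inv \<alpha> i < length ?t" "inv \<beta> i < length ?t"
      using True i permutes_in_image[OF i(1), of i] permutes_in_image[OF i(2), of i] by auto
    ultimately show ?thesis using dt nth_eq_iff_index_eq by blast
  next
    case False
    then show ?thesis using i by (simp add: permutes_not_in)
  qed
  then have "inv \<alpha> = inv \<beta>" by auto
  then have "inv (inv \<alpha>) = inv (inv \<beta>)" by simp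
  then show "\<alpha> = \<beta>"
    by (simp only: permutes_inv_inv[OF p(1)] permutes_inv_inv[OF p(2)])
qed

lemma nth_append_shift_le_iff:
  assumes "gword u" "gword v" "i < length u + length v"
  shows "fst ((u @ shift (length u) v) ! i) \<le> length u \<longleftrightarrow> i < length u"
proof (cases "i < length u")
  case True
  then show ?thesis
    using gword_letter_bounds[OF assms(1) nth_mem[OF True]] by (simp add: nth_append)
next
  case False
  have iv: "i - length u < length v" using assms(3) False by simp
  show ?thesis
    using gword_letter_bounds[OF assms(2) nth_mem[OF iv]] False iv
    by (simp add: nth_append shift_def)
qed

lemma shuffle_word_in_sh_words:
  assumes "gword u" "gword v" "\<alpha> \<in> shuffles_perm (length u) (length v)"
  shows "permute_list (inv \<alpha>) (u @ shift (length u) v) \<in> sh_words u v"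
proof -
  let ?t = "u @ shift (length u) v" and ?N = "length u + length v"
  have p: "\<alpha> permutes {..<length ?t}" "strict_mono_on {0..<length u} \<alpha>" "strict_mono_on {length u..<?N} \<alpha>"
    using assms by (auto simp: shuffles_perm_def atLeast0LessThan)
  have "lo (length u) (permute_list (inv \<alpha>) ?t) = map ((!) ?t) [0..<length u]"
    unfolding lo_def using nth_append_shift_le_iff[OF assms(1,2)]
    by (intro filter_permute_list_inv[OF p(1,2)]) auto
  also have "map ((!) ?t) [0..<length u] = u"
    by (rule nth_equalityI) (auto simp: nth_append)
  finally have lo: "lo (length u) (permute_list (inv \<alpha>) ?t) = u" .
  have "filter (\<lambda>p. length u < fst p) (permute_list (inv \<alpha>) ?t) = map ((!) ?t) [length u..<?N]"
    using nth_append_shift_le_iff[OF assms(1,2)]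
    by (intro filter_permute_list_inv[OF p(1,3)]) (auto simp: not_le[symmetric])
  moreover have "map ((!) ?t) [length u..<?N] = shift (length u) v"
    by (rule nth_equalityI) (auto simp: nth_append)
  moreover have g: "gword (permute_list (inv \<alpha>) ?t)"
    using gword_permute_list[OF gword_append_shift[OF assms(1,2)] permutes_inv[OF p(1)]] .
  moreover have "hi (length u) (shift (length u) v) = v"
    using hi_append_shift[of "[]" "length u" v] gword_letter_bounds[OF assms(2)] by simp
  moreover have "hi (length u) l = hi (length u) (filter (\<lambda>p. length u < fst p) l)" for l
    by (simp add: hi_def)
  note this[of "permute_list (inv \<alpha>) ?t"]
  ultimately have "hi (length u) (permute_list (inv \<alpha>) ?t) = v"
    by simp
  then show ?thesis
    using lo g unfolding sh_words_def by simp
qed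

lemma sh_words_imp_shuffle_word:
  assumes "l \<in> sh_words u v"
  obtains \<alpha> where "\<alpha> \<in> shuffles_perm (length u) (length v)"
    "l = permute_list (inv \<alpha>) (u @ shift (length u) v)"
proof -
  let ?k = "length u" and ?N = "length u + length v"
  have l: "length l = ?N" "lo ?k l = u" "hi ?k l = v"
    using assms by (auto simp: sh_words_def)
  define I where "I = filter (\<lambda>i. fst (l ! i) \<le> ?k) [0..<?N]"
  define J where "J = filter (\<lambda>i. ?k < fst (l ! i)) [0..<?N]"
  have fm: "filter P l = map ((!) l) (filter (\<lambda>i. P (l ! i)) [0..<?N])" for P
    using filter_map[of P "(!) l" "[0..<?N]"] l(1) map_nth[of l] by (simp add: o_def)
  have u: "u = map ((!) l) I"
    using l(2) fm unfolding lo_def I_def by simp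
  have v: "shift ?k v = map ((!) l) J"
    using shift_hi[of ?k l] l(3) fm unfolding J_def by simp
  have len: "length I = ?k" "length J = length v"
    using arg_cong[OF u, of length] arg_cong[OF v, of length] by simp_all
  have IJ: "distinct (I @ J)" "set (I @ J) = {..<?N}"
    by (auto simp: I_def J_def)
  \<comment> \<open>\<open>I\<close> lists the positions in \<open>l\<close> of the small letters
    and \<open>J\<close> those of the large ones, so \<open>\<alpha>\<close> sends an index of
    \<open>u @ shift ?k v\<close> to the place of that entry in \<open>l\<close>. Both lists are
    sorted, which makes \<open>\<alpha>\<close> increasing on each block.\<close>
  define \<alpha> where "\<alpha> = (\<lambda>i. if i < ?N then (I @ J) ! i else i)"
  have "bij_betw (\<lambda>i. (I @ J) ! i) {..<?N} {..<?N}"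
    using IJ(2) len by (intro bij_betw_nth[OF IJ(1)]) simp_all
  then have "bij_betw \<alpha> {..<?N} {..<?N}"
    by (subst bij_betw_cong[of _ _ "\<lambda>i. (I @ J) ! i"]) (auto simp: \<alpha>_def)
  then have p: "\<alpha> permutes {..<?N}"
    by (intro bij_imp_permutes) (auto simp: \<alpha>_def)
  have sI: "sorted_wrt (<) I" and sJ: "sorted_wrt (<) J"
    unfolding I_def J_def by (auto intro!: sorted_wrt_filter)
  have "strict_mono_on {..<?k} \<alpha>"
  proof (rule strict_mono_onI)
    fix r s assume *: "r \<in> {..<?k}" "s \<in> {..<?k}" "r < s"
    then have "\<alpha> r = I ! r" "\<alpha> s = I ! s"
      using len by (simp_all add: \<alpha>_def nth_append)
    then show "\<alpha> r < \<alpha> s"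
      using sorted_wrt_nth_less[OF sI *(3)] * len by simp
  qed
  moreover have "strict_mono_on {?k..<?N} \<alpha>"
  proof (rule strict_mono_onI)
    fix r s assume *: "r \<in> {?k..<?N}" "s \<in> {?k..<?N}" "r < s"
    then have "\<alpha> r = J ! (r - ?k)" "\<alpha> s = J ! (s - ?k)"
      using len by (simp_all add: \<alpha>_def nth_append)
    moreover have "r - ?k < s - ?k" "s - ?k < length J" using * len by auto
    ultimately show "\<alpha> r < \<alpha> s"
      using sorted_wrt_nth_less[OF sJ] by metis
  qed
  ultimately have "\<alpha> \<in> shuffles_perm ?k (length v)"
    using p by (simp add: shuffles_perm_def)
  moreover have "u @ shift ?k v = permute_list \<alpha> l"
  proof -
    have "u @ shift ?k v = map ((!) l) (I @ J)" using u v by simp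
    also have "I @ J = map \<alpha> [0..<?N]"
      by (rule nth_equalityI) (auto simp: \<alpha>_def len)
    finally show ?thesis using l(1) by (simp add: permute_list_def)
  qed
  then have "l = permute_list (inv \<alpha>) (u @ shift ?k v)"
    using permute_list_compose[of "inv \<alpha>" l \<alpha>] p l(1) permutes_inv[OF p]
    by (simp add: permutes_inv_o)
  ultimately show thesis using that by blast
qed

text \<open>The side conditions of the two half-products only say which factor supplies the first
  letter: by monotonicity it is then the first letter of that factor.\<close>

lemma inv_shuffle_zero_cases:
  assumes "\<alpha> \<in> shuffles_perm k m" "1 \<le> k" "1 \<le> m"
  shows "inv \<alpha> 0 = 0 \<longleftrightarrow> inv \<alpha> 0 < k" "inv \<alpha> 0 = k \<longleftrightarrow> \<not> inv \<alpha> 0 < k"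
proof -
  have p: "\<alpha> permutes {..<k + m}" "strict_mono_on {..<k} \<alpha>" "strict_mono_on {k..<k + m} \<alpha>"
    using assms by (auto simp: shuffles_perm_def)
  have b: "\<alpha> (inv \<alpha> 0) = 0" using permutes_inverses[OF p(1)] by auto
  have r: "inv \<alpha> 0 < k + m"
    using permutes_in_image[OF permutes_inv[OF p(1)], of 0] assms by auto
  have "inv \<alpha> 0 = 0" if "inv \<alpha> 0 < k"
  proof (rule ccontr)
    assume "inv \<alpha> 0 \<noteq> 0"
    then have "\<alpha> 0 < \<alpha> (inv \<alpha> 0)"
      using that by (intro strict_mono_onD[OF p(2)]) simp_all
    then show False using b by simp
  qed
  then show "inv \<alpha> 0 = 0 \<longleftrightarrow> inv \<alpha> 0 < k" using assms(2) by linarith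
  have "inv \<alpha> 0 = k" if "\<not> inv \<alpha> 0 < k"
  proof (rule ccontr)
    assume "inv \<alpha> 0 \<noteq> k"
    then have "\<alpha> k < \<alpha> (inv \<alpha> 0)"
      using that r by (intro strict_mono_onD[OF p(3)]) simp_all
    then show False using b by simp
  qed
  then show "inv \<alpha> 0 = k \<longleftrightarrow> \<not> inv \<alpha> 0 < k" by blast
qed

lemma hd_shuffle_word:
  assumes "gword u" "gword v" "\<alpha> \<in> shuffles_perm (length u) (length v)" "u \<noteq> []"
  shows "fst (hd (permute_list (inv \<alpha>) (u @ shift (length u) v))) \<le> length u \<longleftrightarrow> inv \<alpha> 0 < length u"
proof -
  let ?t = "u @ shift (length u) v"
  have p: "inv \<alpha> permutes {..<length ?t}"
    using assms(3) permutes_inv by (auto simp: shuffles_perm_def)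
  have "inv \<alpha> 0 < length ?t" using permutes_in_image[OF p, of 0] assms(4) by auto
  moreover have "hd (permute_list (inv \<alpha>) ?t) = ?t ! inv \<alpha> 0"
  proof -
    have 0: "0 < length ?t" using assms(4) by simp
    then have ne: "permute_list (inv \<alpha>) ?t \<noteq> []"
      by (metis length_permute_list length_greater_0_conv)
    show ?thesis
      using hd_conv_nth[OF ne] permute_list_nth[OF p 0] by (rule trans)
  qed
  ultimately show ?thesis
    using nth_append_shift_le_iff[OF assms(1,2), of "inv \<alpha> 0"] by (simp only: length_append length_shift)
qed

text \<open>No word occurs twice in a half-product of biwords, so the coefficients are 0 or 1. The
  factor that supplies the first letter is visible from its value, because the letters of
  \<open>v\<close> are shifted above \<open>length u\<close>.\<close>

lemma lookup_lt_basis: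
  assumes "gword_plus u" "gword_plus v"
  shows "Poly_Mapping.lookup (lt_basis (biword_of u) (biword_of v)) w =
     of_bool (w \<in> biword_of ` {l \<in> sh_words u v. fst (hd l) \<le> length u})"
    and "Poly_Mapping.lookup (gt_basis (biword_of u) (biword_of v)) w =
     of_bool (w \<in> biword_of ` {l \<in> sh_words u v. length u < fst (hd l)})"
proof -
  have g: "gword u" "gword v" "u \<noteq> []" "v \<noteq> []"
    using assms by (auto simp: gword_plus_def)
  let ?S = "shuffles_perm (length u) (length v)"
  let ?f = "\<lambda>\<alpha>. permute_list (inv \<alpha>) (u @ shift (length u) v)"
  have st: "shuffle_term (biword_of u) (biword_of v) \<alpha> = biword_of (?f \<alpha>)" if "\<alpha> \<in> ?S" for \<alpha>
    using that by (intro shuffle_term_biword_of) (auto simp: shuffles_perm_def)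
  have inj: "inj_on (\<lambda>\<alpha>. biword_of (?f \<alpha>)) ?S"
    using inj_on_shuffle_word[OF g(1,2)] by (auto simp: inj_on_def)
  have im: "(\<lambda>\<alpha>. biword_of (?f \<alpha>)) ` {\<alpha> \<in> ?S. Q (inv \<alpha> 0 < length u)} =
      biword_of ` {l \<in> sh_words u v. Q (fst (hd l) \<le> length u)}" for Q
    using shuffle_word_in_sh_words[OF g(1,2)] hd_shuffle_word[OF g(1,2) _ g(3)]
    by (auto elim!: sh_words_imp_shuffle_word)
  have c: "inv \<alpha> 0 = 0 \<longleftrightarrow> inv \<alpha> 0 < length u" "inv \<alpha> 0 = length u \<longleftrightarrow> \<not> inv \<alpha> 0 < length u"
    if "\<alpha> \<in> ?S" for \<alpha>
    using inv_shuffle_zero_cases[OF that] g by (simp_all add: Suc_le_eq)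
  have fin: "finite {\<alpha> \<in> ?S. R \<alpha>}" for R
    by (rule finite_subset[OF _ finite_shuffles_perm]) auto
  \<comment> \<open>Both half-products at once: \<open>Q\<close> is the identity for
    \<open>lt_basis\<close> and negation for \<open>gt_basis\<close>.\<close>
  have key: "Poly_Mapping.lookup (\<Sum>\<alpha> | \<alpha> \<in> ?S \<and> R \<alpha>. basis_vec (shuffle_term (biword_of u) (biword_of v) \<alpha>)) w =
       (of_bool (w \<in> biword_of ` {l \<in> sh_words u v. Q (fst (hd l) \<le> length u)}) :: rat)"
    if "\<And>\<alpha>. \<alpha> \<in> ?S \<Longrightarrow> R \<alpha> \<longleftrightarrow> Q (inv \<alpha> 0 < length u)" for Q R
  proof -
    have "(\<Sum>\<alpha> | \<alpha> \<in> ?S \<and> R \<alpha>. basis_vec (shuffle_term (biword_of u) (biword_of v) \<alpha>)) =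
        (\<Sum>\<alpha>\<in>{\<alpha> \<in> ?S. Q (inv \<alpha> 0 < length u)}. basis_vec (biword_of (?f \<alpha>)) :: biword \<Rightarrow>\<^sub>0 rat)"
      using st that by (intro sum.cong) auto
    then show ?thesis
      using lookup_sum_basis_vec_image[OF fin[of "\<lambda>\<alpha>. Q (inv \<alpha> 0 < length u)"] inj_on_subset[OF inj], of w] im[of Q] by auto
  qed
  show "Poly_Mapping.lookup (lt_basis (biword_of u) (biword_of v)) w =
     of_bool (w \<in> biword_of ` {l \<in> sh_words u v. fst (hd l) \<le> length u})"
    using key[of "\<lambda>\<alpha>. inv \<alpha> 0 = 0" "\<lambda>b. b"] c unfolding lt_basis_def by simp
  show "Poly_Mapping.lookup (gt_basis (biword_of u) (biword_of v)) w =
     of_bool (w \<in> biword_of ` {l \<in> sh_words u v. length u < fst (hd l)})"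
    using key[of "\<lambda>\<alpha>. inv \<alpha> 0 = length u" Not] c unfolding gt_basis_def by (simp add: not_le)
qed

section \<open>Products as convolutions over the cut value\<close>

lemma sh_words_lo_hi:
  "gword l \<Longrightarrow> k \<le> length l \<Longrightarrow> l' \<in> sh_words (lo k l) (hi k l) \<longleftrightarrow>
     gword l' \<and> length l' = length l \<and> lo k l' = lo k l \<and> hi k l' = hi k l"
  by (simp add: sh_words_def gword_lo gword_hi)

text \<open>A word \<open>l\<close> is a shuffle of \<open>u\<close> and \<open>v\<close> only if
  \<open>u = lo k l\<close> and \<open>v = hi k l\<close> with \<open>k = length u\<close>. The
  double sum over both supports therefore collapses to a sum over \<open>k\<close>; the set
  \<open>K\<close> encodes which half-product is meant.\<close>

lemma cf_bilin_ext:
  assumes x: "x \<in> S_plus" and y: "y \<in> S_plus" and l: "gword l"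
    and h: "\<And>u v. gword_plus u \<Longrightarrow> gword_plus v \<Longrightarrow>
      Poly_Mapping.lookup (h (biword_of u) (biword_of v)) (biword_of l) =
        of_bool (l \<in> sh_words u v \<and> length u \<in> K)"
    and K: "K \<subseteq> {1..<length l}"
  shows "cf (bilin_ext h x y) l = (\<Sum>k\<in>K. cf x (lo k l) * cf y (hi k l))"
proof -
  let ?P = "\<lambda>k. (biword_of (lo k l), biword_of (hi k l))"
  let ?X = "Poly_Mapping.keys x \<times> Poly_Mapping.keys y"
  let ?g = "\<lambda>(u, v). Poly_Mapping.lookup x u * Poly_Mapping.lookup y v"
  have fK: "finite K" using K finite_subset by blast
  have lK: "length (lo k l) = k" if "k \<in> K" for k
    using that K l by (intro gword_lo) auto
  have injP: "inj_on ?P K"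
  proof (rule inj_onI)
    fix j k assume "j \<in> K" "k \<in> K" "?P j = ?P k"
    then show "j = k" using lK by (metis biword_of_eq_iff prod.inject)
  qed
  have "cf (bilin_ext h x y) l = (\<Sum>p\<in>?X. ?g p * of_bool (p \<in> ?P ` K))"
    unfolding cf_def lookup_bilin_ext
  proof (rule sum.cong)
    fix p assume p: "p \<in> ?X"
    then obtain u v where uv: "p = (biword_of u, biword_of v)" "gword_plus u" "gword_plus v"
      using x y unfolding S_plus_iff by blast
    have "l \<in> sh_words u v \<and> length u \<in> K \<longleftrightarrow> p \<in> ?P ` K"
    proof
      assume "l \<in> sh_words u v \<and> length u \<in> K"
      then show "p \<in> ?P ` K"
        by (auto simp: uv sh_words_def intro!: image_eqI[of _ _ "length u"])
    next
      assume "p \<in> ?P ` K"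
      then obtain k where k: "k \<in> K" "u = lo k l" "v = hi k l"
        by (auto simp: uv)
      then have "k \<le> length l" using K by auto
      then have "l \<in> sh_words u v" using sh_words_lo_hi[OF l] l k by blast
      then show "l \<in> sh_words u v \<and> length u \<in> K" using k lK by simp
    qed
    then show "(case p of (u, v) \<Rightarrow> Poly_Mapping.lookup x u * Poly_Mapping.lookup y v *
        Poly_Mapping.lookup (h u v) (biword_of l)) = ?g p * of_bool (p \<in> ?P ` K)"
      using h[OF uv(2,3)] by (simp add: uv(1))
  qed simp
  also have "\<dots> = (\<Sum>p\<in>?P ` K. ?g p)"
  proof -
    have "(\<Sum>p\<in>?X. ?g p * of_bool (p \<in> ?P ` K)) = (\<Sum>p\<in>?X \<inter> ?P ` K. ?g p)"
      by (rule sum.mono_neutral_cong_right) auto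
    also have "\<dots> = (\<Sum>p\<in>?P ` K. ?g p)"
      using fK by (intro sum.mono_neutral_left) (auto simp: in_keys_iff)
    finally show ?thesis .
  qed
  also have "\<dots> = (\<Sum>k\<in>K. cf x (lo k l) * cf y (hi k l))"
    by (simp add: sum.reindex[OF injP] cf_def)
  finally show ?thesis .
qed

lemma bilin_ext_in_S_plus:
  assumes "x \<in> S_plus" "y \<in> S_plus"
    and h: "\<And>u v. gword_plus u \<Longrightarrow> gword_plus v \<Longrightarrow>
      Poly_Mapping.keys (h (biword_of u) (biword_of v)) \<subseteq> biword_of ` Collect gword_plus"
  shows "bilin_ext h x y \<in> S_plus"
  unfolding S_plus_iff
proof
  fix w assume "w \<in> Poly_Mapping.keys (bilin_ext h x y)"
  then have "(\<Sum>(u, v)\<in>Poly_Mapping.keys x \<times> Poly_Mapping.keys y.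
        Poly_Mapping.lookup x u * Poly_Mapping.lookup y v * Poly_Mapping.lookup (h u v) w) \<noteq> 0"
    by (simp only: in_keys_iff lookup_bilin_ext not_False_eq_True)
  then obtain p where p: "p \<in> Poly_Mapping.keys x \<times> Poly_Mapping.keys y"
      "(case p of (u, v) \<Rightarrow>
        Poly_Mapping.lookup x u * Poly_Mapping.lookup y v * Poly_Mapping.lookup (h u v) w) \<noteq> 0"
    by (rule sum.not_neutral_contains_not_neutral)
  obtain u v where uv: "p = (biword_of u, biword_of v)" "gword_plus u" "gword_plus v"
    using assms(1,2) p(1) unfolding S_plus_iff by blast
  then have "w \<in> Poly_Mapping.keys (h (biword_of u) (biword_of v))"
    using p(2) by (simp add: in_keys_iff)
  then show "w \<in> biword_of ` Collect gword_plus" using h[OF uv(2,3)] by blast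
qed

lemma gword_plus_sh_words: "gword_plus u \<Longrightarrow> l \<in> sh_words u v \<Longrightarrow> gword_plus l"
  by (auto simp: sh_words_def gword_plus_def)

lemma lt_S_in_S_plus: "x \<in> S_plus \<Longrightarrow> y \<in> S_plus \<Longrightarrow> lt_S x y \<in> S_plus"
  and gt_S_in_S_plus: "x \<in> S_plus \<Longrightarrow> y \<in> S_plus \<Longrightarrow> gt_S x y \<in> S_plus"
  unfolding lt_S_def gt_S_def
  by (erule bilin_ext_in_S_plus, assumption,
      auto simp: in_keys_iff lookup_lt_basis gword_plus_sh_words)+

text \<open>The first letter of \<open>l\<close> belongs to the left factor exactly when the cut
  value \<open>k\<close> is at least that letter; \<open>k < length l\<close> keeps the right factor
  nonempty.\<close>

lemma cf_lt_S:
  assumes "x \<in> S_plus" "y \<in> S_plus" "gword_plus l"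
  shows "cf (lt_S x y) l = (\<Sum>k = fst (hd l)..<length l. cf x (lo k l) * cf y (hi k l))"
  unfolding lt_S_def
proof (rule cf_bilin_ext[OF assms(1,2)])
  fix u v assume uv: "gword_plus u" "gword_plus v"
  have "length u < length l" if "l \<in> sh_words u v"
    using that uv by (auto simp: sh_words_def gword_plus_def)
  then show "Poly_Mapping.lookup (lt_basis (biword_of u) (biword_of v)) (biword_of l) =
      of_bool (l \<in> sh_words u v \<and> length u \<in> {fst (hd l)..<length l})"
    unfolding lookup_lt_basis[OF uv] by (auto simp: inj_image_mem_iff[OF inj_biword_of])
qed (use assms(3) fst_hd_gword in auto)

lemma cf_gt_S:
  assumes "x \<in> S_plus" "y \<in> S_plus" "gword_plus l"
  shows "cf (gt_S x y) l = (\<Sum>k = 1..<fst (hd l). cf x (lo k l) * cf y (hi k l))"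
  unfolding gt_S_def
proof (rule cf_bilin_ext[OF assms(1,2)])
  fix u v assume uv: "gword_plus u" "gword_plus v"
  have "1 \<le> length u"
    using uv by (auto simp: gword_plus_def Suc_le_eq)
  then show "Poly_Mapping.lookup (gt_basis (biword_of u) (biword_of v)) (biword_of l) =
      of_bool (l \<in> sh_words u v \<and> length u \<in> {1..<fst (hd l)})"
    unfolding lookup_lt_basis[OF uv] by (auto simp: inj_image_mem_iff[OF inj_biword_of])
qed (use assms(3) fst_hd_gword[of l] in auto)

lemma cf_lt_gt_S:
  assumes "x \<in> S_plus" "y \<in> S_plus" "gword_plus l"
  shows "cf (lt_S x y + gt_S x y) l = (\<Sum>k = 1..<length l. cf x (lo k l) * cf y (hi k l))"
  using fst_hd_gword[OF assms(3)] cf_lt_S[OF assms] cf_gt_S[OF assms]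
    sum.atLeastLessThan_concat[of 1 "fst (hd l)" "length l" "\<lambda>k. cf x (lo k l) * cf y (hi k l)"]
  by simp

section \<open>The dendriform axioms\<close>

lemma sum_triangle_swap:
  fixes f :: "nat \<Rightarrow> nat \<Rightarrow> 'c::comm_monoid_add"
  shows "(\<Sum>k = a..<b. \<Sum>j = a..<k. f j k) = (\<Sum>j = a..<b. \<Sum>k = Suc j..<b. f j k)"
proof -
  have "(\<Sum>k = a..<b. \<Sum>j = a..<k. f j k) =
      (\<Sum>p\<in>Sigma {a..<b} (\<lambda>k. {a..<k}). f (snd p) (fst p))"
    by (simp add: sum.Sigma case_prod_beta)
  also have "\<dots> = (\<Sum>p\<in>Sigma {a..<b} (\<lambda>j. {Suc j..<b}). f (fst p) (snd p))"
    by (rule sum.reindex_bij_witness[where i = prod.swap and j = prod.swap]) auto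
  also have "\<dots> = (\<Sum>j = a..<b. \<Sum>k = Suc j..<b. f j k)"
    by (simp add: sum.Sigma case_prod_beta)
  finally show ?thesis .
qed

context
  fixes x y z :: "biword \<Rightarrow>\<^sub>0 rat" and l :: word
  assumes S: "x \<in> S_plus" "y \<in> S_plus" "z \<in> S_plus" and l: "gword_plus l"
begin

text \<open>All the triple products are sums of the following terms over a region of pairs
  \<open>j < k\<close>: the word is cut by letter values into the intervals up to \<open>j\<close>, up to \<open>k\<close>, and beyond.\<close>

private definition "trip j k = cf x (lo j l) * cf y (hi j (lo k l)) * cf z (hi k l)"

private lemma bounds: "1 \<le> fst (hd l)" "fst (hd l) \<le> length l" "gword l" "l \<noteq> []"
  using fst_hd_gword[OF l] l by (auto simp: gword_plus_def)

private lemma left_term: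
  assumes "J \<subseteq> {..<k}" "u = (\<Sum>j\<in>J. cf x (lo j (lo k l)) * cf y (hi j (lo k l)))"
  shows "u * cf z (hi k l) = (\<Sum>j\<in>J. trip j k)"
proof -
  have "lo j (lo k l) = lo j l" if "j \<in> J" for j
    using that assms(1) by (auto simp: lo_lo min_def)
  then show ?thesis
    unfolding assms(2) sum_distrib_right trip_def by (intro sum.cong) auto
qed

private lemma left_lt:
  assumes "k \<in> {fst (hd l)..<length l}"
  shows "cf (lt_S x y) (lo k l) * cf z (hi k l) = (\<Sum>j = fst (hd l)..<k. trip j k)"
    and "cf (gt_S x y) (lo k l) * cf z (hi k l) = (\<Sum>j = 1..<fst (hd l). trip j k)"
proof -
  have k: "fst (hd l) \<le> k" "k < length l" using assms by auto
  have g: "gword_plus (lo k l)"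
    using bounds k by (intro gword_plus_lo) auto
  have h: "hd (lo k l) = hd l" using bounds k by (intro hd_lo) auto
  have n: "length (lo k l) = k" using gword_lo[OF bounds(3), of k] k by simp
  show "cf (lt_S x y) (lo k l) * cf z (hi k l) = (\<Sum>j = fst (hd l)..<k. trip j k)"
    using cf_lt_S[OF S(1,2) g] unfolding h n by (intro left_term) auto
  show "cf (gt_S x y) (lo k l) * cf z (hi k l) = (\<Sum>j = 1..<fst (hd l). trip j k)"
    using cf_gt_S[OF S(1,2) g] k unfolding h by (intro left_term) auto
qed

private lemma left_gt:
  assumes "k \<in> {1..<fst (hd l)}"
  shows "cf (lt_S x y + gt_S x y) (lo k l) * cf z (hi k l) = (\<Sum>j = 1..<k. trip j k)"
proof -
  have k: "1 \<le> k" "k < length l" using assms bounds by auto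
  have g: "gword_plus (lo k l)"
    using bounds k by (intro gword_plus_lo) auto
  have n: "length (lo k l) = k" using gword_lo[OF bounds(3), of k] k by simp
  show ?thesis
    using cf_lt_gt_S[OF S(1,2) g] unfolding n by (intro left_term) auto
qed

text \<open>Cutting \<open>hi j l\<close> at the value \<open>i\<close> amounts to cutting
  \<open>l\<close> at \<open>i + j\<close>, hence the shift of the summation bounds by
  \<open>j\<close>.\<close>

private lemma right_term:
  assumes "u = (\<Sum>i = a - j..<b - j. cf y (lo i (hi j l)) * cf z (hi i (hi j l)))" "j \<le> a" "a \<le> b"
  shows "cf x (lo j l) * u = (\<Sum>k = a..<b. trip j k)"
proof -
  have "cf x (lo j l) * u = (\<Sum>i = a - j..<b - j. trip j (i + j))"
    unfolding assms(1) sum_distrib_left trip_def lo_hi hi_hi by (simp only: mult.assoc)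
  also have "\<dots> = (\<Sum>k = a - j + j..<b - j + j. trip j k)"
    by (simp only: sum.shift_bounds_nat_ivl)
  finally show ?thesis using assms by simp
qed

private lemma right_lt:
  assumes "j \<in> {fst (hd l)..<length l}"
  shows "cf x (lo j l) * cf (lt_S y z + gt_S y z) (hi j l) = (\<Sum>k = Suc j..<length l. trip j k)"
proof -
  have j: "j < length l" using assms by auto
  have g: "gword_plus (hi j l)"
    using bounds j by (intro gword_plus_hi) auto
  have n: "length (hi j l) = length l - j" using gword_hi[OF bounds(3), of j] j by simp
  show ?thesis
    using cf_lt_gt_S[OF S(2,3) g] j unfolding n by (intro right_term) auto
qed

private lemma right_gt:
  assumes "j \<in> {1..<fst (hd l)}"
  shows "cf x (lo j l) * cf (lt_S y z) (hi j l) = (\<Sum>k = fst (hd l)..<length l. trip j k)"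
    and "cf x (lo j l) * cf (gt_S y z) (hi j l) = (\<Sum>k = Suc j..<fst (hd l). trip j k)"
proof -
  have j: "j < length l" "j < fst (hd l)" using assms bounds by auto
  have g: "gword_plus (hi j l)"
    using bounds j by (intro gword_plus_hi) auto
  have h: "fst (hd (hi j l)) = fst (hd l) - j" using bounds j by (intro hd_hi) auto
  have n: "length (hi j l) = length l - j" using gword_hi[OF bounds(3), of j] j by simp
  show "cf x (lo j l) * cf (lt_S y z) (hi j l) = (\<Sum>k = fst (hd l)..<length l. trip j k)"
    using cf_lt_S[OF S(2,3) g] j bounds(2) unfolding n h by (intro right_term) auto
  show "cf x (lo j l) * cf (gt_S y z) (hi j l) = (\<Sum>k = Suc j..<fst (hd l). trip j k)"
    using cf_gt_S[OF S(2,3) g] j unfolding h by (intro right_term) auto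
qed

text \<open>Both sides of each axiom sum \<open>trip j k\<close> over the same region. With
  \<open>h\<close> the first letter of \<open>l\<close>, the regions are
  \<open>h \<le> j < k\<close> for the first axiom, \<open>j < h \<le> k\<close> for the second and
  \<open>j < k < h\<close> for the third.\<close>

lemma cf_dendriform:
  "cf (lt_S (lt_S x y) z) l = cf (lt_S x (lt_S y z + gt_S y z)) l"
  "cf (lt_S (gt_S x y) z) l = cf (gt_S x (lt_S y z)) l"
  "cf (gt_S (lt_S x y + gt_S x y) z) l = cf (gt_S x (gt_S y z)) l"
proof -
  note cl = lt_S_in_S_plus gt_S_in_S_plus scl.subspace_add[OF subspace_S_plus] S
  show "cf (lt_S (lt_S x y) z) l = cf (lt_S x (lt_S y z + gt_S y z)) l"
    using l by (simp only: cf_lt_S cl left_lt right_lt sum_triangle_swap cong: sum.cong)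
  have "cf (lt_S (gt_S x y) z) l = (\<Sum>k = fst (hd l)..<length l. \<Sum>j = 1..<fst (hd l). trip j k)"
    using l by (simp only: cf_lt_S cl left_lt cong: sum.cong)
  also have "\<dots> = (\<Sum>j = 1..<fst (hd l). \<Sum>k = fst (hd l)..<length l. trip j k)"
    by (rule sum.swap)
  finally show "cf (lt_S (gt_S x y) z) l = cf (gt_S x (lt_S y z)) l"
    using l by (simp only: cf_gt_S cl right_gt cong: sum.cong)
  show "cf (gt_S (lt_S x y + gt_S x y) z) l = cf (gt_S x (gt_S y z)) l"
    using l by (simp only: cf_gt_S cl left_gt right_gt sum_triangle_swap cong: sum.cong)
qed

end

lemma dendriform_algebra_S_plus_subspace:
  assumes "scl.subspace A" "A \<subseteq> S_plus"
    and "\<And>x y. x \<in> A \<Longrightarrow> y \<in> A \<Longrightarrow> lt_S x y \<in> A" "\<And>x y. x \<in> A \<Longrightarrow> y \<in> A \<Longrightarrow> gt_S x y \<in> A"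
  shows "dendriform_algebra scl A lt_S gt_S"
proof -
  note cl = lt_S_in_S_plus gt_S_in_S_plus scl.subspace_add[OF subspace_S_plus]
    scl.subspace_scale[OF subspace_S_plus]
  have A: "x \<in> S_plus" if "x \<in> A" for x using that assms(2) by blast
  note cf = cf_lt_S cf_gt_S cf_simps
  show ?thesis
  proof (unfold_locales, goal_cases)
    case (4 x y z)
    then show ?case by (intro S_plus_eqI) (simp_all add: cf cl A algebra_simps sum.distrib)
  next
    case (5 x y z)
    then show ?case by (intro S_plus_eqI) (simp_all add: cf cl A algebra_simps sum.distrib)
  next
    case (6 x y c)
    then show ?case by (intro S_plus_eqI) (simp_all add: cf cl A algebra_simps sum_distrib_left)
  next
    case (7 x y c)
    then show ?case by (intro S_plus_eqI) (simp_all add: cf cl A algebra_simps sum_distrib_left)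
  next
    case (8 x y z)
    then show ?case by (intro S_plus_eqI) (simp_all add: cf cl A algebra_simps sum.distrib)
  next
    case (9 x y z)
    then show ?case by (intro S_plus_eqI) (simp_all add: cf cl A algebra_simps sum.distrib)
  next
    case (10 x y c)
    then show ?case by (intro S_plus_eqI) (simp_all add: cf cl A algebra_simps sum_distrib_left)
  next
    case (11 x y c)
    then show ?case by (intro S_plus_eqI) (simp_all add: cf cl A algebra_simps sum_distrib_left)
  next
    case (12 x y z)
    then show ?case by (intro S_plus_eqI) (simp_all only: cf_dendriform cl A)
  next
    case (13 x y z)
    then show ?case by (intro S_plus_eqI) (simp_all only: cf_dendriform cl A)
  next
    case (14 x y z)
    then show ?case by (intro S_plus_eqI) (simp_all only: cf_dendriform cl A)
  qed (use assms in auto)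
qed

section \<open>Binary search trees of words\<close>

text \<open>Insertion of the letters of a word, from left to right, into a binary search tree; the
  fibres of this map on permutations are the sylvester classes.\<close>

function search_tree :: "('a::linorder \<times> 'b) list \<Rightarrow> ('a \<times> 'b) tree" where
  "search_tree [] = Leaf"
| "search_tree (p # ps) =
     Node (search_tree (filter (\<lambda>q. fst q < fst p) ps)) p (search_tree (filter (\<lambda>q. fst p < fst q) ps))"
  by pat_completeness auto
termination by (relation "measure length") (auto simp: less_Suc_eq_le)

lemma search_tree_eq_Leaf_iff [simp]: "search_tree l = Leaf \<longleftrightarrow> l = []"
  by (cases l) auto

text \<open>\<open>P\<close> selects an initial or a final interval of letters. If the root
  survives, its two subtrees are filtered separately; otherwise all survivors lie on one side of it,
  and only that subtree matters. For general \<open>P\<close> this fails: 213 and 231 have the same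
  tree, but after deletion of 2 the words 13 and 31 do not.\<close>

lemma search_tree_filter_cong:
  fixes l l' :: "('a::linorder \<times> 'b) list"
  assumes "search_tree l = search_tree l'"
    and "(\<forall>a b. a \<le> b \<longrightarrow> P b \<longrightarrow> P a) \<or> (\<forall>a b. a \<le> b \<longrightarrow> P a \<longrightarrow> P b)"
  shows "search_tree (filter (\<lambda>q. P (fst q)) l) = search_tree (filter (\<lambda>q. P (fst q)) l')"
  using assms(1)
proof (induction l arbitrary: l' rule: length_induct)
  case (1 l)
  show ?case
  proof (cases l)
    case Nil
    then show ?thesis using 1(2) by (cases l') auto
  next
    case (Cons p ps)
    then obtain ps' where l': "l' = p # ps'"
      and eq: "search_tree (filter (\<lambda>q. fst q < fst p) ps) = search_tree (filter (\<lambda>q. fst q < fst p) ps')"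
        "search_tree (filter (\<lambda>q. fst p < fst q) ps) = search_tree (filter (\<lambda>q. fst p < fst q) ps')"
      using 1(2) by (cases l') auto
    have IH: "search_tree (filter (\<lambda>q. P (fst q)) (filter Q ps)) =
        search_tree (filter (\<lambda>q. P (fst q)) (filter Q ps'))"
      if "search_tree (filter Q ps) = search_tree (filter Q ps')" for Q
      using that 1(1) Cons by (simp add: less_Suc_eq_le del: filter_filter)
    show ?thesis
    proof (cases "P (fst p)")
      case True
      then show ?thesis
        using IH[OF eq(1)] IH[OF eq(2)] by (simp add: Cons l' conj_commute)
    next
      case False
      from assms(2) show ?thesis
      proof
        assume "\<forall>a b. a \<le> b \<longrightarrow> P b \<longrightarrow> P a"
        then have F: "filter (\<lambda>q. P (fst q)) qs = filter (\<lambda>q. P (fst q)) (filter (\<lambda>q. fst q < fst p) qs)" for qs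
          using False by (auto simp del: filter_filter simp: filter_filter[of _ "\<lambda>q. fst q < fst p"]
              intro!: filter_cong) (metis linorder_not_le)
        show ?thesis
          using IH[OF eq(1)] False
          by (simp only: Cons l' filter.simps F[of ps, symmetric] F[of ps', symmetric] if_False)
      next
        assume "\<forall>a b. a \<le> b \<longrightarrow> P a \<longrightarrow> P b"
        then have F: "filter (\<lambda>q. P (fst q)) qs = filter (\<lambda>q. P (fst q)) (filter (\<lambda>q. fst p < fst q) qs)" for qs
          using False by (auto simp del: filter_filter simp: filter_filter[of _ "\<lambda>q. fst p < fst q"]
              intro!: filter_cong) (metis linorder_not_le)
        show ?thesis
          using IH[OF eq(2)] False
          by (simp only: Cons l' filter.simps F[of ps, symmetric] F[of ps', symmetric] if_False)
      qed
    qed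
  qed
qed

text \<open>The root of the first tree splits both factors. The two parts of \<open>v\<close> are
  restrictions to intervals of letters, so their trees depend only on the tree of \<open>v\<close>,
  and the induction applies on each side.\<close>

lemma search_tree_append_cong:
  fixes u u' :: "('a::linorder \<times> 'b) list"
  assumes "search_tree u = search_tree u'" "search_tree v = search_tree v'"
  shows "search_tree (u @ v) = search_tree (u' @ v')"
  using assms
proof (induction u arbitrary: u' v v' rule: length_induct)
  case (1 u)
  show ?case
  proof (cases u)
    case Nil
    then show ?thesis using 1(2,3) by (cases u') auto
  next
    case (Cons p ps)
    then obtain ps' where u': "u' = p # ps'"
      and eq: "search_tree (filter (\<lambda>q. fst q < fst p) ps) = search_tree (filter (\<lambda>q. fst q < fst p) ps')"
        "search_tree (filter (\<lambda>q. fst p < fst q) ps) = search_tree (filter (\<lambda>q. fst p < fst q) ps')"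
      using 1(2) by (cases u') auto
    have IH: "search_tree (filter Q ps @ w) = search_tree (filter Q ps' @ w')"
      if "search_tree (filter Q ps) = search_tree (filter Q ps')" "search_tree w = search_tree w'" for Q w w'
      using that 1(1) Cons by (simp add: less_Suc_eq_le)
    have "search_tree (filter (\<lambda>q. fst q < fst p) v) = search_tree (filter (\<lambda>q. fst q < fst p) v')"
      using 1(3) by (rule search_tree_filter_cong[where P = "\<lambda>a. a < fst p"]) auto
    moreover have "search_tree (filter (\<lambda>q. fst p < fst q) v) = search_tree (filter (\<lambda>q. fst p < fst q) v')"
      using 1(3) by (rule search_tree_filter_cong[where P = "\<lambda>a. fst p < a"]) auto
    ultimately show ?thesis
      using IH[OF eq(1)] IH[OF eq(2)] by (simp add: Cons u')
  qed
qed

lemma search_tree_map: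
  fixes f :: "'a::linorder \<Rightarrow> 'c::linorder"
  assumes "strict_mono_on (fst ` set l) f"
  shows "search_tree (map (apfst f) l) = map_tree (apfst f) (search_tree l)"
  using assms
proof (induction l rule: search_tree.induct)
  case (2 p ps)
  have less: "f a < f b \<longleftrightarrow> a < b" if "a \<in> fst ` set (p # ps)" "b \<in> fst ` set (p # ps)" for a b
    using strict_mono_on_less[OF 2(3)] that by blast
  have "filter (\<lambda>q. fst q < fst (apfst f p)) (map (apfst f) ps) = map (apfst f) (filter (\<lambda>q. fst q < fst p) ps)"
    unfolding filter_map by (rule arg_cong[of _ _ "map _"], rule filter_cong) (simp_all add: less)
  moreover have "filter (\<lambda>q. fst (apfst f p) < fst q) (map (apfst f) ps) = map (apfst f) (filter (\<lambda>q. fst p < fst q) ps)"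
    unfolding filter_map by (rule arg_cong[of _ _ "map _"], rule filter_cong) (simp_all add: less)
  moreover have "strict_mono_on (fst ` set (filter Q ps)) f" for Q
    by (rule monotone_on_subset[OF 2(3)]) auto
  ultimately show ?case using 2(1,2) by simp
qed simp

lemma inorder_search_tree:
  "sorted_wrt (<) (map fst (inorder (search_tree l))) \<and> fst ` set (inorder (search_tree l)) = fst ` set l"
proof (induction l rule: search_tree.induct)
  case (2 p ps)
  let ?L = "filter (\<lambda>q. fst q < fst p) ps" and ?R = "filter (\<lambda>q. fst p < fst q) ps"
  let ?l = "map fst (inorder (search_tree ?L))" and ?r = "map fst (inorder (search_tree ?R))"
  have l: "sorted_wrt (<) ?l" "set ?l = fst ` set ?L" and r: "sorted_wrt (<) ?r" "set ?r = fst ` set ?R"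
    using 2 by (simp_all only: set_map)
  have less: "a < fst p" if "a \<in> set ?l" for a
    using that unfolding l(2) by (elim imageE) (simp only: set_filter mem_Collect_eq)
  have greater: "fst p < a" if "a \<in> set ?r" for a
    using that unfolding r(2) by (elim imageE) (simp only: set_filter mem_Collect_eq)
  have "map fst (inorder (search_tree (p # ps))) = ?l @ fst p # ?r" by simp
  moreover have "sorted_wrt (<) (?l @ fst p # ?r)"
    unfolding sorted_wrt_append sorted_wrt.simps list.set
    using l(1) r(1) less greater by (blast intro: less_trans)
  moreover have "fst ` set ?L \<union> insert (fst p) (fst ` set ?R) = fst ` set (p # ps)"
    by (auto simp: image_iff)
  then have "set (?l @ fst p # ?r) = fst ` set (p # ps)"
    by (simp only: set_append list.set l(2) r(2))
  ultimately show ?case by (metis set_map)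
qed simp

lemma size_search_tree: "distinct (map fst l) \<Longrightarrow> size (search_tree l) = length l"
proof (induction l rule: search_tree.induct)
  case (2 p ps)
  have "length (filter (\<lambda>q. fst q < fst p) ps) + length (filter (\<lambda>q. fst p < fst q) ps) = length ps"
  proof -
    have "filter (\<lambda>q. fst p < fst q) ps = filter (\<lambda>q. \<not> fst q < fst p) ps"
    proof (rule filter_cong)
      fix q assume "q \<in> set ps"
      then have "fst q \<in> fst ` set ps" by (rule imageI)
      then have "fst q \<noteq> fst p" using 2(3) by (metis distinct.simps(2) list.simps(9) set_map)
      then show "fst p < fst q \<longleftrightarrow> \<not> fst q < fst p" by auto
    qed simp
    then show ?thesis by (simp only: sum_length_filter_compl)
  qed
  then show ?case using 2 by (simp add: distinct_fst_filter)
qed simp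

lemma tree_eqI:
  "map_tree snd t = map_tree snd t' \<Longrightarrow> map fst (inorder t) = map fst (inorder t') \<Longrightarrow> t = t'"
proof (induction t arbitrary: t')
  case Leaf
  then show ?case by (cases t') auto
next
  case (Node l a r)
  then obtain l' a' r' where t': "t' = Node l' a' r'" "map_tree snd l = map_tree snd l'"
      "snd a = snd a'" "map_tree snd r = map_tree snd r'"
    by (cases t') auto
  \<comment> \<open>Equally large left subtrees make the two inorder lists split at the same
    place.\<close>
  then have "size l = size l'" by (metis size_map_tree)
  then have "length (map fst (inorder l)) = length (map fst (inorder l'))" by simp
  then have "map fst (inorder l) = map fst (inorder l')" "fst a = fst a'" "map fst (inorder r) = map fst (inorder r')"
    using Node.prems(2) by (auto simp: t' append_eq_append_conv)
  then show ?case using Node.IH t' by (simp add: prod_eq_iff)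
qed

text \<open>Only the degrees are kept as labels. For a graded permutation the letters can be
  restored, because read in order they are \<open>1, ..., n\<close>.\<close>

definition shape :: "word \<Rightarrow> nat tree" where
  "shape l = map_tree snd (search_tree l)"

lemma shape_simps [simp]:
  "shape [] = Leaf"
  "shape (p # ps) = Node (shape (filter (\<lambda>q. fst q < fst p) ps)) (snd p) (shape (filter (\<lambda>q. fst p < fst q) ps))"
  by (simp_all add: shape_def)

lemma shape_eq_Leaf_iff [simp]: "shape l = Leaf \<longleftrightarrow> l = []"
  by (simp add: shape_def)

lemma size_shape: "distinct (map fst l) \<Longrightarrow> size (shape l) = length l"
  by (simp add: shape_def size_search_tree)

lemma size_shape_gword: "gword l \<Longrightarrow> size (shape l) = length l"
  by (simp add: size_shape gwordD)

lemma shape_map: "strict_mono_on (fst ` set l) f \<Longrightarrow> shape (map (apfst f) l) = shape l"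
  by (simp add: shape_def search_tree_map tree.map_comp o_def)

lemma shape_hi: "shape (hi k l) = shape (filter (\<lambda>p. k < fst p) l)"
  unfolding hi_def by (rule shape_map) (auto intro!: strict_mono_onI)

lemma search_tree_eq_iff_shape:
  assumes "gword l" "gword l'"
  shows "search_tree l = search_tree l' \<longleftrightarrow> shape l = shape l'"
proof
  assume s: "shape l = shape l'"
  then have "length l = length l'"
    using size_shape_gword assms by metis
  then have "set (map fst (inorder (search_tree l))) = set (map fst (inorder (search_tree l')))"
    using inorder_search_tree[of l] inorder_search_tree[of l'] gwordD(2)[OF assms(1)] gwordD(2)[OF assms(2)]
    by (simp only: set_map)
  then have "map fst (inorder (search_tree l)) = map fst (inorder (search_tree l'))"
    using inorder_search_tree[of l] inorder_search_tree[of l'] by (intro strict_sorted_equal) blast+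
  with s show "search_tree l = search_tree l'"
    by (intro tree_eqI) (simp_all add: shape_def)
qed (simp add: shape_def)

text \<open>These are the data of a word that enter \<open>cf_lt_S\<close> and
  \<open>cf_gt_S\<close>. Even the value of the first letter is among them: it is one more than the
  size of the left subtree.\<close>

lemma shape_eqD:
  assumes "gword l" "gword l'" "shape l = shape l'"
  shows "length l = length l'" "l \<noteq> [] \<Longrightarrow> hd l = hd l'"
    "shape (lo k l) = shape (lo k l')" "shape (hi k l) = shape (hi k l')"
proof -
  have t: "search_tree l = search_tree l'" using assms search_tree_eq_iff_shape by blast
  show "length l = length l'" using size_shape_gword assms by metis
  show "hd l = hd l'" if "l \<noteq> []" using t that by (cases l; cases l') auto
  show "shape (lo k l) = shape (lo k l')"
    unfolding shape_def lo_def
    using search_tree_filter_cong[OF t, of "\<lambda>a. a \<le> k"] by auto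
  show "shape (hi k l) = shape (hi k l')"
    unfolding shape_hi unfolding shape_def
    using search_tree_filter_cong[OF t, of "\<lambda>a. k < a"] by auto
qed

section \<open>Elements that are constant on sylvester classes\<close>

text \<open>A version, with nodes labelled by degrees and without unit, of the Loday-Ronco algebra
  of planar binary trees, realized by sums over sylvester classes.\<close>

definition sylv :: "(biword \<Rightarrow>\<^sub>0 rat) set" where
  "sylv = {x \<in> S_plus. \<forall>l l'. gword l \<longrightarrow> gword l' \<longrightarrow> shape l = shape l' \<longrightarrow> cf x l = cf x l'}"

lemma sylv_S_plus: "x \<in> sylv \<Longrightarrow> x \<in> S_plus"
  by (simp add: sylv_def)

lemma sylv_cf_cong: "x \<in> sylv \<Longrightarrow> gword l \<Longrightarrow> gword l' \<Longrightarrow> shape l = shape l' \<Longrightarrow> cf x l = cf x l'"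
  unfolding sylv_def mem_Collect_eq by blast

lemma sylvI:
  "x \<in> S_plus \<Longrightarrow> (\<And>l l'. gword l \<Longrightarrow> gword l' \<Longrightarrow> shape l = shape l' \<Longrightarrow> cf x l = cf x l') \<Longrightarrow> x \<in> sylv"
  unfolding sylv_def mem_Collect_eq by blast

lemma subspace_sylv: "scl.subspace sylv"
proof (rule scl.subspaceI)
  show "0 \<in> sylv"
    using scl.subspace_0[OF subspace_S_plus] by (rule sylvI) simp
  show "x + y \<in> sylv" if "x \<in> sylv" "y \<in> sylv" for x y
    using scl.subspace_add[OF subspace_S_plus that[THEN sylv_S_plus]]
  proof (rule sylvI)
    fix l l' assume l: "gword l" "gword l'" "shape l = shape l'"
    show "cf (x + y) l = cf (x + y) l'"
      using sylv_cf_cong[OF that(1) l] sylv_cf_cong[OF that(2) l] by simp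
  qed
  show "scl c x \<in> sylv" if "x \<in> sylv" for c x
    using scl.subspace_scale[OF subspace_S_plus sylv_S_plus[OF that]]
  proof (rule sylvI)
    fix l l' assume l: "gword l" "gword l'" "shape l = shape l'"
    show "cf (scl c x) l = cf (scl c x) l'"
      using sylv_cf_cong[OF that l] by simp
  qed
qed

lemma sylv_closed:
  assumes "x \<in> sylv" "y \<in> sylv"
  shows "lt_S x y \<in> sylv" "gt_S x y \<in> sylv"
proof -
  note xy = assms[THEN sylv_S_plus]
  have eq: "cf (lt_S x y) l = cf (lt_S x y) l' \<and> cf (gt_S x y) l = cf (gt_S x y) l'"
    if l: "gword l" "gword l'" "shape l = shape l'" for l l'
  proof (cases "l = []")
    case True
    then show ?thesis using shape_eqD(1)[OF l] by simp
  next
    case False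
    note d = shape_eqD[OF l]
    have g: "gword_plus l" "gword_plus l'"
      using l False d(1) by (auto simp: gword_plus_def)
    have "cf x (lo k l) * cf y (hi k l) = cf x (lo k l') * cf y (hi k l')" if "k \<le> length l" for k
      using sylv_cf_cong[OF assms(1) _ _ d(3)] sylv_cf_cong[OF assms(2) _ _ d(4)]
        gword_lo[OF l(1)] gword_hi[OF l(1)] gword_lo[OF l(2)] gword_hi[OF l(2)] that d(1) by simp
    then show ?thesis
      unfolding cf_lt_S[OF xy g(1)] cf_lt_S[OF xy g(2)] cf_gt_S[OF xy g(1)] cf_gt_S[OF xy g(2)]
      using d(2)[OF False] d(1) fst_hd_gword[OF g(1)] by (auto intro!: sum.cong)
  qed
  show "lt_S x y \<in> sylv" "gt_S x y \<in> sylv"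
    using eq xy by (blast intro: sylvI lt_S_in_S_plus gt_S_in_S_plus)+
qed

section \<open>The basis of tree elements\<close>

lemma set_tree_search_tree: "distinct (map fst l) \<Longrightarrow> set_tree (search_tree l) = set l"
proof (induction l rule: search_tree.induct)
  case (2 p ps)
  have ne: "fst q \<noteq> fst p" if "q \<in> set ps" for q
  proof -
    have "fst q \<in> fst ` set ps" using that by (rule imageI)
    then show ?thesis using 2(3) by (metis distinct.simps(2) list.simps(9) set_map)
  qed
  have "distinct (map fst (filter Q ps))" for Q
    using 2(3) by (simp add: distinct_fst_filter)
  then have "set_tree (search_tree (p # ps)) =
      insert p ({q \<in> set ps. fst q < fst p} \<union> {q \<in> set ps. fst p < fst q})"
    using 2(1,2) by simp
  also have "\<dots> = set (p # ps)"
    using ne by (auto simp: neq_iff)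
  finally show ?case .
qed simp

lemma set_tree_shape: "gword l \<Longrightarrow> set_tree (shape l) = snd ` set l"
  by (simp add: shape_def tree.set_map set_tree_search_tree gwordD)

text \<open>The preorder reading of \<open>t\<close>, with inorder ranks as letters: a section of
  \<open>shape\<close>, picking one representative from each class.\<close>

fun word_of :: "nat tree \<Rightarrow> word" where
  "word_of Leaf = []"
| "word_of (Node l d r) = (Suc (size l), d) # word_of l @ shift (Suc (size l)) (word_of r)"

lemma word_of_props:
  "length (word_of t) = size t" "fst ` set (word_of t) = {1..size t}"
  "distinct (map fst (word_of t))" "snd ` set (word_of t) = set_tree t" "shape (word_of t) = t"
proof -
  have "length (word_of t) = size t \<and> fst ` set (word_of t) = {1..size t} \<and>
      distinct (map fst (word_of t)) \<and> snd ` set (word_of t) = set_tree t \<and> shape (word_of t) = t"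
  proof (induction t)
    case (Node l d r)
    have im: "(\<lambda>a. a + k) ` {1..m} = {k + 1..k + m}" for k m :: nat
      by (simp add: image_add_atLeastAtMost' add.commute)
    let ?k = "Suc (size l)"
    let ?s = "shift ?k (word_of r)"
    have l: "fst ` set (word_of l) = {1..size l}" and r: "fst ` set (word_of r) = {1..size r}"
      using Node by blast+
    have "fst ` set ?s = (\<lambda>a. a + ?k) ` fst ` set (word_of r)"
      by (simp only: shift_def set_map image_image fst_apfst)
    also have "\<dots> = {?k + 1..?k + size r}"
      unfolding r by (rule im)
    finally have s: "fst ` set ?s = {?k + 1..?k + size r}" .
    have "map fst ?s = map (\<lambda>a. a + ?k) (map fst (word_of r))"
      by (simp add: shift_def)
    moreover have "distinct (map (\<lambda>a. a + ?k) (map fst (word_of r)))"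
      unfolding distinct_map[of _ "map fst (word_of r)"] using Node by (simp add: inj_on_def)
    ultimately have ds: "distinct (map fst ?s)" by simp
    have "distinct (map fst (word_of (Node l d r)))"
    proof -
      have "?k \<notin> {1..size l} \<union> {?k + 1..?k + size r}" "{1..size l} \<inter> {?k + 1..?k + size r} = {}" by auto
      moreover have "map fst (word_of (Node l d r)) = ?k # map fst (word_of l) @ map fst ?s" by simp
      moreover have "distinct (map fst (word_of l))" using Node by blast
      then have "distinct (?k # map fst (word_of l) @ map fst ?s)"
        using ds calculation(1,2) unfolding distinct.simps distinct_append set_append set_map l s by blast
      ultimately show ?thesis by simp
    qed
    moreover have "fst ` set (word_of (Node l d r)) = {1..size (Node l d r)}"
    proof -
      have "fst ` set (word_of (Node l d r)) = insert ?k ({1..size l} \<union> {?k + 1..?k + size r})"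
        by (simp only: word_of.simps list.set set_append image_insert image_Un fst_conv l s)
      also have "\<dots> = {1..?k + size r}" by auto
      also have "?k + size r = size (Node l d r)" by simp
      finally show ?thesis .
    qed
    moreover have "snd ` set ?s = snd ` set (word_of r)"
      by (simp only: shift_def set_map image_image snd_apfst)
    then have "snd ` set (word_of (Node l d r)) = set_tree (Node l d r)"
      using Node by (auto simp: image_Un)
    moreover have "length (word_of (Node l d r)) = size (Node l d r)"
      using Node by simp
    moreover have "shape (word_of (Node l d r)) = Node l d r"
    proof -
      have bl: "fst q < ?k" if "q \<in> set (word_of l)" for q
        using imageI[OF that, of fst] unfolding l by simp
      have bs: "?k < fst q" if "q \<in> set ?s" for q
        using imageI[OF that, of fst] unfolding s by simp
      have "filter (\<lambda>q. fst q < ?k) (word_of l @ ?s) = word_of l"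
      proof -
        have "filter (\<lambda>q. fst q < ?k) (word_of l) = word_of l"
          using bl by (intro filter_True ballI)
        moreover have "filter (\<lambda>q. fst q < ?k) ?s = []"
          unfolding filter_empty_conv using bs by (meson less_asym)
        ultimately show ?thesis by (simp only: filter_append append_Nil2)
      qed
      moreover have "filter (\<lambda>q. ?k < fst q) (word_of l @ ?s) = ?s"
      proof -
        have "filter (\<lambda>q. ?k < fst q) ?s = ?s"
          using bs by (intro filter_True ballI)
        moreover have "filter (\<lambda>q. ?k < fst q) (word_of l) = []"
          unfolding filter_empty_conv using bl by (meson less_asym)
        ultimately show ?thesis by (simp only: filter_append append_Nil)
      qed
      moreover have "shape ?s = r"
        unfolding shift_def using Node by (subst shape_map) (auto intro!: strict_mono_onI)
      ultimately show ?thesis using Node by simp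
    qed
    ultimately show ?case by blast
  qed simp
  then show "length (word_of t) = size t" "fst ` set (word_of t) = {1..size t}"
    "distinct (map fst (word_of t))" "snd ` set (word_of t) = set_tree t" "shape (word_of t) = t"
    by blast+
qed

definition gtree :: "nat tree \<Rightarrow> bool" where
  "gtree t \<longleftrightarrow> t \<noteq> Leaf \<and> (\<forall>d\<in>set_tree t. 1 \<le> d)"

lemma gword_word_of_iff: "gword (word_of t) \<longleftrightarrow> (\<forall>d\<in>set_tree t. 1 \<le> d)"
proof
  assume "gword (word_of t)"
  then show "\<forall>d\<in>set_tree t. 1 \<le> d"
    using gwordD(3) unfolding word_of_props(4)[symmetric] by blast
next
  assume *: "\<forall>d\<in>set_tree t. 1 \<le> d"
  show "gword (word_of t)"
  proof (rule gwordI)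
    show "1 \<le> snd p" if "p \<in> set (word_of t)" for p
      using * imageI[OF that, of snd] unfolding word_of_props(4) by blast
  qed (simp_all only: word_of_props)
qed

lemma gword_plus_word_of_iff: "gword_plus (word_of t) \<longleftrightarrow> gtree t"
  unfolding gword_plus_def gtree_def gword_word_of_iff using word_of_props(1)[of t] by (cases t) auto

lemma gtree_shape: "gword_plus l \<Longrightarrow> gtree (shape l)"
  using set_tree_shape[of l] gwordD(3)[of l] unfolding gtree_def gword_plus_def by auto

definition tree_elt :: "nat tree \<Rightarrow> (biword \<Rightarrow>\<^sub>0 rat)" where
  "tree_elt t = (\<Sum>l | gword l \<and> shape l = t. basis_vec (biword_of l))"

lemma finite_shape_fibre: "finite {l. gword l \<and> shape l = t}"
proof (rule finite_subset)
  show "{l. gword l \<and> shape l = t} \<subseteq> {l. set l \<subseteq> {1..size t} \<times> set_tree t \<and> length l = size t}"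
  proof clarify
    fix l assume l: "gword l"
    have "set l \<subseteq> fst ` set l \<times> snd ` set l" by force
    then show "set l \<subseteq> {1..size (shape l)} \<times> set_tree (shape l) \<and> length l = size (shape l)"
      unfolding size_shape_gword[OF l] set_tree_shape[OF l] gwordD(2)[OF l] by blast
  qed
  show "finite {l. set l \<subseteq> {1..size t} \<times> set_tree t \<and> length l = size t}"
    by (intro finite_lists_length_eq finite_cartesian_product) auto
qed

lemma cf_tree_elt: "cf (tree_elt t) l = of_bool (gword l \<and> shape l = t)"
  unfolding cf_def tree_elt_def
  using lookup_sum_basis_vec_image[OF finite_shape_fibre inj_on_subset[OF inj_biword_of subset_UNIV]]
  by (simp add: inj_image_mem_iff[OF inj_biword_of])

lemma tree_elt_S_plus:
  assumes "t \<noteq> Leaf"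
  shows "tree_elt t \<in> S_plus"
  unfolding tree_elt_def
proof (rule scl.subspace_sum[OF subspace_S_plus])
  fix l assume "l \<in> {l. gword l \<and> shape l = t}"
  then have "gword_plus l" using assms by (auto simp: gword_plus_def)
  then show "basis_vec (biword_of l) \<in> S_plus"
    by (auto simp: S_plus_iff)
qed

lemma tree_elt_sylv: "t \<noteq> Leaf \<Longrightarrow> tree_elt t \<in> sylv"
  by (rule sylvI[OF tree_elt_S_plus]) (simp_all add: cf_tree_elt)

text \<open>For \<open>x\<close> in \<open>sylv\<close> this is the coordinate of \<open>x\<close>
  on \<open>tree_elt t\<close>, read off at the representative of the class.\<close>

definition tcoef :: "(biword \<Rightarrow>\<^sub>0 rat) \<Rightarrow> nat tree \<Rightarrow> rat" where
  "tcoef x t = cf x (word_of t)"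

definition tsupp :: "(biword \<Rightarrow>\<^sub>0 rat) \<Rightarrow> nat tree set" where
  "tsupp x = {t. tcoef x t \<noteq> 0}"

lemma tcoef_simps [simp]:
  "tcoef (x + y) t = tcoef x t + tcoef y t" "tcoef (scl c x) t = c * tcoef x t"
  by (simp_all add: tcoef_def)

lemma finite_tsupp: "finite (tsupp x)"
proof (rule finite_subset)
  show "tsupp x \<subseteq> shape ` (biword_of -` Poly_Mapping.keys x)"
  proof
    fix t assume "t \<in> tsupp x"
    then have "word_of t \<in> biword_of -` Poly_Mapping.keys x"
      by (simp add: tsupp_def tcoef_def cf_def in_keys_iff)
    then show "t \<in> shape ` (biword_of -` Poly_Mapping.keys x)"
      using word_of_props(5)[of t, symmetric] by (intro image_eqI[where x = "word_of t"])
  qed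
  show "finite (shape ` (biword_of -` Poly_Mapping.keys x))"
    by (intro finite_imageI finite_vimageI inj_biword_of) simp
qed

lemma gtree_tsupp: "x \<in> S_plus \<Longrightarrow> t \<in> tsupp x \<Longrightarrow> gtree t"
  using cf_eq_0[of x "word_of t"] unfolding gword_plus_word_of_iff tsupp_def tcoef_def by blast

lemma cf_eq_tcoef_shape:
  assumes "x \<in> sylv" "gword l"
  shows "cf x l = tcoef x (shape l)"
proof -
  have "\<forall>d\<in>set_tree (shape l). 1 \<le> d"
    unfolding set_tree_shape[OF assms(2)] using gwordD(3)[OF assms(2)] by blast
  then have "gword (word_of (shape l))" by (simp only: gword_word_of_iff)
  then show ?thesis
    unfolding tcoef_def using sylv_cf_cong[OF assms(1,2)] by (simp only: word_of_props)
qed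

lemma sylv_expansion:
  assumes x: "x \<in> sylv"
  shows "x = (\<Sum>t\<in>tsupp x. scl (tcoef x t) (tree_elt t))"
proof (rule S_plus_eqI)
  show "x \<in> S_plus" using x by (rule sylv_S_plus)
  have "gtree t" if "t \<in> tsupp x" for t
    using gtree_tsupp[OF sylv_S_plus[OF x] that] .
  then show "(\<Sum>t\<in>tsupp x. scl (tcoef x t) (tree_elt t)) \<in> S_plus"
    by (intro scl.subspace_sum scl.subspace_scale subspace_S_plus tree_elt_S_plus)
      (auto simp: gtree_def)
  fix l assume "gword_plus l"
  then have l: "gword l" by simp
  have "cf (\<Sum>t\<in>tsupp x. scl (tcoef x t) (tree_elt t)) l = (\<Sum>t\<in>tsupp x. if shape l = t then tcoef x t else 0)"
    unfolding cf_sum using l by (intro sum.cong) (auto simp: cf_tree_elt)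
  also have "\<dots> = tcoef x (shape l)"
    using finite_tsupp by (simp add: sum.delta' tsupp_def)
  finally show "cf x l = cf (\<Sum>t\<in>tsupp x. scl (tcoef x t) (tree_elt t)) l"
    using cf_eq_tcoef_shape[OF x l] by simp
qed

lemma sylv_induct:
  assumes "x \<in> sylv" "scl.subspace H" "\<And>t. gtree t \<Longrightarrow> tree_elt t \<in> H"
  shows "x \<in> H"
proof -
  have "(\<Sum>t\<in>tsupp x. scl (tcoef x t) (tree_elt t)) \<in> H"
    using assms(2,3) gtree_tsupp[OF sylv_S_plus[OF assms(1)]]
    by (intro scl.subspace_sum scl.subspace_scale) auto
  then show ?thesis using sylv_expansion[OF assms(1)] by simp
qed

lemma tcoef_tree_elt: "gtree t \<Longrightarrow> tcoef (tree_elt t) t' = of_bool (t' = t)"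
  unfolding tcoef_def cf_tree_elt word_of_props(5) gword_word_of_iff gtree_def by auto

section \<open>Factorization of tree elements at the root\<close>

lemma shape_root:
  assumes "gword_plus l"
  shows "shape l = Node (shape (lo (fst (hd l) - 1) l)) (snd (hd l)) (shape (hi (fst (hd l)) l))"
proof -
  obtain p ps where l: "l = p # ps" using assms by (cases l) (auto simp: gword_plus_def)
  have "1 \<le> fst p" using fst_hd_gword[OF assms] l by simp
  then have "filter (\<lambda>q. fst q < fst p) ps = lo (fst p - 1) l"
    by (auto simp: l lo_def intro!: filter_cong)
  then show ?thesis
    by (simp add: l shape_hi)
qed

text \<open>As long as it is kept, the first letter is the root of \<open>lo k l\<close>, and its
  right subtree holds the letters between it and \<open>k\<close>. That subtree is empty only for
  \<open>k = fst (hd l)\<close>, so a left factor without right subtree admits a single cut.\<close>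

lemma shape_lo_root:
  assumes l: "gword_plus l" and k: "fst (hd l) \<le> k" "k \<le> length l"
  shows "shape (lo k l) = Node L d Leaf \<longleftrightarrow>
     k = fst (hd l) \<and> shape (lo (fst (hd l) - 1) l) = L \<and> snd (hd l) = d"
proof -
  have b: "1 \<le> fst (hd l)" "gword l" "l \<noteq> []"
    using fst_hd_gword[OF l] l by (auto simp: gword_plus_def)
  have g: "gword_plus (lo k l)" using b k by (intro gword_plus_lo) auto
  have h: "hd (lo k l) = hd l" using b k by (intro hd_lo)
  have lo: "lo (fst (hd l) - 1) (lo k l) = lo (fst (hd l) - 1) l"
  proof -
    have "fst (hd l) - 1 \<le> k" using k by linarith
    then show ?thesis by (simp only: lo_lo min_absorb1)
  qed
  have "length (hi (fst (hd l)) (lo k l)) = k - fst (hd l)"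
    using gword_hi(2)[of "lo k l" "fst (hd l)"] g gword_lo(2)[OF b(2) k(2)] k by simp
  then have "hi (fst (hd l)) (lo k l) = [] \<longleftrightarrow> k = fst (hd l)"
    using k by (metis diff_is_0_eq' diff_self_eq_0 le_antisym diff_is_0_eq length_0_conv)
  then show ?thesis
    using shape_root[OF g] unfolding h lo by auto
qed

text \<open>Mirror image: the left subtree of \<open>hi k l\<close> has
  \<open>fst (hd l) - k - 1\<close> nodes, so it is empty only when the cut is just below the first
  letter.\<close>

lemma shape_hi_root:
  assumes l: "gword_plus l" and k: "k < fst (hd l)"
  shows "shape (hi k l) = Node Leaf d R \<longleftrightarrow>
     k = fst (hd l) - 1 \<and> snd (hd l) = d \<and> shape (hi (fst (hd l)) l) = R"
proof -
  have b: "1 \<le> fst (hd l)" "fst (hd l) \<le> length l" "gword l" "l \<noteq> []"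
    using fst_hd_gword[OF l] l by (auto simp: gword_plus_def)
  have g: "gword_plus (hi k l)" using b k by (intro gword_plus_hi) auto
  have h: "fst (hd (hi k l)) = fst (hd l) - k" using b k by (intro hd_hi)
  have s: "snd (hd (hi k l)) = snd (hd l)" using b(4) k by (cases l) (auto simp: hi_def)
  have hi: "hi (fst (hd l) - k) (hi k l) = hi (fst (hd l)) l"
    using k by (simp add: hi_hi)
  have "length (lo (fst (hd l) - k - 1) (hi k l)) = fst (hd l) - k - 1"
    using gword_lo(2)[of "hi k l" "fst (hd l) - k - 1"] g gword_hi(2)[OF b(3), of k] b(2) k by simp
  then have "lo (fst (hd l) - k - 1) (hi k l) = [] \<longleftrightarrow> k = fst (hd l) - 1"
    using k by (metis Suc_diff_1 Suc_leI b(1) diff_diff_left diff_is_0_eq diff_self_eq_0 le_add_diff_inverse2 length_0_conv less_Suc_eq_le less_one linorder_not_le plus_1_eq_Suc add.commute le_antisym)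
  then show ?thesis
    using shape_root[OF g] unfolding h s hi by auto
qed

text \<open>In the convolution only the cut at the first letter survives, and it separates the root
  and its left subtree from the right subtree. The case \<open>R = Leaf\<close> is excluded because
  \<open>tree_elt Leaf\<close> is the empty biword, which lies outside
  \<open>S_plus\<close>.\<close>

lemma lt_S_tree_elt:
  assumes "R \<noteq> Leaf"
  shows "lt_S (tree_elt (Node L d Leaf)) (tree_elt R) = tree_elt (Node L d R)"
proof (rule S_plus_eqI)
  have S: "tree_elt (Node L d Leaf) \<in> S_plus" "tree_elt R \<in> S_plus" "tree_elt (Node L d R) \<in> S_plus"
    using assms by (auto intro: tree_elt_S_plus)
  show "lt_S (tree_elt (Node L d Leaf)) (tree_elt R) \<in> S_plus" "tree_elt (Node L d R) \<in> S_plus"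
    using S lt_S_in_S_plus by auto
  fix l assume l: "gword_plus l"
  let ?h = "fst (hd l)"
  let ?B = "shape (lo (?h - 1) l) = L \<and> snd (hd l) = d \<and> shape (hi ?h l) = R"
  have b: "1 \<le> ?h" "?h \<le> length l" "gword l" using fst_hd_gword[OF l] l by auto
  have "cf (lt_S (tree_elt (Node L d Leaf)) (tree_elt R)) l =
      (\<Sum>k = ?h..<length l. if k = ?h then of_bool ?B else 0)"
    unfolding cf_lt_S[OF S(1,2) l]
  proof (rule sum.cong)
    fix k assume k: "k \<in> {?h..<length l}"
    then have "gword (lo k l)" "gword (hi k l)"
      using b by (auto intro: gword_lo gword_hi)
    then show "cf (tree_elt (Node L d Leaf)) (lo k l) * cf (tree_elt R) (hi k l) =
        (if k = ?h then of_bool ?B else 0)"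
      using shape_lo_root[OF l, of k L d] k by (auto simp: cf_tree_elt)
  qed simp
  also have "\<dots> = of_bool (?h < length l \<and> ?B)"
    by (auto simp: sum.delta)
  also have "\<dots> = of_bool ?B"
  proof -
    have "?h < length l" if "shape (hi ?h l) = R"
    proof (rule ccontr)
      assume "\<not> ?h < length l"
      then have "length (hi ?h l) = 0" using b gword_hi(2)[OF b(3,2)] by simp
      then show False using that assms by simp
    qed
    then show ?thesis by auto
  qed
  also have "\<dots> = cf (tree_elt (Node L d R)) l"
    using shape_root[OF l] b by (simp add: cf_tree_elt)
  finally show "cf (lt_S (tree_elt (Node L d Leaf)) (tree_elt R)) l = cf (tree_elt (Node L d R)) l" .
qed

lemma gt_S_tree_elt:
  assumes "L \<noteq> Leaf"
  shows "gt_S (tree_elt L) (tree_elt (Node Leaf d R)) = tree_elt (Node L d R)"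
proof (rule S_plus_eqI)
  have S: "tree_elt L \<in> S_plus" "tree_elt (Node Leaf d R) \<in> S_plus" "tree_elt (Node L d R) \<in> S_plus"
    using assms by (auto intro: tree_elt_S_plus)
  show "gt_S (tree_elt L) (tree_elt (Node Leaf d R)) \<in> S_plus" "tree_elt (Node L d R) \<in> S_plus"
    using S gt_S_in_S_plus by auto
  fix l assume l: "gword_plus l"
  let ?h = "fst (hd l)"
  let ?B = "shape (lo (?h - 1) l) = L \<and> snd (hd l) = d \<and> shape (hi ?h l) = R"
  have b: "1 \<le> ?h" "?h \<le> length l" "gword l" using fst_hd_gword[OF l] l by auto
  have "cf (gt_S (tree_elt L) (tree_elt (Node Leaf d R))) l =
      (\<Sum>k = 1..<?h. if k = ?h - 1 then of_bool ?B else 0)"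
    unfolding cf_gt_S[OF S(1,2) l]
  proof (rule sum.cong)
    fix k assume k: "k \<in> {1..<?h}"
    then have "gword (lo k l)" "gword (hi k l)"
      using b by (auto intro: gword_lo gword_hi)
    then show "cf (tree_elt L) (lo k l) * cf (tree_elt (Node Leaf d R)) (hi k l) =
        (if k = ?h - 1 then of_bool ?B else 0)"
      using shape_hi_root[OF l, of k d R] k by (auto simp: cf_tree_elt)
  qed simp
  also have "\<dots> = of_bool (1 < ?h \<and> ?B)"
    by (auto simp: sum.delta)
  also have "\<dots> = of_bool ?B"
  proof -
    have "1 < ?h" if "shape (lo (?h - 1) l) = L"
    proof (rule ccontr)
      assume "\<not> 1 < ?h"
      then have "length (lo (?h - 1) l) = 0" using b gword_lo(2)[OF b(3), of "?h - 1"] by simp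
      then show False using that assms by simp
    qed
    then show ?thesis by auto
  qed
  also have "\<dots> = cf (tree_elt (Node L d R)) l"
    using shape_root[OF l] b by (simp add: cf_tree_elt)
  finally show "cf (gt_S (tree_elt L) (tree_elt (Node Leaf d R))) l = cf (tree_elt (Node L d R)) l" .
qed

abbreviation letter :: "nat \<Rightarrow> (biword \<Rightarrow>\<^sub>0 rat)" where
  "letter d \<equiv> tree_elt (Node Leaf d Leaf)"

text \<open>A tree element grows from the letter at its root by attaching the left subtree with
  \<open>gt_S\<close> and then the right subtree with \<open>lt_S\<close>; an empty subtree
  contributes no factor. The form for any stable subspace \<open>B\<close> serves generation,
  uniqueness of morphisms and the comparison with \<open>Descd_plus\<close>.\<close>

lemma sylv_subset_of_letters:
  assumes "scl.subspace B" "\<And>x y. x \<in> B \<Longrightarrow> y \<in> B \<Longrightarrow> lt_S x y \<in> B \<and> gt_S x y \<in> B"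
    and "\<And>d. 1 \<le> d \<Longrightarrow> letter d \<in> B"
  shows "sylv \<subseteq> B"
proof
  have t: "tree_elt t \<in> B" if "gtree t" for t
    using that
  proof (induction t)
    case (Node l d r)
    have d: "letter d \<in> B" using Node.prems by (intro assms(3)) (simp add: gtree_def)
    have X: "tree_elt (Node l d Leaf) \<in> B"
    proof (cases "l = Leaf")
      case False
      then have "tree_elt l \<in> B" using Node by (simp add: gtree_def)
      then show ?thesis using assms(2) d gt_S_tree_elt[OF False, of d Leaf] by metis
    qed (use d in simp)
    show ?case
    proof (cases "r = Leaf")
      case False
      then have "tree_elt r \<in> B" using Node by (simp add: gtree_def)
      then show ?thesis using assms(2) X lt_S_tree_elt[OF False, of l d] by metis
    qed (use X in simp)
  qed (simp add: gtree_def)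
  fix x assume "x \<in> sylv"
  then show "x \<in> B" using assms(1) t by (rule sylv_induct)
qed

section \<open>The generators of the dendriform descent algebra\<close>

lemma cf_p_gen:
  assumes "gword_plus l"
  shows "cf (p_gen N) l = of_bool (map fst l = [1..<length l + 1] \<and> sum_list (map snd l) = N)"
proof -
  let ?D = "\<lambda>k. {d :: nat list. length d = k \<and> (\<forall>a\<in>set d. 1 \<le> a) \<and> sum_list d = N}"
  let ?f = "\<lambda>(k, d). ([1..<k + 1], d) :: biword"
  have "p_gen N = (\<Sum>p\<in>Sigma {1..N} ?D. basis_vec (?f p))"
    unfolding p_gen_def by (subst sum.Sigma) (auto simp: finite_compositions case_prod_beta simp del: One_nat_def)
  moreover have "finite (Sigma {1..N} ?D)"
    by (intro finite_SigmaI finite_compositions finite_atLeastAtMost)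
  moreover have "inj_on ?f (Sigma {1..N} ?D)"
    by (auto simp: inj_on_def)
  ultimately have "cf (p_gen N) l = of_bool (biword_of l \<in> ?f ` Sigma {1..N} ?D)"
    unfolding cf_def by (simp only: lookup_sum_basis_vec_image)
  moreover have "biword_of l \<in> ?f ` Sigma {1..N} ?D \<longleftrightarrow>
      map fst l = [1..<length l + 1] \<and> sum_list (map snd l) = N"
  proof
    assume "biword_of l \<in> ?f ` Sigma {1..N} ?D"
    then obtain p where p: "p \<in> Sigma {1..N} ?D" "biword_of l = ?f p" by (elim imageE)
    obtain k d where kd: "p = (k, d)" by (cases p)
    have "biword_of l = ([1..<k + 1], d)" "length d = k" "sum_list d = N"
      using p unfolding kd by auto
    then have "map fst l = [1..<k + 1]" "map snd l = d" "k = length l" "sum_list d = N"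
      unfolding biword_of_def by auto
    then show "map fst l = [1..<length l + 1] \<and> sum_list (map snd l) = N" by blast
  next
    assume *: "map fst l = [1..<length l + 1] \<and> sum_list (map snd l) = N"
    have pos: "\<forall>a\<in>set (map snd l). 1 \<le> a"
      using gwordD(3)[of l] assms by auto
    \<comment> \<open>All degrees are at least 1, so the length lies in the summation range
      \<open>1..N\<close> of \<open>p_gen\<close>.\<close>
    have "length l \<le> sum_list (map snd l)"
      using sum_list_mono[of l "\<lambda>_. 1" snd] pos by (simp add: sum_list_triv)
    moreover have "1 \<le> length l" using assms by (simp add: gword_plus_def Suc_le_eq)
    ultimately have "(length l, map snd l) \<in> Sigma {1..N} ?D"
      using * pos by auto
    moreover have "biword_of l = ?f (length l, map snd l)"
      using * by (simp add: biword_of_def)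
    ultimately show "biword_of l \<in> ?f ` Sigma {1..N} ?D" by blast
  qed
  ultimately show ?thesis by simp
qed

lemma p_gen_S_plus: "p_gen N \<in> S_plus"
  unfolding p_gen_def
proof (intro scl.subspace_sum[OF subspace_S_plus])
  fix k d assume kd: "k \<in> {1..N}" "d \<in> {d. length d = k \<and> (\<forall>a\<in>set d. 1 \<le> a) \<and> sum_list d = N}"
  have "([1..<k + 1], d) \<in> {w \<in> graded_perms. length (fst w) \<ge> 1}"
    using kd by (auto simp: graded_perms_def)
  then have "([1..<k + 1], d) \<in> biword_of ` Collect gword_plus"
    by (simp only: graded_perms_plus_eq)
  then show "basis_vec ([1..<k + 1], d) \<in> S_plus"
    by (simp only: S_plus_iff) simp
qed

lemma shape_eq_letter_iff:
  assumes "gword_plus l"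
  shows "shape l = Node Leaf d Leaf \<longleftrightarrow> l = [(1, d)]"
proof
  assume s: "shape l = Node Leaf d Leaf"
  then have "length l = 1" using size_shape_gword[of l] assms by simp
  then obtain p where l: "l = [p]" by (metis One_nat_def Suc_length_conv length_0_conv)
  then have "fst p = 1" using fst_hd_gword[OF assms] by simp
  then show "l = [(1, d)]" using s l by (cases p) auto
qed simp

lemma map_fst_hi_one:
  assumes "gword_plus ((1, d) # ps)"
  shows "hi 1 ((1, d) # ps) = map (apfst (\<lambda>a. a - 1)) ps" "\<And>q. q \<in> set ps \<Longrightarrow> 1 < fst q"
proof -
  show *: "1 < fst q" if "q \<in> set ps" for q
  proof -
    have "fst q \<in> fst ` set ps" using that by (rule imageI)
    moreover have "1 \<notin> fst ` set ps"
      using gwordD(1)[of "(1, d) # ps"] assms by (simp del: One_nat_def)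
    ultimately have "fst q \<noteq> 1" by metis
    moreover have "1 \<le> fst q" using gword_letter_bounds[of "(1, d) # ps" q] assms that by simp
    ultimately show ?thesis by simp
  qed
  then have "filter (\<lambda>p. 1 < fst p) ps = ps" by (intro filter_True ballI)
  then show "hi 1 ((1, d) # ps) = map (apfst (\<lambda>a. a - 1)) ps"
    unfolding hi_def by simp
qed

definition identity_word :: "nat \<Rightarrow> word \<Rightarrow> bool" where
  "identity_word N l \<longleftrightarrow> map fst l = [1..<length l + 1] \<and> sum_list (map snd l) = N"

lemma identity_word_singleton: "identity_word N [p] \<longleftrightarrow> p = (1, N)"
  by (cases p) (auto simp: identity_word_def)

text \<open>Deleting the leading 1 of an identity word and lowering the other letters leaves an
  identity word. The condition \<open>d < N\<close> holds since the remainder is nonempty with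
  positive degrees; it also keeps \<open>N - d\<close> from being a truncated difference.\<close>

lemma identity_word_Cons:
  assumes l: "gword_plus ((h, d) # ps)" and ps: "ps \<noteq> []"
  shows "identity_word N ((h, d) # ps) \<longleftrightarrow> h = 1 \<and> d < N \<and> identity_word (N - d) (hi 1 ((h, d) # ps))"
proof (cases "h = 1")
  case False
  have "[1..<length ((h, d) # ps) + 1] = 1 # [Suc 1..<length ((h, d) # ps) + 1]"
    by (intro upt_conv_Cons) simp
  then show ?thesis using False unfolding identity_word_def by simp
next
  case True
  note l = l[unfolded True]
  note m = map_fst_hi_one[OF l]
  obtain q qs where q: "ps = q # qs" using ps by (cases ps) auto
  have "1 \<le> snd q" using gwordD(3)[of "(1, d) # ps" q] l q by simp
  then have pos: "1 \<le> sum_list (map snd ps)" by (simp add: q)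
  have "[1..<length ((1, d) # ps) + 1] = 1 # map Suc [1..<length ps + 1]"
    by (subst upt_conv_Cons) (simp_all add: map_Suc_upt del: upt_Suc)
  then have "map fst ((1, d) # ps) = [1..<length ((1, d) # ps) + 1] \<longleftrightarrow>
      map fst ps = map Suc [1..<length ps + 1]"
    by (simp only: list.map fst_conv list.inject simp_thms)
  also have "\<dots> \<longleftrightarrow> map (\<lambda>q. fst q - 1) ps = [1..<length ps + 1]"
  proof
    assume "map fst ps = map Suc [1..<length ps + 1]"
    then have "map (\<lambda>a. a - 1) (map fst ps) = map (\<lambda>a. a - 1) (map Suc [1..<length ps + 1])"
      by (rule arg_cong)
    then show "map (\<lambda>q. fst q - 1) ps = [1..<length ps + 1]"
      by (simp only: map_map o_def diff_Suc_1 map_ident)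
  next
    assume "map (\<lambda>q. fst q - 1) ps = [1..<length ps + 1]"
    then have "map Suc (map (\<lambda>q. fst q - 1) ps) = map Suc [1..<length ps + 1]"
      by (rule arg_cong)
    moreover have "map Suc (map (\<lambda>q. fst q - 1) ps) = map fst ps"
      unfolding map_map o_def
    proof (rule map_cong)
      fix q assume "q \<in> set ps"
      then have "1 < fst q" by (rule m(2))
      then show "Suc (fst q - 1) = fst q" by linarith
    qed simp
    ultimately show "map fst ps = map Suc [1..<length ps + 1]" by (simp only:)
  qed
  also have "map (\<lambda>q. fst q - 1) ps = map fst (hi 1 ((1, d) # ps))"
    unfolding m(1) by (simp add: o_def)
  also have "length ps = length (hi 1 ((1, d) # ps))"
    unfolding m(1) by simp
  finally have "map fst ((1, d) # ps) = [1..<length ((1, d) # ps) + 1] \<longleftrightarrow>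
    map fst (hi 1 ((1, d) # ps)) = [1..<length (hi 1 ((1, d) # ps)) + 1]" .
  moreover have "map snd (hi 1 ((1, d) # ps)) = map snd ps"
    unfolding m(1) by simp
  moreover have "sum_list (map snd ((1, d) # ps)) = N \<longleftrightarrow> d < N \<and> sum_list (map snd ps) = N - d"
    using pos by auto
  ultimately show ?thesis
    unfolding identity_word_def True by metis
qed

text \<open>A one-letter left factor forces the cut at value 1. The first letter must belong to that
  factor, so it is 1 with degree \<open>i\<close>, and the right factor is the rest of the
  word.\<close>

lemma cf_lt_S_letter:
  assumes y: "y \<in> S_plus" and l: "gword_plus ((h, d) # ps)"
  shows "cf (lt_S (letter i) y) ((h, d) # ps) =
    (if h = 1 \<and> d = i \<and> ps \<noteq> [] then cf y (hi 1 ((h, d) # ps)) else 0)"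
proof -
  define w where "w = (h, d) # ps"
  note l = l[folded w_def]
  have hd: "fst (hd w) = h" "snd (hd w) = d" by (simp_all add: w_def)
  have h: "1 \<le> h" "h \<le> length w" using fst_hd_gword[OF l] hd by auto
  have S: "letter i \<in> S_plus" by (rule tree_elt_S_plus) simp
  have "length (lo (h - 1) w) = h - 1"
    using gword_lo(2)[of w "h - 1"] l h by simp
  then have lo: "lo (h - 1) w = [] \<longleftrightarrow> h = 1"
    using h(1) by (metis diff_self_eq_0 le_antisym diff_is_0_eq length_0_conv)
  have "cf (lt_S (letter i) y) w =
      (\<Sum>k = h..<length w. if k = h then of_bool (h = 1 \<and> d = i) * cf y (hi h w) else 0)"
    unfolding cf_lt_S[OF S y l] hd
  proof (rule sum.cong)
    fix k assume k: "k \<in> {h..<length w}"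
    have "shape (lo k w) = Node Leaf i Leaf \<longleftrightarrow> k = h \<and> h = 1 \<and> d = i"
      using shape_lo_root[OF l, of k Leaf i] k unfolding hd shape_eq_Leaf_iff lo by auto
    moreover have "gword (lo k w)"
      using l k by (auto intro: gword_lo)
    ultimately show "cf (letter i) (lo k w) * cf y (hi k w) =
        (if k = h then of_bool (h = 1 \<and> d = i) * cf y (hi h w) else 0)"
      by (auto simp: cf_tree_elt)
  qed simp
  also have "\<dots> = (if h < length w then of_bool (h = 1 \<and> d = i) * cf y (hi h w) else 0)"
    by (simp add: sum.delta)
  also have "\<dots> = (if h = 1 \<and> d = i \<and> ps \<noteq> [] then cf y (hi 1 w) else 0)"
    by (auto simp: w_def)
  finally show ?thesis by (simp only: w_def)
qed

text \<open>Identity words of total degree \<open>N\<close> are sorted by the degree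
  \<open>i\<close> of their first letter; the word with a single letter gives
  \<open>letter N\<close>.\<close>

lemma p_gen_eq:
  assumes "1 \<le> N"
  shows "p_gen N = letter N + (\<Sum>i = 1..<N. lt_S (letter i) (p_gen (N - i)))"
proof (rule S_plus_eqI)
  have S: "letter i \<in> S_plus" for i by (rule tree_elt_S_plus) simp
  show "p_gen N \<in> S_plus" by (rule p_gen_S_plus)
  show "letter N + (\<Sum>i = 1..<N. lt_S (letter i) (p_gen (N - i))) \<in> S_plus"
    by (intro scl.subspace_add scl.subspace_sum subspace_S_plus S lt_S_in_S_plus p_gen_S_plus)
  fix l assume l: "gword_plus l"
  obtain h d ps where lp: "l = (h, d) # ps" using l by (cases l) (auto simp: gword_plus_def)
  note l = l[unfolded lp]
  have d: "1 \<le> d" using gwordD(3)[of "(h, d) # ps" "(h, d)"] l by simp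
  have letter: "cf (letter N) l = of_bool (l = [(1, N)])"
    unfolding cf_tree_elt lp using shape_eq_letter_iff[OF l, of N] l by simp
  have "cf (\<Sum>i = 1..<N. lt_S (letter i) (p_gen (N - i))) l =
      (\<Sum>i = 1..<N. if d = i then if h = 1 \<and> ps \<noteq> [] then cf (p_gen (N - d)) (hi 1 l) else 0 else 0)"
    unfolding cf_sum lp cf_lt_S_letter[OF p_gen_S_plus l] by (intro sum.cong) auto
  also have "\<dots> = (if h = 1 \<and> ps \<noteq> [] \<and> d < N then cf (p_gen (N - d)) (hi 1 l) else 0)"
    using d by (auto simp: sum.delta')
  also have "\<dots> = of_bool (ps \<noteq> [] \<and> identity_word N l)"
  proof (cases "ps = []")
    case False
    have "gword_plus (hi 1 l)"
      using l False unfolding lp by (intro gword_plus_hi) (auto simp: Suc_le_eq)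
    then show ?thesis
      using identity_word_Cons[OF l False, of N] False cf_p_gen[of "hi 1 l" "N - d"]
      unfolding lp[symmetric] identity_word_def by auto
  qed simp
  finally have "cf (letter N + (\<Sum>i = 1..<N. lt_S (letter i) (p_gen (N - i)))) l =
      of_bool (l = [(1, N)]) + of_bool (ps \<noteq> [] \<and> identity_word N l)"
    using letter by simp
  also have "\<dots> = of_bool (identity_word N l)"
    using identity_word_singleton[of N "(h, d)"] by (cases "ps = []") (auto simp: lp)
  finally show "cf (p_gen N) l = cf (letter N + (\<Sum>i = 1..<N. lt_S (letter i) (p_gen (N - i)))) l"
    using cf_p_gen[of l N] l unfolding lp identity_word_def by simp
qed

lemma p_gen_sylv: "1 \<le> N \<Longrightarrow> p_gen N \<in> sylv"
proof (induction N rule: less_induct)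
  case (less N)
  then have "lt_S (letter i) (p_gen (N - i)) \<in> sylv" if "i \<in> {1..<N}" for i
    using that by (intro sylv_closed tree_elt_sylv less.IH) auto
  then show ?case
    by (subst p_gen_eq[OF less.prems], intro scl.subspace_add scl.subspace_sum subspace_sylv tree_elt_sylv) auto
qed

text \<open>The recursion for \<open>p_gen\<close> is unitriangular: solved for
  \<open>letter N\<close>, it involves only letters of smaller degree, so strong induction
  applies.\<close>

lemma letter_mem_of_p_gen:
  assumes B: "scl.subspace B" "\<And>x y. x \<in> B \<Longrightarrow> y \<in> B \<Longrightarrow> lt_S x y \<in> B"
    and p: "\<And>n. 1 \<le> n \<Longrightarrow> p_gen n \<in> B"
  shows "1 \<le> N \<Longrightarrow> letter N \<in> B"
proof (induction N rule: less_induct)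
  case (less N)
  have "letter N = p_gen N - (\<Sum>i = 1..<N. lt_S (letter i) (p_gen (N - i)))"
    unfolding p_gen_eq[OF less.prems] by (rule add_diff_cancel_right'[symmetric])
  moreover have "lt_S (letter i) (p_gen (N - i)) \<in> B" if "i \<in> {1..<N}" for i
    using that by (intro B(2) less.IH p) auto
  ultimately show ?case
    using p[OF less.prems] B(1) by (auto intro!: scl.subspace_diff scl.subspace_sum)
qed

lemma dendriform_subalgebra_sylv: "dendriform_subalgebra scl S_plus lt_S gt_S sylv"
  unfolding dendriform_subalgebra_def
  using subspace_sylv sylv_closed sylv_S_plus by blast

lemma dendriform_algebra_sylv: "dendriform_algebra scl sylv lt_S gt_S"
  using subspace_sylv sylv_S_plus sylv_closed by (intro dendriform_algebra_S_plus_subspace) auto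

theorem Descd_plus_eq_sylv: "Descd_plus = sylv"
proof
  show "Descd_plus \<subseteq> sylv"
    unfolding Descd_plus_def generated_dendriform_def
    using p_gen_sylv dendriform_subalgebra_sylv by (intro hull_minimal) auto
  show "sylv \<subseteq> Descd_plus"
    unfolding Descd_plus_def generated_dendriform_def hull_def
  proof (rule Inter_greatest)
    fix B assume "B \<in> {t. dendriform_subalgebra scl S_plus lt_S gt_S t \<and> {p_gen n |n. n \<ge> 1} \<subseteq> t}"
    then have B: "scl.subspace B" "\<And>x y. x \<in> B \<Longrightarrow> y \<in> B \<Longrightarrow> lt_S x y \<in> B \<and> gt_S x y \<in> B"
      "\<And>n. 1 \<le> n \<Longrightarrow> p_gen n \<in> B"
      unfolding dendriform_subalgebra_def by auto
    have "letter d \<in> B" if "1 \<le> d" for d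
      using letter_mem_of_p_gen[OF B(1) _ B(3) that] B(2) by blast
    then show "sylv \<subseteq> B"
      using B by (intro sylv_subset_of_letters) auto
  qed
qed

section \<open>Freeness over the letters\<close>

definition letters :: "(biword \<Rightarrow>\<^sub>0 rat) set" where
  "letters = scl.span {letter d | d. 1 \<le> d}"

lemma letter_in_letters: "1 \<le> d \<Longrightarrow> letter d \<in> letters"
  unfolding letters_def by (rule scl.span_base) blast

lemma subspace_letters: "scl.subspace letters"
  by (simp add: letters_def)

lemma letters_subset_sylv: "letters \<subseteq> sylv"
  unfolding letters_def by (intro scl.span_minimal subspace_sylv) (auto intro: tree_elt_sylv)

section \<open>The morphism extending a linear map on the letters\<close>

locale letter_evaluation = dendriform_algebra scale B lt gt
  for scale :: "rat \<Rightarrow> 'b::ab_group_add \<Rightarrow> 'b" and B lt gt +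
  fixes f :: "(biword \<Rightarrow>\<^sub>0 rat) \<Rightarrow> 'b"
  assumes f: "linear_map_on scl letters scale B f"
begin

text \<open>The factorization of \<open>tree_elt\<close> transported to the target, hence the only
  possible value of a morphism extending \<open>f\<close>. The target has no unit, so an empty
  subtree drops its factor, and the value at \<open>Leaf\<close> is a dummy.\<close>

fun eval_tree :: "nat tree \<Rightarrow> 'b" where
  "eval_tree Leaf = 0"
| "eval_tree (Node l d r) =
     (let m = (if l = Leaf then f (letter d) else gt (eval_tree l) (f (letter d)))
      in if r = Leaf then m else lt m (eval_tree r))"

definition eval_elt :: "(biword \<Rightarrow>\<^sub>0 rat) \<Rightarrow> 'b" where
  "eval_elt x = (\<Sum>t\<in>tsupp x. scale (tcoef x t) (eval_tree t))"

lemma f_letter: "1 \<le> d \<Longrightarrow> f (letter d) \<in> B"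
  using f letter_in_letters by (auto simp: linear_map_on_def)

lemma eval_tree_in: "gtree t \<Longrightarrow> eval_tree t \<in> B"
proof (induction t)
  case (Node l d r)
  have d: "f (letter d) \<in> B" using Node.prems by (intro f_letter) (simp add: gtree_def)
  have "l \<noteq> Leaf \<Longrightarrow> eval_tree l \<in> B" "r \<noteq> Leaf \<Longrightarrow> eval_tree r \<in> B"
    using Node by (simp_all add: gtree_def)
  then show ?case using d lt_closed gt_closed by (auto simp: Let_def)
qed (simp add: gtree_def)

lemma eval_elt_superset:
  assumes "finite F" "tsupp x \<subseteq> F"
  shows "eval_elt x = (\<Sum>t\<in>F. scale (tcoef x t) (eval_tree t))"
  unfolding eval_elt_def
  by (rule sum.mono_neutral_left[OF assms]) (auto simp: tsupp_def)

lemma eval_elt_add: "eval_elt (x + y) = eval_elt x + eval_elt y"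
proof -
  let ?F = "tsupp x \<union> tsupp y \<union> tsupp (x + y)"
  have "finite ?F" using finite_tsupp by simp
  then show ?thesis
    using eval_elt_superset[of ?F x] eval_elt_superset[of ?F y] eval_elt_superset[of ?F "x + y"]
    by (simp add: scale_left_distrib sum.distrib le_supI1 le_supI2)
qed

lemma eval_elt_scale: "eval_elt (scl c x) = scale c (eval_elt x)"
proof -
  have "tsupp (scl c x) \<subseteq> tsupp x" by (auto simp: tsupp_def)
  then show ?thesis
    using eval_elt_superset[OF finite_tsupp, of "scl c x" x]
    by (simp add: eval_elt_def scale_sum_right)
qed

lemma eval_elt_tree_elt:
  assumes "gtree t"
  shows "eval_elt (tree_elt t) = eval_tree t"
proof -
  have "tsupp (tree_elt t) = {t}"
    using tcoef_tree_elt[OF assms] by (auto simp: tsupp_def)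
  then show ?thesis
    using tcoef_tree_elt[OF assms] by (simp add: eval_elt_def)
qed

lemma eval_elt_in:
  assumes "x \<in> sylv"
  shows "eval_elt x \<in> B"
  unfolding eval_elt_def
  using gtree_tsupp[OF sylv_S_plus[OF assms]] eval_tree_in
  by (intro subspace_sum subspace_scale carrier_subspace) auto

lemma linear_eval_elt: "linear_map_on scl sylv scale B eval_elt"
  unfolding linear_map_on_def using eval_elt_in eval_elt_add eval_elt_scale by auto

text \<open>Reduces a multiplicativity statement to tree elements: \<open>p\<close> and
  \<open>q\<close> stand for multiplication by a fixed element in \<open>sylv\<close> and by its
  image in \<open>B\<close>.\<close>

lemma eval_elt_linear_ext:
  assumes p: "linear_map_on scl sylv scl sylv p" and q: "linear_map_on scale B scale B q"
    and tree: "\<And>t. gtree t \<Longrightarrow> eval_elt (p (tree_elt t)) = q (eval_tree t)"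
    and x: "x \<in> sylv"
  shows "eval_elt (p x) = q (eval_elt x)"
proof -
  let ?H = "{x \<in> sylv. eval_elt (p x) = q (eval_elt x)}"
  have scl: "p (scl c x) = scl c (p x)" if "x \<in> sylv" for c x
    using p that by (simp add: linear_map_on_def)
  have scale: "q (scale c y) = scale c (q y)" if "y \<in> B" for c y
    using q that by (simp add: linear_map_on_def)
  have e0: "eval_elt 0 = 0" using eval_elt_scale[of 0 0] by simp
  have "x \<in> ?H" using x
  proof (rule sylv_induct)
    show "scl.subspace ?H"
    proof (rule scl.subspaceI)
      show "0 \<in> ?H"
        using scl.subspace_0[OF subspace_sylv] scl[of 0 0] scale[of 0 0] e0 subspace_0[OF carrier_subspace]
        by simp
      show "x + y \<in> ?H" if "x \<in> ?H" "y \<in> ?H" for x y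
        using that p q scl.subspace_add[OF subspace_sylv]
        by (simp add: linear_map_on_def eval_elt_in eval_elt_add)
      show "scl c x \<in> ?H" if "x \<in> ?H" for c x
        using that scl.subspace_scale[OF subspace_sylv]
        by (simp add: scl scale eval_elt_in eval_elt_scale)
    qed
    show "tree_elt t \<in> ?H" if "gtree t" for t
      using that tree[OF that] eval_elt_tree_elt[OF that] tree_elt_sylv[of t] by (simp add: gtree_def)
  qed
  then show ?thesis by blast
qed

lemma linear_products:
  assumes "y \<in> B"
  shows "linear_map_on scale B scale B (lt y)" "linear_map_on scale B scale B (gt y)"
    "linear_map_on scale B scale B (\<lambda>x. lt x y)" "linear_map_on scale B scale B (\<lambda>x. gt x y)"
  using assms unfolding linear_map_on_def
  by (simp_all add: lt_closed gt_closed lt_add_left lt_add_right gt_add_left gt_add_right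
      lt_scale_left lt_scale_right gt_scale_left gt_scale_right)

sublocale sylv: dendriform_algebra scl sylv lt_S gt_S
  by (rule dendriform_algebra_sylv)

text \<open>\<open>eval_tree\<close> attaches the left subtree first. By the mixed associativity
  \<open>dendriform_mid\<close> it may equally be attached last, which is what products by
  \<open>gt\<close> require.\<close>

lemma eval_tree_gt:
  assumes "l \<noteq> Leaf" "gtree (Node l d r)"
  shows "eval_tree (Node l d r) = gt (eval_tree l) (eval_tree (Node Leaf d r))"
proof -
  have "eval_tree l \<in> B" "f (letter d) \<in> B" "r \<noteq> Leaf \<Longrightarrow> eval_tree r \<in> B"
    using assms by (auto intro!: eval_tree_in f_letter simp: gtree_def)
  then show ?thesis using assms(1) dendriform_mid by (simp add: Let_def)
qed

text \<open>The right subtree of the left factor is empty, so multiplication by a tree element just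
  grafts that tree there, and \<open>eval_tree\<close> follows the same rule.\<close>

lemma eval_elt_lt_right_comb:
  assumes t: "gtree (Node l d Leaf)" and y: "y \<in> sylv"
  shows "eval_elt (lt_S (tree_elt (Node l d Leaf)) y) = lt (eval_tree (Node l d Leaf)) (eval_elt y)"
proof (rule eval_elt_linear_ext[OF _ _ _ y])
  show "linear_map_on scl sylv scl sylv (lt_S (tree_elt (Node l d Leaf)))"
    using sylv.lt_closed sylv.lt_add_right sylv.lt_scale_right tree_elt_sylv[of "Node l d Leaf"]
    by (simp add: linear_map_on_def)
  show "linear_map_on scale B scale B (lt (eval_tree (Node l d Leaf)))"
    by (rule linear_products[OF eval_tree_in[OF t]])
  fix s assume s: "gtree s"
  then have "gtree (Node l d s)" using t by (auto simp: gtree_def)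
  then show "eval_elt (lt_S (tree_elt (Node l d Leaf)) (tree_elt s)) = lt (eval_tree (Node l d Leaf)) (eval_tree s)"
    using s by (subst lt_S_tree_elt) (auto simp: gtree_def eval_elt_tree_elt Let_def)
qed

lemma eval_elt_gt_left_comb:
  assumes t: "gtree (Node Leaf d r)" and x: "x \<in> sylv"
  shows "eval_elt (gt_S x (tree_elt (Node Leaf d r))) = gt (eval_elt x) (eval_tree (Node Leaf d r))"
proof (rule eval_elt_linear_ext[OF _ _ _ x])
  show "linear_map_on scl sylv scl sylv (\<lambda>x. gt_S x (tree_elt (Node Leaf d r)))"
    using sylv.gt_closed sylv.gt_add_left sylv.gt_scale_left tree_elt_sylv[of "Node Leaf d r"]
    by (simp add: linear_map_on_def)
  show "linear_map_on scale B scale B (\<lambda>x. gt x (eval_tree (Node Leaf d r)))"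
    by (rule linear_products[OF eval_tree_in[OF t]])
  fix s assume s: "gtree s"
  then have "s \<noteq> Leaf" "gtree (Node s d r)" using t by (auto simp: gtree_def)
  then show "eval_elt (gt_S (tree_elt s) (tree_elt (Node Leaf d r))) = gt (eval_tree s) (eval_tree (Node Leaf d r))"
    using eval_tree_gt[of s d r] by (subst gt_S_tree_elt) (auto simp: eval_elt_tree_elt)
qed

text \<open>For \<open>lt_S\<close>, write \<open>tree_elt s\<close> as \<open>lt_S\<close> of a
  tree \<open>m\<close> without right subtree and \<open>r\<close>. The first axiom turns the
  product with \<open>t\<close> into \<open>m\<close> times the sum of both half-products of
  \<open>r\<close> and \<open>t\<close>: the inner pair is smaller, and the outer product is a
  grafting. For \<open>gt_S\<close> one splits off the left subtree of \<open>t\<close> and uses the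
  third axiom. The sum of both products explains the joint induction.\<close>

lemma eval_elt_tree_products:
  assumes "gtree s" "gtree t"
  shows "eval_elt (lt_S (tree_elt s) (tree_elt t)) = lt (eval_tree s) (eval_tree t) \<and>
    eval_elt (gt_S (tree_elt s) (tree_elt t)) = gt (eval_tree s) (eval_tree t)"
  using assms
proof (induction "size s + size t" arbitrary: s t rule: less_induct)
  case less
  note st = less.prems
  have E: "tree_elt u \<in> sylv" "eval_tree u \<in> B" if "gtree u" for u
    using that by (auto intro!: tree_elt_sylv eval_tree_in simp: gtree_def)
  have sum: "lt_S (tree_elt u) (tree_elt v) + gt_S (tree_elt u) (tree_elt v) \<in> sylv"
    "eval_elt (lt_S (tree_elt u) (tree_elt v) + gt_S (tree_elt u) (tree_elt v)) =
      lt (eval_tree u) (eval_tree v) + gt (eval_tree u) (eval_tree v)"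
    if "size u + size v < size s + size t" "gtree u" "gtree v" for u v
    using less.hyps[OF that] E that(2,3) sylv_closed scl.subspace_add[OF subspace_sylv]
    by (simp_all add: eval_elt_add)
  have "eval_elt (lt_S (tree_elt s) (tree_elt t)) = lt (eval_tree s) (eval_tree t)"
  proof (cases s)
    case (Node l d r)
    have m: "gtree (Node l d Leaf)" using st Node by (auto simp: gtree_def)
    show ?thesis
    proof (cases "r = Leaf")
      case True
      then show ?thesis
        using eval_elt_lt_right_comb[OF m E(1)[OF st(2)]] st Node by (simp add: eval_elt_tree_elt)
    next
      case False
      then have r: "gtree r" using st Node by (auto simp: gtree_def)
      have size: "size r + size t < size s + size t" using Node by simp
      have s: "tree_elt s = lt_S (tree_elt (Node l d Leaf)) (tree_elt r)"
        "eval_tree s = lt (eval_tree (Node l d Leaf)) (eval_tree r)"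
        using lt_S_tree_elt[OF False] False Node by (simp_all add: Let_def)
      show ?thesis
        unfolding s sylv.dendriform_lt[OF E(1)[OF m] E(1)[OF r] E(1)[OF st(2)]]
          eval_elt_lt_right_comb[OF m sum(1)[OF size r st(2)]] sum(2)[OF size r st(2)]
          dendriform_lt[OF E(2)[OF m] E(2)[OF r] E(2)[OF st(2)]] ..
    qed
  qed (use st in \<open>simp add: gtree_def\<close>)
  moreover have "eval_elt (gt_S (tree_elt s) (tree_elt t)) = gt (eval_tree s) (eval_tree t)"
  proof (cases t)
    case (Node l d r)
    have m: "gtree (Node Leaf d r)" using st Node by (auto simp: gtree_def)
    show ?thesis
    proof (cases "l = Leaf")
      case True
      then show ?thesis
        using eval_elt_gt_left_comb[OF m E(1)[OF st(1)]] st Node by (simp add: eval_elt_tree_elt)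
    next
      case False
      then have l: "gtree l" using st Node by (auto simp: gtree_def)
      have size: "size s + size l < size s + size t" using Node by simp
      have t: "tree_elt t = gt_S (tree_elt l) (tree_elt (Node Leaf d r))"
        "eval_tree t = gt (eval_tree l) (eval_tree (Node Leaf d r))"
        using gt_S_tree_elt[OF False] eval_tree_gt[OF False] st Node by simp_all
      show ?thesis
        unfolding t sylv.dendriform_gt[OF E(1)[OF st(1)] E(1)[OF l] E(1)[OF m], symmetric]
          eval_elt_gt_left_comb[OF m sum(1)[OF size st(1) l]] sum(2)[OF size st(1) l]
          dendriform_gt[OF E(2)[OF st(1)] E(2)[OF l] E(2)[OF m]] ..
    qed
  qed (use st in \<open>simp add: gtree_def\<close>)
  ultimately show ?case ..
qed

lemma eval_elt_products:
  assumes x: "x \<in> sylv" and y: "y \<in> sylv"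
  shows "eval_elt (lt_S x y) = lt (eval_elt x) (eval_elt y)" "eval_elt (gt_S x y) = gt (eval_elt x) (eval_elt y)"
proof -
  have E: "tree_elt u \<in> sylv" if "gtree u" for u
    using that by (auto intro!: tree_elt_sylv simp: gtree_def)
  note linS = sylv.lt_closed sylv.gt_closed sylv.lt_add_left sylv.lt_add_right sylv.gt_add_left
    sylv.gt_add_right sylv.lt_scale_left sylv.lt_scale_right sylv.gt_scale_left sylv.gt_scale_right
  have 1: "eval_elt (lt_S (tree_elt s) y) = lt (eval_tree s) (eval_elt y)" if s: "gtree s" for s
    using E[OF s] linS eval_elt_tree_products[OF s]
    by (intro eval_elt_linear_ext[OF _ linear_products(1)[OF eval_tree_in[OF s]] _ y])
      (auto simp: linear_map_on_def)
  have 2: "eval_elt (gt_S (tree_elt s) y) = gt (eval_tree s) (eval_elt y)" if s: "gtree s" for s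
    using E[OF s] linS eval_elt_tree_products[OF s]
    by (intro eval_elt_linear_ext[OF _ linear_products(2)[OF eval_tree_in[OF s]] _ y])
      (auto simp: linear_map_on_def)
  show "eval_elt (lt_S x y) = lt (eval_elt x) (eval_elt y)"
    using y linS 1
    by (intro eval_elt_linear_ext[OF _ linear_products(3)[OF eval_elt_in[OF y]] _ x, where p = "\<lambda>x. lt_S x y"])
      (auto simp: linear_map_on_def)
  show "eval_elt (gt_S x y) = gt (eval_elt x) (eval_elt y)"
    using y linS 2
    by (intro eval_elt_linear_ext[OF _ linear_products(4)[OF eval_elt_in[OF y]] _ x, where p = "\<lambda>x. gt_S x y"])
      (auto simp: linear_map_on_def)
qed

lemma eval_elt_letters:
  assumes "v \<in> letters"
  shows "eval_elt v = f v"
proof -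
  have "v \<in> letters \<and> eval_elt v = f v"
    using assms unfolding letters_def
  proof (induction rule: scl.span_induct_alt)
    case base
    have "f (scl 0 0) = scale 0 (f 0)"
      using f scl.subspace_0[OF subspace_letters] unfolding linear_map_on_def by blast
    then show ?case
      using eval_elt_scale[of 0 0] by (simp add: scl.span_zero)
  next
    case (step c x y)
    then obtain d where d: "1 \<le> d" "x = letter d" by blast
    then have g: "gtree (Node Leaf d Leaf)" by (simp add: gtree_def)
    have x: "x \<in> letters" using d letter_in_letters by simp
    have y: "y \<in> letters" using step by (simp add: letters_def)
    have cx: "scl c x \<in> letters" using x scl.subspace_scale[OF subspace_letters] by blast
    have "eval_elt x = f x" using eval_elt_tree_elt[OF g] by (simp add: d)
    moreover have "f (scl c x + y) = scale c (f x) + f y"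
      using f x y cx by (simp add: linear_map_on_def)
    moreover have "scl c x + y \<in> letters" using cx y scl.subspace_add[OF subspace_letters] by blast
    ultimately show ?case
      using step(2) by (simp add: eval_elt_add eval_elt_scale letters_def)
  qed
  then show ?thesis ..
qed

lemma dendriform_hom_eval_elt:
  "dendriform_hom scl sylv lt_S gt_S scale B lt gt (restrict eval_elt sylv)"
  using linear_eval_elt eval_elt_products sylv_closed scl.subspace_add[OF subspace_sylv]
    scl.subspace_scale[OF subspace_sylv]
  unfolding dendriform_hom_def linear_map_on_def by auto

end

lemma generated_dendriform_letters: "generated_dendriform scl sylv lt_S gt_S letters = sylv"
proof
  show "generated_dendriform scl sylv lt_S gt_S letters \<subseteq> sylv"
    unfolding generated_dendriform_def
    using subspace_sylv sylv_closed letters_subset_sylv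
    by (intro hull_minimal) (auto simp: dendriform_subalgebra_def)
  show "sylv \<subseteq> generated_dendriform scl sylv lt_S gt_S letters"
    unfolding generated_dendriform_def hull_def
  proof (rule Inter_greatest)
    fix C assume "C \<in> {t. dendriform_subalgebra scl sylv lt_S gt_S t \<and> letters \<subseteq> t}"
    then show "sylv \<subseteq> C"
      using letter_in_letters unfolding dendriform_subalgebra_def
      by (intro sylv_subset_of_letters) auto
  qed
qed

text \<open>Two morphisms agree on a subspace stable under both products; containing the letters, it
  is everything.\<close>

lemma dendriform_hom_unique:
  assumes g: "dendriform_hom scl sylv lt_S gt_S scale B lt gt g"
    and h: "dendriform_hom scl sylv lt_S gt_S scale B lt gt h"
    and eq: "\<And>v. v \<in> letters \<Longrightarrow> g v = h v"
    and x: "x \<in> sylv"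
  shows "g x = h x"
proof -
  let ?H = "{x \<in> sylv. g x = h x}"
  have "sylv \<subseteq> ?H"
  proof (rule sylv_subset_of_letters)
    have "g 0 = h 0" using eq scl.subspace_0[OF subspace_letters] by blast
    then show "scl.subspace ?H"
      using g h scl.subspace_0[OF subspace_sylv] scl.subspace_add[OF subspace_sylv]
        scl.subspace_scale[OF subspace_sylv]
      by (intro scl.subspaceI) (auto simp: dendriform_hom_def linear_map_on_def)
    show "lt_S x y \<in> ?H \<and> gt_S x y \<in> ?H" if "x \<in> ?H" "y \<in> ?H" for x y
      using that g h sylv_closed by (auto simp: dendriform_hom_def)
    show "letter d \<in> ?H" if "1 \<le> d" for d
      using eq letter_in_letters[OF that] letters_subset_sylv by blast
  qed
  then show ?thesis using x by blast
qed

theorem freely_generated_letters: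
  "freely_generated_dendriform TYPE('b::ab_group_add) scl sylv lt_S gt_S letters"
  unfolding freely_generated_dendriform_def
proof (intro conjI allI impI)
  fix scale' :: "rat \<Rightarrow> 'b \<Rightarrow> 'b" and B lt' gt' f
  assume "dendriform_algebra scale' B lt' gt'" "linear_map_on scl letters scale' B f"
  then interpret letter_evaluation scale' B lt' gt' f
    by (simp add: letter_evaluation_def letter_evaluation_axioms_def)
  show "\<exists>!g. g \<in> extensional sylv \<and> dendriform_hom scl sylv lt_S gt_S scale' B lt' gt' g \<and>
      (\<forall>v\<in>letters. g v = f v)"
  proof (rule ex1I)
    show "restrict eval_elt sylv \<in> extensional sylv \<and>
        dendriform_hom scl sylv lt_S gt_S scale' B lt' gt' (restrict eval_elt sylv) \<and>
        (\<forall>v\<in>letters. restrict eval_elt sylv v = f v)"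
      using eval_elt_letters letters_subset_sylv
      by (intro conjI restrict_extensional dendriform_hom_eval_elt ballI) (simp add: subset_iff)
    fix g assume g: "g \<in> extensional sylv \<and> dendriform_hom scl sylv lt_S gt_S scale' B lt' gt' g \<and>
        (\<forall>v\<in>letters. g v = f v)"
    have letters: "g v = restrict eval_elt sylv v" if "v \<in> letters" for v
      using g eval_elt_letters[OF that] letters_subset_sylv that by (simp add: subset_iff)
    have "g x = restrict eval_elt sylv x" if "x \<in> sylv" for x
      using g dendriform_hom_unique[OF _ dendriform_hom_eval_elt letters that] by blast
    moreover have "g \<in> extensional sylv" using g by blast
    ultimately show "g = restrict eval_elt sylv"
      by (intro extensionalityI[OF _ restrict_extensional])
  qed
qed (rule dendriform_algebra_sylv subspace_letters letters_subset_sylv generated_dendriform_letters)+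

section \<open>Standardization\<close>

definition rank :: "nat set \<Rightarrow> nat \<Rightarrow> nat" where
  "rank S a = card {b \<in> S. b \<le> a}"

text \<open>The increasing enumeration of \<open>S\<close>; it undoes standardization for a word
  whose set of letters is \<open>S\<close>.\<close>

definition unrank :: "nat set \<Rightarrow> nat \<Rightarrow> nat" where
  "unrank S = inv_into S (rank S)"

lemma strict_mono_on_rank:
  assumes "finite S"
  shows "strict_mono_on S (rank S)"
proof (rule strict_mono_onI)
  fix a b assume ab: "a \<in> S" "b \<in> S" "a < b"
  then have "b \<in> {c \<in> S. c \<le> b}" "b \<notin> {c \<in> S. c \<le> a}" "{c \<in> S. c \<le> a} \<subseteq> {c \<in> S. c \<le> b}"
    by auto
  then have "{c \<in> S. c \<le> a} \<subset> {c \<in> S. c \<le> b}" by blast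
  then show "rank S a < rank S b"
    unfolding rank_def using assms by (intro psubset_card_mono) auto
qed

lemma bij_betw_rank:
  assumes "finite S"
  shows "bij_betw (rank S) S {1..card S}"
proof -
  have inj: "inj_on (rank S) S"
    using strict_mono_on_rank[OF assms] by (rule strict_mono_on_imp_inj_on)
  have "rank S ` S \<subseteq> {1..card S}"
  proof
    fix i assume "i \<in> rank S ` S"
    then obtain a where a: "a \<in> S" "i = rank S a" by blast
    have "card {a} \<le> rank S a"
      unfolding rank_def using a(1) assms by (intro card_mono) auto
    moreover have "rank S a \<le> card S"
      unfolding rank_def using assms by (intro card_mono) auto
    ultimately show "i \<in> {1..card S}" using a(2) by simp
  qed
  then have "rank S ` S = {1..card S}"
    using card_image[OF inj] by (intro card_subset_eq) auto
  then show ?thesis using inj by (simp add: bij_betw_def)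
qed

lemma unrank_rank: "finite S \<Longrightarrow> a \<in> S \<Longrightarrow> unrank S (rank S a) = a"
  unfolding unrank_def using bij_betw_rank by (intro inv_into_f_f) (auto simp: bij_betw_def)

lemma rank_unrank: "finite S \<Longrightarrow> i \<in> {1..card S} \<Longrightarrow> rank S (unrank S i) = i"
  unfolding unrank_def using bij_betw_rank[of S] by (intro f_inv_into_f) (simp add: bij_betw_def)

lemma bij_betw_unrank: "finite S \<Longrightarrow> bij_betw (unrank S) {1..card S} S"
  unfolding unrank_def by (intro bij_betw_inv_into bij_betw_rank)

lemma strict_mono_on_unrank:
  assumes "finite S"
  shows "strict_mono_on {1..card S} (unrank S)"
proof (rule strict_mono_onI)
  fix i j assume ij: "i \<in> {1..card S}" "j \<in> {1..card S}" "i < j"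
  then have S: "unrank S i \<in> S" "unrank S j \<in> S"
    using bij_betwE[OF bij_betw_unrank[OF assms]] by blast+
  show "unrank S i < unrank S j"
  proof (rule ccontr)
    assume "\<not> unrank S i < unrank S j"
    then have "rank S (unrank S j) \<le> rank S (unrank S i)"
      using strict_mono_on_leD[OF strict_mono_on_rank[OF assms] S(2,1)] by simp
    then show False using rank_unrank[OF assms] ij by simp
  qed
qed

definition std_word :: "word \<Rightarrow> word" where
  "std_word p = map (apfst (rank (fst ` set p))) p"

lemma length_std_word [simp]: "length (std_word p) = length p"
  by (simp add: std_word_def)

definition relabel :: "nat set \<Rightarrow> word \<Rightarrow> word" where
  "relabel S u = map (apfst (unrank S)) u"

lemma length_relabel [simp]: "length (relabel S u) = length u"
  by (simp add: relabel_def)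

lemma relabel_std_word: "relabel (fst ` set p) (std_word p) = p"
  unfolding relabel_def std_word_def map_map
  by (rule map_idI) (auto simp: unrank_rank prod_eq_iff)

lemma gword_std_word:
  assumes "distinct (map fst p)" "\<And>q. q \<in> set p \<Longrightarrow> 1 \<le> snd q"
  shows "gword (std_word p)"
proof (rule gwordI)
  let ?S = "fst ` set p"
  have m: "map fst (std_word p) = map (rank ?S) (map fst p)"
    by (simp add: std_word_def)
  show "distinct (map fst (std_word p))"
    unfolding m distinct_map[of _ "map fst p"]
    using assms(1) bij_betw_rank[of ?S] by (simp add: bij_betw_def)
  have "fst ` set (std_word p) = rank ?S ` ?S"
    using m by (metis set_map)
  also have "\<dots> = {1..card ?S}" using bij_betw_rank[of ?S] by (simp add: bij_betw_def)
  also have "card ?S = length (std_word p)"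
    using length_eq_card_fst[OF assms(1)] by simp
  finally show "fst ` set (std_word p) = {1..length (std_word p)}" .
  show "1 \<le> snd q" if "q \<in> set (std_word p)" for q
    using that assms(2) by (auto simp: std_word_def)
qed

lemma relabel_props:
  assumes "gword u" "finite S" "card S = length u"
  shows "fst ` set (relabel S u) = S" "distinct (map fst (relabel S u))"
    "\<And>q. q \<in> set (relabel S u) \<Longrightarrow> 1 \<le> snd q" "std_word (relabel S u) = u"
proof -
  note u = gwordD[OF assms(1)]
  have m: "map fst (relabel S u) = map (unrank S) (map fst u)"
    by (simp add: relabel_def)
  have b: "bij_betw (unrank S) {1..length u} S"
    using bij_betw_unrank[OF assms(2)] assms(3) by simp
  have "fst ` set (relabel S u) = unrank S ` fst ` set u"
    using m by (metis set_map)
  also have "\<dots> = S" unfolding u(2) using b by (simp add: bij_betw_def)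
  finally show S: "fst ` set (relabel S u) = S" .
  show "distinct (map fst (relabel S u))"
    unfolding m distinct_map[of _ "map fst u"] set_map u(2)
    using u(1) b by (simp add: bij_betw_def)
  show "1 \<le> snd q" if "q \<in> set (relabel S u)" for q
    using that u(3) by (auto simp: relabel_def)
  show "std_word (relabel S u) = u"
    unfolding std_word_def S
    unfolding relabel_def map_map
  proof (rule map_idI)
    fix q assume "q \<in> set u"
    then have "fst q \<in> {1..card S}"
      using u(2) assms(3) by (metis imageI)
    then show "(apfst (rank S) \<circ> apfst (unrank S)) q = q"
      using rank_unrank[OF assms(2)] by (simp add: prod_eq_iff)
  qed
qed

text \<open>The word whose prefix of length \<open>length u\<close> has the set of letters \<open>S\<close> and standardizes to
  \<open>u\<close>, and whose remaining suffix standardizes to \<open>v\<close>.\<close>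

definition merge :: "word \<Rightarrow> word \<Rightarrow> nat set \<Rightarrow> word" where
  "merge u v S = relabel S u @ relabel ({1..length u + length v} - S) v"

lemma length_merge [simp]: "length (merge u v S) = length u + length v"
  by (simp add: merge_def)

text \<open>Together with \<open>cut_props\<close> this makes \<open>merge\<close> inverse to
  cutting after \<open>length u\<close> letters and standardizing both parts: all that
  standardization forgets is the set \<open>S\<close> of letters of the prefix.\<close>

lemma merge_props:
  assumes "gword u" "gword v" "S \<subseteq> {1..length u + length v}" "card S = length u"
  shows "gword (merge u v S)" "fst ` set (take (length u) (merge u v S)) = S"
    "std_word (take (length u) (merge u v S)) = u" "std_word (drop (length u) (merge u v S)) = v"
proof -
  let ?n = "length u + length v"
  let ?C = "{1..?n} - S"
  have fin: "finite S" "finite ?C" using assms(3) finite_subset by blast+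
  have "card ?C = length v" using assms(3,4) fin by (simp add: card_Diff_subset)
  note u = relabel_props[OF assms(1) fin(1) assms(4)] and v = relabel_props[OF assms(2) fin(2) this]
  show "gword (merge u v S)"
  proof (rule gwordI)
    have "S \<inter> ?C = {}" by blast
    then show "distinct (map fst (merge u v S))"
      unfolding merge_def map_append distinct_append set_map u(1) v(1) using u(2) v(2) by blast
    have "fst ` set (merge u v S) = S \<union> ?C"
      unfolding merge_def set_append image_Un u(1) v(1) ..
    then show "fst ` set (merge u v S) = {1..length (merge u v S)}"
      using assms(3) by auto
    show "1 \<le> snd q" if "q \<in> set (merge u v S)" for q
      using that u(3) v(3) unfolding merge_def set_append by blast
  qed
  have t: "take (length u) (merge u v S) = relabel S u" "drop (length u) (merge u v S) = relabel ?C v"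
    by (simp_all add: merge_def)
  show "fst ` set (take (length u) (merge u v S)) = S" "std_word (take (length u) (merge u v S)) = u"
    "std_word (drop (length u) (merge u v S)) = v"
    unfolding t using u v by blast+
qed

lemma cut_props:
  assumes "gword l" "k \<le> length l"
  shows "gword (std_word (take k l))" "gword (std_word (drop k l))"
    "fst ` set (take k l) \<subseteq> {1..length l}" "card (fst ` set (take k l)) = k"
    "merge (std_word (take k l)) (std_word (drop k l)) (fst ` set (take k l)) = l"
proof -
  note l = gwordD[OF assms(1)]
  have d: "distinct (map fst (take k l))" "distinct (map fst (drop k l))"
    using l(1) by (simp_all add: take_map[symmetric] drop_map[symmetric])
  show "gword (std_word (take k l))"
  proof (rule gword_std_word[OF d(1)])
    fix q assume "q \<in> set (take k l)"
    then show "1 \<le> snd q" by (intro l(3)) (rule in_set_takeD)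
  qed
  show "gword (std_word (drop k l))"
  proof (rule gword_std_word[OF d(2)])
    fix q assume "q \<in> set (drop k l)"
    then show "1 \<le> snd q" by (intro l(3)) (rule in_set_dropD)
  qed
  have un: "fst ` set (take k l) \<union> fst ` set (drop k l) = {1..length l}"
    unfolding l(2)[symmetric] image_Un[symmetric] set_append[symmetric] append_take_drop_id ..
  then show "fst ` set (take k l) \<subseteq> {1..length l}" by blast
  show "card (fst ` set (take k l)) = k"
    using length_eq_card_fst[OF d(1)] assms(2) by simp
  have "distinct (map fst (take k l) @ map fst (drop k l))"
    using l(1) by (metis append_take_drop_id map_append)
  then have "fst ` set (take k l) \<inter> fst ` set (drop k l) = {}"
    by (metis distinct_append set_map)
  then have "{1..length l} - fst ` set (take k l) = fst ` set (drop k l)"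
    using un by blast
  then have "merge (std_word (take k l)) (std_word (drop k l)) (fst ` set (take k l)) =
      relabel (fst ` set (take k l)) (std_word (take k l)) @ relabel (fst ` set (drop k l)) (std_word (drop k l))"
    using assms(2) by (simp add: merge_def)
  then show "merge (std_word (take k l)) (std_word (drop k l)) (fst ` set (take k l)) = l"
    unfolding relabel_std_word append_take_drop_id .
qed

lemma cut_biword_of: "cut (biword_of l) i = (biword_of (std_word (take i l)), biword_of (std_word (drop i l)))"
  by (simp add: cut_def biword_of_def std_def std_word_def rank_def take_map drop_map image_comp o_def)

section \<open>The coproducts on coefficients\<close>

text \<open>The words that contribute to the coefficient at \<open>u\<close> and \<open>v\<close>
  are the \<open>merge u v S\<close>, one for each letter set \<open>S\<close>. The range
  \<open>I\<close> of admissible cuts becomes a condition \<open>Q\<close> on \<open>S\<close>, so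
  that one computation serves both coproducts.\<close>

lemma lookup_cop:
  assumes x: "x \<in> S_plus" and uv: "gword_plus u" "gword_plus v"
    and I: "\<And>l i. gword_plus l \<Longrightarrow>
      i \<in> I (biword_of l) \<longleftrightarrow> 1 \<le> i \<and> i < length l \<and> Q (fst ` set (take i l))"
  shows "Poly_Mapping.lookup (lin_ext (\<lambda>w. \<Sum>i\<in>I w. basis_vec (cut w i)) x) (biword_of u, biword_of v) =
    (\<Sum>S | S \<subseteq> {1..length u + length v} \<and> card S = length u \<and> Q S. cf x (merge u v S))"
proof -
  let ?SS = "{S. S \<subseteq> {1..length u + length v} \<and> card S = length u \<and> Q S}"
  let ?M = "(\<lambda>S. biword_of (merge u v S)) ` ?SS"
  have g: "gword u" "gword v" "1 \<le> length u" "1 \<le> length v"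
    using uv by (auto simp: gword_plus_def Suc_le_eq)
  have fin: "finite ?SS" by (rule finite_subset[of _ "Pow {1..length u + length v}"]) auto
  have inner: "Poly_Mapping.lookup (\<Sum>i\<in>I w. basis_vec (cut w i)) (biword_of u, biword_of v) =
      (of_bool (w \<in> ?M) :: rat)" if w: "w \<in> Poly_Mapping.keys x" for w
  proof -
    obtain l where l: "w = biword_of l" "gword_plus l"
      using x w unfolding S_plus_iff by blast
    have gl: "gword l" using l(2) by simp
    have "I w \<subseteq> {..<length l}" using I[OF l(2)] l(1) by auto
    then have finI: "finite (I w)" by (rule finite_subset) simp
    \<comment> \<open>The length of the first component is the position of the cut, so at most one
      \<open>i\<close> contributes.\<close>
    have *: "cut w i = (biword_of u, biword_of v) \<longleftrightarrow>
        i = length u \<and> std_word (take i l) = u \<and> std_word (drop i l) = v" if "i \<in> I w" for i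
    proof -
      have "i < length l" using that I[OF l(2)] l(1) by simp
      then have "length (std_word (take i l)) = i" by simp
      then show ?thesis unfolding l(1) cut_biword_of by auto
    qed
    have "Poly_Mapping.lookup (\<Sum>i\<in>I w. basis_vec (cut w i)) (biword_of u, biword_of v) =
        (\<Sum>i\<in>I w. if i = length u
          then of_bool (std_word (take (length u) l) = u \<and> std_word (drop (length u) l) = v) else 0 :: rat)"
      unfolding lookup_sum
    proof (rule sum.cong)
      fix i assume "i \<in> I w"
      then show "Poly_Mapping.lookup (basis_vec (cut w i)) (biword_of u, biword_of v) =
          (if i = length u
            then of_bool (std_word (take (length u) l) = u \<and> std_word (drop (length u) l) = v) else 0 :: rat)"
        using * by (auto simp: lookup_single when_def)
    qed simp
    also have "\<dots> = of_bool (length u \<in> I w \<and> std_word (take (length u) l) = u \<and> std_word (drop (length u) l) = v)"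
      using finI by (simp add: sum.delta)
    also have "(length u \<in> I w \<and> std_word (take (length u) l) = u \<and> std_word (drop (length u) l) = v) \<longleftrightarrow> w \<in> ?M"
    proof
      assume A: "length u \<in> I w \<and> std_word (take (length u) l) = u \<and> std_word (drop (length u) l) = v"
      then have k: "length u < length l" "Q (fst ` set (take (length u) l))"
        using I[OF l(2)] l(1) by auto
      let ?S = "fst ` set (take (length u) l)"
      have "length (std_word (drop (length u) l)) = length l - length u" by simp
      then have n: "length u + length v = length l" using A k by simp
      have "l = merge u v ?S"
        using cut_props(5)[OF gl less_imp_le[OF k(1)]] A by simp
      moreover have "?S \<in> ?SS"
        using cut_props(3,4)[OF gl less_imp_le[OF k(1)]] k(2) n by simp
      ultimately show "w \<in> ?M" unfolding l(1) by (metis (no_types, lifting) imageI)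
    next
      assume "w \<in> ?M"
      then obtain S where S: "S \<subseteq> {1..length u + length v}" "card S = length u" "Q S" "l = merge u v S"
        unfolding l(1) by auto
      note m = merge_props[OF g(1,2) S(1,2)]
      have "length u \<in> I w"
        using I[OF l(2), of "length u"] m(2) S(3) g(3) uv(2) unfolding l(1) S(4)
        by (simp add: gword_plus_def)
      then show "length u \<in> I w \<and> std_word (take (length u) l) = u \<and> std_word (drop (length u) l) = v"
        using m(3,4) S(4) by simp
    qed
    finally show ?thesis .
  qed
  have inj: "inj_on (\<lambda>S. biword_of (merge u v S)) ?SS"
  proof (rule inj_onI)
    fix S T assume S: "S \<in> ?SS" and T: "T \<in> ?SS" and eq: "biword_of (merge u v S) = biword_of (merge u v T)"
    then have m: "merge u v S = merge u v T" by simp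
    have SS: "S \<subseteq> {1..length u + length v}" "card S = length u"
      "T \<subseteq> {1..length u + length v}" "card T = length u"
      using S T by blast+
    show "S = T"
      using merge_props(2)[OF g(1,2) SS(1,2)] merge_props(2)[OF g(1,2) SS(3,4)] unfolding m by (rule trans[OF sym])
  qed
  have "Poly_Mapping.lookup (lin_ext (\<lambda>w. \<Sum>i\<in>I w. basis_vec (cut w i)) x) (biword_of u, biword_of v) =
      (\<Sum>w\<in>Poly_Mapping.keys x. Poly_Mapping.lookup x w * of_bool (w \<in> ?M))"
    unfolding lookup_lin_ext using inner by (intro sum.cong) auto
  also have "\<dots> = (\<Sum>w\<in>Poly_Mapping.keys x \<inter> ?M. Poly_Mapping.lookup x w)"
    by (rule sum.mono_neutral_cong_right) auto
  also have "\<dots> = (\<Sum>w\<in>?M. Poly_Mapping.lookup x w)"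
    using fin by (intro sum.mono_neutral_left) (auto simp: in_keys_iff)
  also have "\<dots> = (\<Sum>S\<in>?SS. cf x (merge u v S))"
    unfolding sum.reindex[OF inj] cf_def o_def ..
  finally show ?thesis .
qed

lemma keys_cop:
  assumes x: "x \<in> S_plus" and I: "\<And>l i. gword_plus l \<Longrightarrow> i \<in> I (biword_of l) \<Longrightarrow> 1 \<le> i \<and> i < length l"
  shows "Poly_Mapping.keys (lin_ext (\<lambda>w. \<Sum>i\<in>I w. basis_vec (cut w i)) x) \<subseteq>
    (biword_of ` Collect gword_plus) \<times> (biword_of ` Collect gword_plus)"
proof
  fix p assume "p \<in> Poly_Mapping.keys (lin_ext (\<lambda>w. \<Sum>i\<in>I w. basis_vec (cut w i)) x)"
  then have "(\<Sum>w\<in>Poly_Mapping.keys x. Poly_Mapping.lookup x w *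
      Poly_Mapping.lookup (\<Sum>i\<in>I w. basis_vec (cut w i)) p) \<noteq> 0"
    by (simp only: in_keys_iff lookup_lin_ext not_False_eq_True)
  then obtain w where w: "w \<in> Poly_Mapping.keys x"
      "Poly_Mapping.lookup x w * Poly_Mapping.lookup (\<Sum>i\<in>I w. basis_vec (cut w i)) p \<noteq> 0"
    by (rule sum.not_neutral_contains_not_neutral)
  obtain l where l: "w = biword_of l" "gword_plus l"
    using x w unfolding S_plus_iff by blast
  have "(\<Sum>i\<in>I w. Poly_Mapping.lookup (basis_vec (cut w i)) p :: rat) \<noteq> 0"
    using w(2) by (simp add: lookup_sum)
  then obtain i where i: "i \<in> I w" "Poly_Mapping.lookup (basis_vec (cut w i)) p \<noteq> (0 :: rat)"
    by (rule sum.not_neutral_contains_not_neutral)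
  have p: "p = cut w i" using i(2) by (simp add: lookup_single when_def split: if_splits)
  have b: "1 \<le> i" "i < length l" using I[OF l(2)] i(1) l(1) by auto
  have "gword_plus (std_word (take i l))" "gword_plus (std_word (drop i l))"
    using cut_props(1,2)[of l i] l(2) b unfolding gword_plus_def by (auto simp flip: length_greater_0_conv)
  then show "p \<in> (biword_of ` Collect gword_plus) \<times> (biword_of ` Collect gword_plus)"
    unfolding p l(1) cut_biword_of by blast
qed

text \<open>Translates the position of the letter 1 into a condition on the letters of a prefix, the
  form in which \<open>lookup_cop\<close> takes the range of cuts.\<close>

lemma pos_one_gword:
  assumes "gword_plus l"
  shows "1 \<le> pos_one (map fst l)" "pos_one (map fst l) \<le> length l"
    "i \<le> length l \<Longrightarrow> pos_one (map fst l) \<le> i \<longleftrightarrow> 1 \<in> fst ` set (take i l)"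
proof -
  have l: "distinct (map fst l)" "fst ` set l = {1..length l}" "1 \<le> length l"
    using assms gwordD[of l] by (auto simp: gword_plus_def Suc_le_eq)
  have "1 \<in> fst ` set l" unfolding l(2) using l(3) by simp
  then have "1 \<in> set (map fst l)" by (simp only: set_map)
  then obtain j where j: "j < length l" "map fst l ! j = 1"
    unfolding in_set_conv_nth by auto
  have uniq: "m = j" if "m < length l" "map fst l ! m = 1" for m
    using nth_eq_iff_index_eq[OF l(1), of m j] that j by simp
  have p: "pos_one (map fst l) = Suc j"
    unfolding pos_one_def
  proof (rule the_equality)
    show "Suc j \<in> {1..length (map fst l)} \<and> map fst l ! (Suc j - 1) = 1"
      using j by simp
    fix i assume i: "i \<in> {1..length (map fst l)} \<and> map fst l ! (i - 1) = 1"
    then have "i - 1 < length l" by auto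
    then have "i - 1 = j" using i uniq by blast
    then show "i = Suc j" using i by auto
  qed
  show "1 \<le> pos_one (map fst l)" "pos_one (map fst l) \<le> length l"
    unfolding p using j by auto
  assume i: "i \<le> length l"
  have "1 \<in> fst ` set (take i l) \<longleftrightarrow> 1 \<in> set (take i (map fst l))"
    by (simp only: set_map take_map)
  also have "\<dots> \<longleftrightarrow> (\<exists>m<i. map fst l ! m = 1)"
    unfolding in_set_conv_nth using i by (auto simp: min_def)
  also have "\<dots> \<longleftrightarrow> j < i"
    using uniq j i by (metis less_le_trans)
  finally show "pos_one (map fst l) \<le> i \<longleftrightarrow> 1 \<in> fst ` set (take i l)"
    unfolding p by auto
qed

lemma cop_lt_range:
  assumes "gword_plus l"
  shows "i \<in> {pos_one (fst (biword_of l))..<length (fst (biword_of l))} \<longleftrightarrow>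
    1 \<le> i \<and> i < length l \<and> 1 \<in> fst ` set (take i l)"
proof (cases "i < length l")
  case True
  show ?thesis
    unfolding length_fst_biword_of atLeastLessThan_iff unfolding fst_biword_of
      pos_one_gword(3)[OF assms less_imp_le[OF True], symmetric]
    using pos_one_gword(1)[OF assms] True by linarith
next
  case False
  then show ?thesis unfolding length_fst_biword_of atLeastLessThan_iff by blast
qed

lemma cop_gt_range:
  assumes "gword_plus l"
  shows "i \<in> {1..<pos_one (fst (biword_of l))} \<longleftrightarrow>
    1 \<le> i \<and> i < length l \<and> 1 \<notin> fst ` set (take i l)"
proof (cases "i < length l")
  case True
  show ?thesis
    unfolding fst_biword_of atLeastLessThan_iff
      pos_one_gword(3)[OF assms less_imp_le[OF True], symmetric]
    using True by linarith
next
  case False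
  then have "\<not> i < pos_one (map fst l)" using pos_one_gword(2)[OF assms] by linarith
  then show ?thesis unfolding fst_biword_of atLeastLessThan_iff using False by blast
qed

lemma lookup_cop_lt:
  assumes "x \<in> S_plus" "gword_plus u" "gword_plus v"
  shows "Poly_Mapping.lookup (cop_lt x) (biword_of u, biword_of v) =
    (\<Sum>S | S \<subseteq> {1..length u + length v} \<and> card S = length u \<and> 1 \<in> S. cf x (merge u v S))"
  unfolding cop_lt_def by (rule lookup_cop[OF assms]) (rule cop_lt_range)

lemma lookup_cop_gt:
  assumes "x \<in> S_plus" "gword_plus u" "gword_plus v"
  shows "Poly_Mapping.lookup (cop_gt x) (biword_of u, biword_of v) =
    (\<Sum>S | S \<subseteq> {1..length u + length v} \<and> card S = length u \<and> 1 \<notin> S. cf x (merge u v S))"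
  unfolding cop_gt_def by (rule lookup_cop[OF assms]) (rule cop_gt_range)

lemma keys_cop_lt_gt:
  assumes "x \<in> S_plus"
  shows "Poly_Mapping.keys (cop_lt x) \<subseteq> (biword_of ` Collect gword_plus) \<times> (biword_of ` Collect gword_plus)"
    "Poly_Mapping.keys (cop_gt x) \<subseteq> (biword_of ` Collect gword_plus) \<times> (biword_of ` Collect gword_plus)"
  unfolding cop_lt_def cop_gt_def
  using cop_lt_range cop_gt_range by (intro keys_cop[OF assms]; blast)+

section \<open>Stability under the coproducts\<close>

lemma search_tree_relabel_cong:
  assumes "gword u" "gword u'" "search_tree u = search_tree u'" "length u = length u'"
    and "finite S" "card S = length u"
  shows "search_tree (relabel S u) = search_tree (relabel S u')"
proof -
  have "strict_mono_on (fst ` set w) (unrank S)" if "gword w" "length w = length u" for w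
    using strict_mono_on_unrank[OF assms(5)] gwordD(2)[OF that(1)] that(2) assms(6) by simp
  then show ?thesis
    unfolding relabel_def using assms by (simp only: search_tree_map)
qed

text \<open>For fixed \<open>S\<close> both relabellings are increasing and depend only on the
  lengths. The concatenation compares letters across the factors, so the argument passes from shapes
  to search trees, which carry the letters.\<close>

lemma shape_merge_cong:
  assumes u: "gword u" "gword u'" "shape u = shape u'" and v: "gword v" "gword v'" "shape v = shape v'"
    and S: "S \<subseteq> {1..length u + length v}" "card S = length u"
  shows "shape (merge u v S) = shape (merge u' v' S)"
proof -
  have len: "length u = length u'" "length v = length v'"
    using shape_eqD(1)[OF u] shape_eqD(1)[OF v] .
  have st: "search_tree u = search_tree u'" "search_tree v = search_tree v'"
    using u v search_tree_eq_iff_shape by blast+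
  have fin: "finite S" using S(1) finite_subset by blast
  then have "card ({1..length u + length v} - S) = length v"
    using S by (simp add: card_Diff_subset)
  then have "search_tree (merge u v S) = search_tree (merge u' v' S)"
    unfolding merge_def len(1)[symmetric] len(2)[symmetric]
    using u v st len fin S by (intro search_tree_append_cong search_tree_relabel_cong) auto
  then show ?thesis by (simp only: shape_def)
qed

text \<open>The tensors \<open>tensor (tree_elt s) (tree_elt t)\<close> are indicators of products
  of sylvester classes with disjoint supports, so \<open>z\<close> is their combination with the
  coefficients found at the representatives \<open>word_of\<close>.\<close>

lemma tensor_sylvI:
  assumes keys: "Poly_Mapping.keys z \<subseteq> (biword_of ` Collect gword_plus) \<times> (biword_of ` Collect gword_plus)"
    and cong: "\<And>u u' v v'. gword_plus u \<Longrightarrow> gword_plus u' \<Longrightarrow> gword_plus v \<Longrightarrow> gword_plus v' \<Longrightarrow>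
      shape u = shape u' \<Longrightarrow> shape v = shape v' \<Longrightarrow>
      Poly_Mapping.lookup z (biword_of u, biword_of v) = Poly_Mapping.lookup z (biword_of u', biword_of v')"
  shows "z \<in> tensor_space sylv sylv"
proof -
  let ?c = "\<lambda>(s, t). Poly_Mapping.lookup z (biword_of (word_of s), biword_of (word_of t))"
  define F where "F = {p. ?c p \<noteq> 0}"
  have gF: "gtree s \<and> gtree t" if "(s, t) \<in> F" for s t
  proof -
    have "(biword_of (word_of s), biword_of (word_of t)) \<in> Poly_Mapping.keys z"
      using that by (simp add: F_def in_keys_iff)
    then have "gword_plus (word_of s)" "gword_plus (word_of t)"
      using keys by auto
    then show ?thesis by (simp only: gword_plus_word_of_iff)
  qed
  have "F \<subseteq> map_prod shape shape ` (map_prod biword_of biword_of -` Poly_Mapping.keys z)"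
  proof
    fix p assume "p \<in> F"
    then have "map_prod word_of word_of p \<in> map_prod biword_of biword_of -` Poly_Mapping.keys z"
      by (cases p) (simp add: F_def in_keys_iff)
    moreover have "p = map_prod shape shape (map_prod word_of word_of p)"
      by (cases p) (simp add: word_of_props)
    ultimately show "p \<in> map_prod shape shape ` (map_prod biword_of biword_of -` Poly_Mapping.keys z)"
      by (rule rev_image_eqI)
  qed
  moreover have "finite (map_prod shape shape ` (map_prod biword_of biword_of -` Poly_Mapping.keys z))"
    by (intro finite_imageI finite_vimageI prod.inj_map inj_biword_of) simp
  ultimately have finF: "finite F" by (rule finite_subset)
  have "z = (\<Sum>(s, t)\<in>F. scl (?c (s, t)) (tensor (tree_elt s) (tree_elt t)))"
  proof (rule poly_mapping_eqI)
    fix p :: "biword \<times> biword"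
    obtain a b where p: "p = (a, b)" by (cases p)
    have sum: "Poly_Mapping.lookup (\<Sum>(s, t)\<in>F. scl (?c (s, t)) (tensor (tree_elt s) (tree_elt t))) p =
        (\<Sum>(s, t)\<in>F. ?c (s, t) * (Poly_Mapping.lookup (tree_elt s) a * Poly_Mapping.lookup (tree_elt t) b))"
      unfolding p by (simp add: lookup_sum case_prod_beta lookup_tensor)
    show "Poly_Mapping.lookup z p =
        Poly_Mapping.lookup (\<Sum>(s, t)\<in>F. scl (?c (s, t)) (tensor (tree_elt s) (tree_elt t))) p"
    proof (cases "p \<in> (biword_of ` Collect gword_plus) \<times> (biword_of ` Collect gword_plus)")
      case True
      then obtain u v where uv: "a = biword_of u" "b = biword_of v" "gword_plus u" "gword_plus v"
        unfolding p by blast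
      have g: "gtree (shape u)" "gtree (shape v)" using uv gtree_shape by auto
      have "(\<Sum>(s, t)\<in>F. ?c (s, t) * (Poly_Mapping.lookup (tree_elt s) a * Poly_Mapping.lookup (tree_elt t) b)) =
          (\<Sum>q\<in>F. if q = (shape u, shape v) then ?c q else 0)"
      proof (rule sum.cong)
        fix q assume "q \<in> F"
        obtain s t where q: "q = (s, t)" by (cases q)
        show "(case q of (s, t) \<Rightarrow> ?c (s, t) * (Poly_Mapping.lookup (tree_elt s) a * Poly_Mapping.lookup (tree_elt t) b)) =
            (if q = (shape u, shape v) then ?c q else 0)"
          using cf_tree_elt[of s u] cf_tree_elt[of t v] uv unfolding cf_def q by auto
      qed simp
      also have "\<dots> = ?c (shape u, shape v)"
        using finF by (simp add: sum.delta F_def)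
      also have "\<dots> = Poly_Mapping.lookup z p"
        unfolding p uv(1,2) prod.case using uv g
        by (intro cong) (simp_all only: gword_plus_word_of_iff word_of_props)
      finally show ?thesis using sum by simp
    next
      case False
      have "Poly_Mapping.lookup (tree_elt s) a * Poly_Mapping.lookup (tree_elt t) b = 0" if "(s, t) \<in> F" for s t
      proof -
        have "tree_elt s \<in> S_plus" "tree_elt t \<in> S_plus"
          using gF[OF that] by (auto intro: tree_elt_S_plus simp: gtree_def)
        then have "a \<notin> Poly_Mapping.keys (tree_elt s) \<or> b \<notin> Poly_Mapping.keys (tree_elt t)"
          using False unfolding p S_plus_iff by blast
        then show ?thesis by (auto simp: in_keys_iff)
      qed
      then have "(\<Sum>(s, t)\<in>F. ?c (s, t) * (Poly_Mapping.lookup (tree_elt s) a * Poly_Mapping.lookup (tree_elt t) b)) = 0"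
        by (intro sum.neutral) auto
      moreover have "Poly_Mapping.lookup z p = 0"
        using False keys by (meson in_keys_iff subsetD)
      ultimately show ?thesis using sum by simp
    qed
  qed
  also have "\<dots> \<in> tensor_space sylv sylv"
    unfolding tensor_space_def
  proof (rule scl.span_sum)
    fix q assume "q \<in> F"
    then obtain s t where q: "q = (s, t)" "gtree s" "gtree t" using gF by (cases q) blast
    then have "tree_elt s \<in> sylv" "tree_elt t \<in> sylv"
      by (auto intro: tree_elt_sylv simp: gtree_def)
    then show "(case q of (s, t) \<Rightarrow> scl (?c (s, t)) (tensor (tree_elt s) (tree_elt t)))
        \<in> scl.span {tensor x y |x y. x \<in> sylv \<and> y \<in> sylv}"
      unfolding q(1) prod.case by (intro scl.span_scale scl.span_base) blast
  qed
  finally show ?thesis .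
qed

text \<open>In the coefficient at \<open>u\<close> and \<open>v\<close> the range of
  \<open>S\<close> depends only on the lengths and each summand only on the shapes.\<close>

lemma cop_sylv:
  assumes x: "x \<in> sylv"
  shows "cop_lt x \<in> tensor_space sylv sylv" "cop_gt x \<in> tensor_space sylv sylv"
proof -
  note xS = sylv_S_plus[OF x]
  have cong: "cf x (merge u v S) = cf x (merge u' v' S)"
    if "gword_plus u" "gword_plus u'" "gword_plus v" "gword_plus v'" "shape u = shape u'" "shape v = shape v'"
      and S: "S \<subseteq> {1..length u + length v}" "card S = length u" for u u' v v' S
  proof (rule sylv_cf_cong[OF x])
    have g: "gword u" "gword u'" "gword v" "gword v'" using that by auto
    have len: "length u = length u'" "length v = length v'"
      using shape_eqD(1)[OF g(1,2) that(5)] shape_eqD(1)[OF g(3,4) that(6)] .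
    show "gword (merge u v S)" by (rule merge_props(1)[OF g(1,3) S])
    show "gword (merge u' v' S)" by (rule merge_props(1)[OF g(2,4) S[unfolded len]])
    show "shape (merge u v S) = shape (merge u' v' S)"
      by (rule shape_merge_cong[OF g(1,2) that(5) g(3,4) that(6) S])
  qed
  have len: "length u = length u'" if "gword_plus u" "gword_plus u'" "shape u = shape u'" for u u'
    using shape_eqD(1) that by simp
  show "cop_lt x \<in> tensor_space sylv sylv"
  proof (rule tensor_sylvI[OF keys_cop_lt_gt(1)[OF xS]])
    fix u u' v v'
    assume *: "gword_plus u" "gword_plus u'" "gword_plus v" "gword_plus v'" "shape u = shape u'" "shape v = shape v'"
    show "Poly_Mapping.lookup (cop_lt x) (biword_of u, biword_of v) =
        Poly_Mapping.lookup (cop_lt x) (biword_of u', biword_of v')"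
      unfolding lookup_cop_lt[OF xS *(1,3)] lookup_cop_lt[OF xS *(2,4)]
        len[OF *(1,2,5), symmetric] len[OF *(3,4,6), symmetric]
      by (rule sum.cong[OF refl], rule cong[OF *]) blast+
  qed
  show "cop_gt x \<in> tensor_space sylv sylv"
  proof (rule tensor_sylvI[OF keys_cop_lt_gt(2)[OF xS]])
    fix u u' v v'
    assume *: "gword_plus u" "gword_plus u'" "gword_plus v" "gword_plus v'" "shape u = shape u'" "shape v = shape v'"
    show "Poly_Mapping.lookup (cop_gt x) (biword_of u, biword_of v) =
        Poly_Mapping.lookup (cop_gt x) (biword_of u', biword_of v')"
      unfolding lookup_cop_gt[OF xS *(1,3)] lookup_cop_gt[OF xS *(2,4)]
        len[OF *(1,2,5), symmetric] len[OF *(3,4,6), symmetric]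
      by (rule sum.cong[OF refl], rule cong[OF *]) blast+
  qed
qed

lemma sub_bidendriform_sylv: "sub_bidendriform sylv"
  unfolding sub_bidendriform_def using dendriform_subalgebra_sylv cop_sylv by blast

section \<open>The dendriform primitive elements\<close>

text \<open>Of two letters inserted after \<open>c\<close>, one below and one above
  \<open>c\<close>, neither becomes an ancestor of the other, because \<open>c\<close> already
  separates them; their order of insertion is immaterial. This is the basic relation of the
  sylvester congruence, applied repeatedly.\<close>

lemma search_tree_append_reorder:
  fixes u v :: "('a::linorder \<times> 'b) list"
  assumes "c \<in> fst ` set u"
  shows "search_tree (u @ v) =
    search_tree (u @ filter (\<lambda>q. c < fst q) v @ filter (\<lambda>q. fst q < c) v)"
  using assms
proof (induction u arbitrary: v rule: length_induct)
  case (1 u)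
  obtain p ps where u: "u = p # ps" using 1(2) by (cases u) auto
  let ?v = "filter (\<lambda>q. c < fst q) v @ filter (\<lambda>q. fst q < c) v"
  have IH: "search_tree (filter Q ps @ filter Q v) = search_tree (filter Q ps @ filter Q ?v)"
    if "c \<in> fst ` set (filter Q ps)" for Q
  proof -
    have "length (filter Q ps) < length u" by (simp add: u less_Suc_eq_le)
    then have "search_tree (filter Q ps @ filter Q v) = search_tree (filter Q ps @
        filter (\<lambda>q. c < fst q) (filter Q v) @ filter (\<lambda>q. fst q < c) (filter Q v))"
      using 1(1) that by blast
    also have "filter (\<lambda>q. c < fst q) (filter Q v) @ filter (\<lambda>q. fst q < c) (filter Q v) = filter Q ?v"
      by (simp add: conj_commute)
    finally show ?thesis .
  qed
  have lt: "filter (\<lambda>q. fst q < a) ?v = filter (\<lambda>q. fst q < a) v" if "a \<le> c" for a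
  proof -
    have "filter (\<lambda>q. fst q < a) (filter (\<lambda>q. c < fst q) v) = []"
      using that by (auto simp: filter_empty_conv)
    moreover have "filter (\<lambda>q. fst q < a) (filter (\<lambda>q. fst q < c) v) = filter (\<lambda>q. fst q < a) v"
      unfolding filter_filter using that by (intro filter_cong) auto
    ultimately show ?thesis by (simp only: filter_append append_Nil)
  qed
  have gt: "filter (\<lambda>q. a < fst q) ?v = filter (\<lambda>q. a < fst q) v" if "c \<le> a" for a
  proof -
    have "filter (\<lambda>q. a < fst q) (filter (\<lambda>q. fst q < c) v) = []"
      using that by (auto simp: filter_empty_conv)
    moreover have "filter (\<lambda>q. a < fst q) (filter (\<lambda>q. c < fst q) v) = filter (\<lambda>q. a < fst q) v"
      unfolding filter_filter using that by (intro filter_cong) auto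
    ultimately show ?thesis by (simp only: filter_append append_Nil2)
  qed
  have L: "search_tree (filter (\<lambda>q. fst q < fst p) ps @ filter (\<lambda>q. fst q < fst p) v) =
      search_tree (filter (\<lambda>q. fst q < fst p) ps @ filter (\<lambda>q. fst q < fst p) ?v)"
  proof (cases "fst p \<le> c")
    case True
    then show ?thesis by (simp only: lt)
  next
    case False
    then have "c \<in> fst ` set (filter (\<lambda>q. fst q < fst p) ps)"
      using 1(2) u by auto
    then show ?thesis by (rule IH)
  qed
  have R: "search_tree (filter (\<lambda>q. fst p < fst q) ps @ filter (\<lambda>q. fst p < fst q) v) =
      search_tree (filter (\<lambda>q. fst p < fst q) ps @ filter (\<lambda>q. fst p < fst q) ?v)"
  proof (cases "c \<le> fst p")
    case True
    then show ?thesis by (simp only: gt)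
  next
    case False
    then have "c \<in> fst ` set (filter (\<lambda>q. fst p < fst q) ps)"
      using 1(2) u by auto
    then show ?thesis by (rule IH)
  qed
  show ?case
    unfolding u append_Cons search_tree.simps filter_append[of _ ps] L R ..
qed

lemma gword_mset_cong:
  assumes "mset l = mset l'" "gword l"
  shows "gword l'"
proof (rule gwordI)
  note l = gwordD[OF assms(2)]
  have "mset (map fst l) = mset (map fst l')" using assms(1) by simp
  then show "distinct (map fst l')" using l(1) mset_eq_imp_distinct_iff by blast
  have s: "set l = set l'" "length l = length l'"
    using assms(1) mset_eq_setD mset_eq_length by blast+
  show "fst ` set l' = {1..length l'}" using l(2) unfolding s .
  show "1 \<le> snd p" if "p \<in> set l'" for p using l(3) that unfolding s .
qed

lemma unrank_one:
  assumes "S \<subseteq> {1..n}" "1 \<in> S"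
  shows "unrank S 1 = 1"
proof -
  have "{b \<in> S. b \<le> 1} = {1}" using assms by auto
  then have "rank S 1 = 1" by (simp add: rank_def)
  moreover have "finite S" using assms(1) finite_subset by blast
  ultimately show ?thesis using unrank_rank[of S 1] assms(2) by simp
qed

lemma cop_lt_eq_0_imp_cf_eq_0:
  assumes x: "x \<in> S_plus" "cop_lt x = 0" and l: "gword ((1, d) # ps)" "ps \<noteq> []"
  shows "cf x ((1, d) # ps) = 0"
proof -
  let ?l = "(1, d) # ps"
  let ?u = "std_word (take 1 ?l)" and ?v = "std_word (drop 1 ?l)"
  have "1 \<le> length ?l" by simp
  note c = cut_props[OF l(1) this]
  have len: "length ?u = 1" "length ?v = length ps" by simp_all
  then have "?u \<noteq> []" "?v \<noteq> []" using l(2) by (metis length_0_conv zero_neq_one)+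
  then have uv: "gword_plus ?u" "gword_plus ?v" using c(1,2) by (simp_all only: gword_plus_def simp_thms)
  \<comment> \<open>A prefix of one letter that contains 1 has letter set \<open>{1}\<close>, so the
    coefficient of \<open>cop_lt x\<close> at this cut is a single coefficient of
    \<open>x\<close>.\<close>
  have "{S. S \<subseteq> {1..length ?u + length ?v} \<and> card S = length ?u \<and> 1 \<in> S} = {{1}}"
    unfolding len by (auto simp: card_1_singleton_iff)
  then have "cf x (merge ?u ?v {1}) = 0"
    using lookup_cop_lt[OF x(1) uv] unfolding x(2) by simp
  moreover have "fst ` set (take 1 ?l) = {1}" by simp
  ultimately show ?thesis using c(5) by metis
qed

text \<open>With \<open>c\<close> the least letter in front of the letter 1, the word has the same search tree as a word
  \<open>a @ b\<close> in which \<open>b\<close> begins with 1 and contains exactly the letters below \<open>c\<close>. In the coefficient of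
  \<open>cop_gt x\<close> at the cut of \<open>a @ b\<close> between \<open>a\<close> and \<open>b\<close>, every other term has a smaller \<open>c\<close>.\<close>

lemma primitive_cf_eq_0_aux:
  assumes x: "x \<in> sylv" "cop_gt x = 0"
  shows "gword (u @ (1, d) # r) \<Longrightarrow> u \<noteq> [] \<Longrightarrow> cf x (u @ (1, d) # r) = 0"
proof (induction "Min (fst ` set u)" arbitrary: u d r rule: less_induct)
  case less
  define c where "c = Min (fst ` set u)"
  define v where "v = (1, d) # r"
  have l: "gword (u @ v)" using less.prems by (simp only: v_def)
  have ne: "fst ` set u \<noteq> {}" using less.prems by simp
  have c: "c \<in> fst ` set u" unfolding c_def using ne by (intro Min_in) simp_all
  have cu: "c \<le> fst q" if "q \<in> set u" for q
    unfolding c_def using that by (intro Min_le) auto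
  have disj: "fst ` set u \<inter> fst ` set v = {}"
    using gwordD(1)[OF l] unfolding map_append distinct_append set_map by blast
  have "1 \<in> fst ` set v" by (simp add: v_def)
  then have "c \<noteq> 1" using c disj by blast
  moreover have "c \<in> {1..length (u @ v)}"
    using c unfolding gwordD(2)[OF l, symmetric] set_append image_Un by blast
  ultimately have c1: "1 < c" by simp
  have cv: "fst q \<noteq> c" if "q \<in> set v" for q
  proof -
    have "fst q \<in> fst ` set v" using that by (rule imageI)
    then show ?thesis using c disj by blast
  qed
  \<comment> \<open>Moving the large letters of \<open>v\<close> forward keeps the tree because
    \<open>c\<close> already occurs in \<open>u\<close>, and \<open>c\<close> stays the least letter
    of the prefix.\<close>
  define a where "a = u @ filter (\<lambda>q. c < fst q) v"
  define b where "b = filter (\<lambda>q. fst q < c) v"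
  have b_eq: "b = (1, d) # filter (\<lambda>q. fst q < c) r"
    using c1 by (simp add: b_def v_def)
  have "filter (\<lambda>q. fst q < c) v = filter (\<lambda>q. \<not> c < fst q) v"
  proof (rule filter_cong)
    fix q assume "q \<in> set v"
    then have "fst q \<noteq> c" by (rule cv)
    then show "fst q < c \<longleftrightarrow> \<not> c < fst q" by auto
  qed simp
  then have "mset (filter (\<lambda>q. c < fst q) v) + mset b = mset v"
    unfolding b_def by (simp only: mset_filter multiset_partition[symmetric])
  then have "mset (u @ v) = mset (a @ b)"
    unfolding a_def by (simp only: mset_append add.assoc)
  then have gl: "gword (a @ b)" using l by (rule gword_mset_cong)
  have "search_tree (u @ v) = search_tree (a @ b)"
    using search_tree_append_reorder[OF c, of v] by (simp add: a_def b_def)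
  then have "shape (u @ v) = shape (a @ b)" by (simp only: shape_def)
  then have eq: "cf x (u @ v) = cf x (a @ b)" by (rule sylv_cf_cong[OF x(1) l gl])
  let ?k = "length a"
  have k: "?k \<le> length (a @ b)" by simp
  note cp = cut_props[OF gl k]
  have td: "take ?k (a @ b) = a" "drop ?k (a @ b) = b" by simp_all
  note cp = cp[unfolded td]
  have abne: "a \<noteq> []" "b \<noteq> []" using less.prems(2) by (simp_all add: a_def b_eq)
  have "std_word a \<noteq> []" "std_word b \<noteq> []"
    using abne length_std_word[of a] length_std_word[of b] by (metis length_0_conv)+
  then have uv: "gword_plus (std_word a)" "gword_plus (std_word b)"
    using cp(1,2) by (simp_all only: gword_plus_def simp_thms)
  let ?n = "length a + length b"
  let ?A = "fst ` set a"
  let ?SS = "{S. S \<subseteq> {1..?n} \<and> card S = length a \<and> 1 \<notin> S}"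
  have A_ge: "c \<le> y" if "y \<in> ?A" for y
    using that cu unfolding a_def set_append image_Un by auto
  have n: "length (a @ b) = ?n" by simp
  have A: "?A \<in> ?SS"
    using cp(3,4) A_ge[of 1] c1 unfolding n by auto
  have "fst ` set (a @ b) = {1..?n}" using gwordD(2)[OF gl] by (simp only: n)
  \<comment> \<open>Together with \<open>A_ge\<close>, this makes \<open>?A\<close> the interval
    from \<open>c\<close> to \<open>?n\<close>. A different set of the same size must then contain a
    letter below \<open>c\<close>.\<close>
  then have A_all: "y \<in> ?A" if "y \<in> {1..?n}" "c \<le> y" for y
  proof -
    have "y \<notin> fst ` set b" using that(2) by (auto simp: b_def)
    moreover have "y \<in> ?A \<union> fst ` set b"
      using that(1) \<open>fst ` set (a @ b) = {1..?n}\<close> by (simp only: set_append image_Un)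
    ultimately show ?thesis by blast
  qed
  have zero: "cf x (merge (std_word a) (std_word b) S) = 0" if S: "S \<in> ?SS - {?A}" for S
  proof -
    have S': "S \<subseteq> {1..?n}" "card S = length a" "1 \<notin> S" "S \<noteq> ?A" using S by blast+
    have finS: "finite S" using S'(1) finite_subset by blast
    have "S \<noteq> {}" using S'(2) abne by auto
    have "\<not> S \<subseteq> ?A"
    proof
      assume "S \<subseteq> ?A"
      then have "S = ?A" using S'(2) cp(4) by (intro card_subset_eq) simp_all
      then show False using S'(4) by blast
    qed
    then obtain y where y: "y \<in> S" "y < c" using A_all S'(1) by (metis linorder_not_le subset_iff)
    have Min: "Min S < c" using Min_le[OF finS y(1)] y(2) by linarith
    let ?C = "{1..?n} - S"
    \<comment> \<open>As 1 is the least letter both of \<open>b\<close> and of the complement of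
      \<open>S\<close>, relabelling leaves it, with its degree, at the front of the suffix. The term
      thus has the form required by the induction hypothesis.\<close>
    have "rank (fst ` set b) 1 = 1"
    proof -
      have "fst ` set b \<subseteq> {1..?n}"
        using \<open>fst ` set (a @ b) = {1..?n}\<close> unfolding set_append image_Un by blast
      then have "{y \<in> fst ` set b. y \<le> 1} = {1}" by (auto simp: b_eq)
      then show ?thesis by (simp add: rank_def)
    qed
    then obtain r' where r': "std_word b = (1, d) # r'"
      unfolding std_word_def by (simp add: b_eq)
    have "1 \<in> ?C" using S'(3) abne by (auto simp: Suc_le_eq)
    then have "unrank ?C 1 = 1" by (intro unrank_one[of _ ?n]) auto
    then have rC: "relabel ?C (std_word b) = (1, d) # relabel ?C r'"
      by (simp add: r' relabel_def)
    let ?p = "relabel S (std_word a)"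
    have "merge (std_word a) (std_word b) S = ?p @ relabel ?C (std_word b)"
      by (simp add: merge_def)
    then have m: "merge (std_word a) (std_word b) S = ?p @ (1, d) # relabel ?C r'"
      unfolding rC .
    have cardS: "card S = length (std_word a)" using S'(2) by simp
    have g: "gword (merge (std_word a) (std_word b) S)"
      using S'(1) cardS by (intro merge_props(1)[OF cp(1,2)]) simp_all
    have "fst ` set ?p = S" by (rule relabel_props(1)[OF cp(1) finS cardS])
    moreover have "?p \<noteq> []" using abne by (metis length_0_conv length_relabel length_std_word)
    ultimately show ?thesis
      using less.hyps[of ?p d "relabel ?C r'"] Min g unfolding m c_def by simp
  qed
  have "(\<Sum>S\<in>?SS. cf x (merge (std_word a) (std_word b) S)) = 0"
    using lookup_cop_gt[OF sylv_S_plus[OF x(1)] uv] unfolding x(2) length_std_word by simp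
  moreover have "(\<Sum>S\<in>?SS. cf x (merge (std_word a) (std_word b) S)) =
      cf x (merge (std_word a) (std_word b) ?A) + (\<Sum>S\<in>?SS - {?A}. cf x (merge (std_word a) (std_word b) S))"
    using A by (intro sum.remove) (auto intro: finite_subset[of _ "Pow {1..?n}"])
  moreover have "(\<Sum>S\<in>?SS - {?A}. cf x (merge (std_word a) (std_word b) S)) = 0"
    using zero by (intro sum.neutral ballI)
  ultimately have "cf x (a @ b) = 0" unfolding cp(5) by simp
  then show ?case using eq by (simp only: v_def)
qed

text \<open>If the word starts with 1, a cut after this letter belongs to \<open>cop_lt\<close>;
  otherwise a cut before it belongs to \<open>cop_gt\<close>.\<close>

lemma primitive_cf_eq_0:
  assumes x: "x \<in> sylv" "cop_lt x = 0" "cop_gt x = 0" and l: "gword l" "2 \<le> length l"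
  shows "cf x l = 0"
proof -
  have "1 \<in> fst ` set l" unfolding gwordD(2)[OF l(1)] using l(2) by simp
  then obtain q where q: "q \<in> set l" "fst q = 1" by auto
  obtain u r where u: "l = u @ q # r" using split_list[OF q(1)] by blast
  obtain d where d: "q = (1, d)" using q(2) by (cases q) simp
  show ?thesis
  proof (cases "u = []")
    case True
    then have "r \<noteq> []" "l = (1, d) # r" using l(2) u d by auto
    then show ?thesis using cop_lt_eq_0_imp_cf_eq_0[OF sylv_S_plus[OF x(1)] x(2)] l(1) by blast
  next
    case False
    then show ?thesis using primitive_cf_eq_0_aux[OF x(1,3)] l(1) unfolding u d by blast
  qed
qed

lemma letters_cf_eq_0:
  assumes "x \<in> letters" "2 \<le> length l"
  shows "cf x l = 0"
proof -
  have "cf (letter d) l = 0" for d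
  proof -
    have "length l = 1" if "gword l" "shape l = Node Leaf d Leaf"
      using size_shape_gword[OF that(1)] that(2) by simp
    then show ?thesis using assms(2) by (auto simp: cf_tree_elt)
  qed
  moreover have "scl.subspace {x. cf x l = 0}"
    by (rule scl.subspaceI) auto
  ultimately have "letters \<subseteq> {x. cf x l = 0}"
    unfolding letters_def by (intro scl.span_minimal) auto
  then show ?thesis using assms(1) by blast
qed

lemma dendriform_primitives_sylv: "dendriform_primitives sylv = letters"
proof
  show "dendriform_primitives sylv \<subseteq> letters"
  proof
    fix x assume "x \<in> dendriform_primitives sylv"
    then have x: "x \<in> sylv" "cop_lt x = 0" "cop_gt x = 0"
      by (simp_all add: dendriform_primitives_def)
    have "scl (tcoef x t) (tree_elt t) \<in> letters" if t: "t \<in> tsupp x" for t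
    proof -
      have g: "gtree t" by (rule gtree_tsupp[OF sylv_S_plus[OF x(1)] t])
      then have "gword (word_of t)" "t \<noteq> Leaf" by (simp_all add: gword_word_of_iff gtree_def)
      then have "\<not> 2 \<le> length (word_of t)"
        using primitive_cf_eq_0[OF x, of "word_of t"] t by (auto simp: tsupp_def tcoef_def)
      then have "size t < 2" by (simp only: word_of_props not_le)
      then obtain d where d: "t = Node Leaf d Leaf"
        using \<open>t \<noteq> Leaf\<close> by (cases t) auto
      then have "1 \<le> d" using g by (simp add: gtree_def)
      then show ?thesis
        unfolding d using letter_in_letters scl.subspace_scale[OF subspace_letters] by blast
    qed
    then have "(\<Sum>t\<in>tsupp x. scl (tcoef x t) (tree_elt t)) \<in> letters"
      by (intro scl.subspace_sum subspace_letters)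
    then show "x \<in> letters" using sylv_expansion[OF x(1)] by simp
  qed
  show "letters \<subseteq> dendriform_primitives sylv"
  proof
    fix x assume x: "x \<in> letters"
    then have sx: "x \<in> sylv" using letters_subset_sylv by blast
    note S = sylv_S_plus[OF sx]
    \<comment> \<open>Both factors of a cut are nonempty, so the coproducts only see coefficients at
      words of length at least 2, where combinations of letters vanish.\<close>
    have m: "cf x (merge u v T) = 0" if "gword_plus u" "gword_plus v" for u v T
    proof (rule letters_cf_eq_0[OF x])
      have "1 \<le> length u" "1 \<le> length v" using that by (auto simp: gword_plus_def Suc_le_eq)
      then show "2 \<le> length (merge u v T)" by simp
    qed
    have "z = 0" if "Poly_Mapping.keys z \<subseteq> (biword_of ` Collect gword_plus) \<times> (biword_of ` Collect gword_plus)"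
      "\<And>u v. gword_plus u \<Longrightarrow> gword_plus v \<Longrightarrow> Poly_Mapping.lookup z (biword_of u, biword_of v) = 0"
      for z :: "biword \<times> biword \<Rightarrow>\<^sub>0 rat"
    proof -
      have "Poly_Mapping.keys z = {}"
      proof (rule ccontr)
        assume "Poly_Mapping.keys z \<noteq> {}"
        then obtain p where p: "p \<in> Poly_Mapping.keys z" by blast
        then have "p \<in> (biword_of ` Collect gword_plus) \<times> (biword_of ` Collect gword_plus)"
          using that(1) by blast
        then obtain u v where "gword_plus u" "gword_plus v" "p = (biword_of u, biword_of v)"
          by blast
        then show False using that(2) p by (simp add: in_keys_iff)
      qed
      then show ?thesis by simp
    qed
    note zero = this
    have "cop_lt x = 0"
      by (rule zero[OF keys_cop_lt_gt(1)[OF S]]) (simp only: lookup_cop_lt[OF S] m sum.neutral_const)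
    moreover have "cop_gt x = 0"
      by (rule zero[OF keys_cop_lt_gt(2)[OF S]]) (simp only: lookup_cop_gt[OF S] m sum.neutral_const)
    ultimately show "x \<in> dendriform_primitives sylv"
      using sx by (simp add: dendriform_primitives_def)
  qed
qed

theorem corollary19:
  shows "sub_bidendriform Descd_plus \<and>
         freely_generated_dendriform TYPE('b::ab_group_add) scl Descd_plus lt_S gt_S
           (dendriform_primitives Descd_plus)"
  unfolding Descd_plus_eq_sylv dendriform_primitives_sylv
  using sub_bidendriform_sylv freely_generated_letters by blast

end
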